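(* There is a polynomial-time algorithm approximating unweighted \texttt{MDD(max)} on cubic (3-regular) input graphs within a factor of $1.583$.
   Context: \texttt{MDD(max)}: given a finite simple undirected graph $G=(V,E)$ and a distinguished vertex $p\in V$, find a set $S\subseteq V\setminus\{p\}$ of minimum cardinality such that $p$ is the unique vertex of maximum degree in the induced subgraph $G[V\setminus S]$. *)

theory Defs
  imports Complex_Main "HOL-Computational_Algebra.Polynomial"
begin

section \<open>Finite simple undirected graphs\<close>

text \<open>A graph is given by a vertex set \<open>V\<close> and a set \<open>E\<close> of two-element sets of vertices.\<close>

definition simple_graph :: "'a set \<Rightarrow> 'a set set \<Rightarrow> bool" where
  "simple_graph V E \<longleftrightarrow> finite V \<and> E \<subseteq> {e. e \<subseteq> V \<and> card e = 2}"

definition vertex_degree :: "'a set set \<Rightarrow> 'a \<Rightarrow> nat" where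
  "vertex_degree E v = card {e \<in> E. v \<in> e}"

definition cubic_graph :: "'a set \<Rightarrow> 'a set set \<Rightarrow> bool" where
  "cubic_graph V E \<longleftrightarrow> simple_graph V E \<and> (\<forall>v \<in> V. vertex_degree E v = 3)"

definition induced_edges :: "'a set set \<Rightarrow> 'a set \<Rightarrow> 'a set set" where
  "induced_edges E W = {e \<in> E. e \<subseteq> W}"

definition unique_max_degree_vertex :: "'a set \<Rightarrow> 'a set set \<Rightarrow> 'a \<Rightarrow> bool" where
  "unique_max_degree_vertex V E p \<longleftrightarrow>
     p \<in> V \<and> (\<forall>v \<in> V. v \<noteq> p \<longrightarrow> vertex_degree E v < vertex_degree E p)"


section \<open>The problem MDD(max)\<close>

definition mdd_max_feasible :: "'a set \<Rightarrow> 'a set set \<Rightarrow> 'a \<Rightarrow> 'a set \<Rightarrow> bool" where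
  "mdd_max_feasible V E p S \<longleftrightarrow>
     S \<subseteq> V - {p} \<and> unique_max_degree_vertex (V - S) (induced_edges E (V - S)) p"

definition mdd_max_opt :: "'a set \<Rightarrow> 'a set set \<Rightarrow> 'a \<Rightarrow> nat" where
  "mdd_max_opt V E p = Min (card ` {S. mdd_max_feasible V E p S})"

text \<open>
  Deleting every vertex but \<open>p\<close> is always feasible, so the minimum is taken over a finite
  nonempty set.
\<close>

lemma mdd_max_feasible_all:
  assumes "p \<in> V"
  shows "mdd_max_feasible V E p (V - {p})"
  using assms by (auto simp: mdd_max_feasible_def unique_max_degree_vertex_def)

lemma finite_mdd_max_feasible:
  assumes "finite V"
  shows "finite {S. mdd_max_feasible V E p S}"
  by (rule finite_subset[of _ "Pow V"]) (use assms in \<open>auto simp: mdd_max_feasible_def\<close>)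


section \<open>Model of computation\<close>

text \<open>
  Algorithms are programs of a random access machine in structured form. A program works on
  finitely many named unbounded arrays of natural numbers; a scalar variable is an array that is
  only used at index 0. The arithmetic operations are addition and truncated subtraction.
  Multiplication is deliberately absent: under the unit cost measure used here, the bit length of
  the largest stored number then grows by at most a constant in each step, so that polynomial time
  on this machine coincides with polynomial time on Turing machines.
\<close>

type_synonym store = "string \<Rightarrow> nat \<Rightarrow> nat"

datatype aexp =
    Const nat
  | Read string aexp
  | Plus aexp aexp
  | Minus aexp aexp

datatype bexp =
    Less aexp aexp
  | Equal aexp aexp
  | Neg bexp
  | Conj bexp bexp

datatype com =
    Skip
  | Write string aexp aexp
  | Seq com com
  | Cond bexp com com
  | Loop bexp com

primrec aval :: "aexp \<Rightarrow> store \<Rightarrow> nat" where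
  "aval (Const k) s = k"
| "aval (Read x a) s = s x (aval a s)"
| "aval (Plus a b) s = aval a s + aval b s"
| "aval (Minus a b) s = aval a s - aval b s"

primrec bval :: "bexp \<Rightarrow> store \<Rightarrow> bool" where
  "bval (Less a b) s \<longleftrightarrow> aval a s < aval b s"
| "bval (Equal a b) s \<longleftrightarrow> aval a s = aval b s"
| "bval (Neg b) s \<longleftrightarrow> \<not> bval b s"
| "bval (Conj b c) s \<longleftrightarrow> bval b s \<and> bval c s"

primrec acost :: "aexp \<Rightarrow> nat" where
  "acost (Const k) = 1"
| "acost (Read x a) = acost a + 1"
| "acost (Plus a b) = acost a + acost b + 1"
| "acost (Minus a b) = acost a + acost b + 1"

primrec bcost :: "bexp \<Rightarrow> nat" where
  "bcost (Less a b) = acost a + acost b + 1"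
| "bcost (Equal a b) = acost a + acost b + 1"
| "bcost (Neg b) = bcost b + 1"
| "bcost (Conj b c) = bcost b + bcost c + 1"

text \<open>
  \<open>exec c s t s'\<close>: started in store \<open>s\<close>, the program \<open>c\<close> halts after exactly \<open>t\<close> elementary
  steps in store \<open>s'\<close>.
\<close>

inductive exec :: "com \<Rightarrow> store \<Rightarrow> nat \<Rightarrow> store \<Rightarrow> bool" where
  Skip: "exec Skip s 1 s"
| Write: "exec (Write x a b) s (acost a + acost b + 1) (s(x := (s x)(aval a s := aval b s)))"
| Seq: "exec c1 s t1 s1 \<Longrightarrow> exec c2 s1 t2 s2 \<Longrightarrow> exec (Seq c1 c2) s (t1 + t2) s2"
| Cond_True: "bval b s \<Longrightarrow> exec c1 s t s1 \<Longrightarrow> exec (Cond b c1 c2) s (bcost b + t + 1) s1"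
| Cond_False: "\<not> bval b s \<Longrightarrow> exec c2 s t s1 \<Longrightarrow> exec (Cond b c1 c2) s (bcost b + t + 1) s1"
| Loop_False: "\<not> bval b s \<Longrightarrow> exec (Loop b c) s (bcost b + 1) s"
| Loop_True: "bval b s \<Longrightarrow> exec c s t1 s1 \<Longrightarrow> exec (Loop b c) s1 t2 s2 \<Longrightarrow>
    exec (Loop b c) s (bcost b + t1 + t2 + 1) s2"

inductive_cases exec_SkipE: "exec Skip s t s'"
inductive_cases exec_WriteE: "exec (Write x a b) s t s'"
inductive_cases exec_SeqE: "exec (Seq c1 c2) s t s'"
inductive_cases exec_CondE: "exec (Cond b c1 c2) s t s'"
inductive_cases exec_LoopE: "exec (Loop b c) s t s'"

lemma exec_deterministic:
  "exec c s t s' \<Longrightarrow> exec c s u s'' \<Longrightarrow> u = t \<and> s'' = s'"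
proof (induction arbitrary: u s'' rule: exec.induct)
  case (Skip s)
  then show ?case by (auto elim: exec_SkipE)
next
  case (Write x a b s)
  then show ?case by (auto elim: exec_WriteE)
next
  case (Seq c1 s t1 s1 c2 t2 s2)
  from Seq.prems show ?case by (rule exec_SeqE) (metis Seq.IH)
next
  case (Cond_True b s c1 t s1 c2)
  from Cond_True.prems show ?case by (rule exec_CondE) (metis Cond_True.IH Cond_True.hyps(1) Suc_eq_plus1)+
next
  case (Cond_False b s c2 t s1 c1)
  from Cond_False.prems show ?case by (rule exec_CondE) (metis Cond_False.IH Cond_False.hyps(1) Suc_eq_plus1)+
next
  case (Loop_False b s c)
  from Loop_False.prems show ?case by (rule exec_LoopE) (metis Loop_False.hyps(1) Suc_eq_plus1)+
next
  case (Loop_True b s c t1 s1 t2 s2)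
  from Loop_True.prems show ?case by (rule exec_LoopE) (metis Loop_True.IH Loop_True.hyps(1) Suc_eq_plus1)+
qed


section \<open>Encoding of instances and solutions\<close>

text \<open>
  An instance has vertex set \<open>{..<n}\<close> and is stored as \<open>n\<close>, the distinguished vertex \<open>p\<close>, and the
  adjacency matrix in row-major order; all other cells are 0. The length of this encoding is
  polynomially related to \<open>n\<close>. A solution is read off as a characteristic vector.
\<close>

definition mdd_input :: "nat \<Rightarrow> nat set set \<Rightarrow> nat \<Rightarrow> store" where
  "mdd_input n E p = (\<lambda>x i.
     if x = ''n'' \<and> i = 0 then n
     else if x = ''p'' \<and> i = 0 then p
     else if x = ''adj'' \<and> i < n * n \<and> {i div n, i mod n} \<in> E then 1
     else 0)"

definition mdd_output :: "nat \<Rightarrow> store \<Rightarrow> nat set" where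
  "mdd_output n s = {v. v < n \<and> s ''sol'' v \<noteq> 0}"

end

theory Submission
  imports Defs
begin

text \<open>
  If \<open>S\<close> is feasible, every remaining vertex other than \<open>p\<close> has a neighbour in \<open>S\<close>, so
  \<open>4 |S| \<ge> n - 1\<close>. If \<open>S\<close> also meets the neighbourhood of \<open>p\<close>, these vertices have two neighbours in
  \<open>S\<close>, so \<open>5 |S| \<ge> 2 (n - 1)\<close>. Bounds in terms of \<open>n\<close> alone therefore suffice: a dominating set with at
  most \<open>15/38 n\<close> vertices in the first case and a set of at most \<open>3/5 n\<close> vertices
  containing two neighbours of every other vertex in the second. Either set differs from a feasible solution in at most 13 vertices,
  which are found by exhaustive search; the additive constants are absorbed by a lookup table for the
  instances with fewer than 20000 vertices. (The generic bound \<open>H\<^sub>4 - 1/2 = 19/12\<close> for covering by sets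
  of size 4 exceeds 1.583.)

  Both sets are local optima under exchanges of at most 13 vertices. For domination the objective is
  lexicographic: the size of \<open>D\<close>, the number of edges inside \<open>D\<close>, the number of vertices outside \<open>D\<close>
  with exactly one neighbour in \<open>D\<close>. In a local optimum every vertex has charge 3; the vertices outside
  \<open>D\<close> distribute theirs, and every vertex of \<open>D\<close> ends up with at least \<open>38/5\<close>.
\<close>

section \<open>Locally optimal dominating sets in cubic graphs\<close>

text \<open>Charge 3 per vertex and \<open>38/5\<close> per vertex of \<open>D\<close> give
  \<open>38/5 |D| \<le> 3 n\<close>, the source of \<open>15/38\<close>. Against the bound
  \<open>(n - 1) / 4\<close> this is a ratio tending to \<open>30/19 = 1.5789...\<close>; the other
  case gives \<open>(3/5) / (2/5) = 3/2\<close>. The obstacle is a vertex of \<open>D\<close> that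
  is nobody's only dominator: all its neighbours are shared, so it collects little. Minimal size
  restricts how such vertices cluster. Few inner edges give two private neighbours to every vertex
  of \<open>D\<close> that has a neighbour in \<open>D\<close>. The third component forces the
  vertices just beyond a poor configuration to have two dominators, and then they have charge to
  spare; this is why charge travels two steps. The radius 13 comes from the repair of a dominating
  set: the closed neighbourhood of \<open>p\<close> (4 vertices) is removed and at most 9 vertices
  are covered anew. The exchanges of the charging argument are smaller. The three objectives are
  packed into one sum of vertex weights of polynomial size, so the number of improvements is
  polynomial.\<close>

locale cubic_nbhd =
  fixes V :: "'a set" and N :: "'a \<Rightarrow> 'a set"
  assumes finite_V: "finite V"
    and N_sub: "N v \<subseteq> V"
    and N_sym: "w \<in> N v \<Longrightarrow> v \<in> N w"
    and N_irrefl: "v \<notin> N v"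
    and card_N: "v \<in> V \<Longrightarrow> card (N v) = 3"
begin

definition dominating :: "'a set \<Rightarrow> bool" where
  "dominating D \<longleftrightarrow> D \<subseteq> V \<and> (\<forall>z\<in>V - D. N z \<inter> D \<noteq> {})"

text \<open>Twice the number of edges inside \<open>D\<close>.\<close>

definition inner :: "'a set \<Rightarrow> nat" where
  "inner D = (\<Sum>u\<in>D. card (N u \<inter> D))"

definition once :: "'a set \<Rightarrow> 'a set" where
  "once D = {u \<in> V - D. card (N u \<inter> D) = 1}"

lemma finite_N [simp]: "finite (N v)"
  using finite_subset[OF N_sub finite_V] .

lemma N_sym_iff: "w \<in> N v \<longleftrightarrow> v \<in> N w"
  using N_sym by blast

lemma N_V: "w \<in> N v \<Longrightarrow> w \<in> V" "w \<in> N v \<Longrightarrow> v \<in> V"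
  using N_sub N_sym by blast+

lemma N_eq3:
  assumes "a \<in> N v" "b \<in> N v" "c \<in> N v" "a \<noteq> b" "a \<noteq> c" "b \<noteq> c"
  shows "N v = {a, b, c}"
proof -
  have "card {a, b, c} = card (N v)"
    using assms card_N[of v] N_V(2)[OF assms(1)] by simp
  then show ?thesis
    using card_subset_eq[OF finite_N, of "{a,b,c}" v] assms by auto
qed

lemma N_third:
  assumes "a \<in> N v" "b \<in> N v" "a \<noteq> b"
  obtains c where "N v = {a, b, c}" "c \<noteq> a" "c \<noteq> b"
proof -
  have "card (N v - {a, b}) = 1"
    using assms card_N[of v] N_V(2)[OF assms(1)] by (simp add: card_Diff_subset)
  then obtain c where "N v - {a, b} = {c}" by (auto simp: card_1_singleton_iff)
  then show thesis using that assms by blast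
qed

lemma N_others:
  assumes "a \<in> N v"
  obtains b c where "N v = {a, b, c}" "a \<noteq> b" "a \<noteq> c" "b \<noteq> c"
proof -
  have "card (N v - {a}) = 2"
    using assms card_N[of v] N_V(2)[OF assms] by (simp add: card_Diff_subset)
  then obtain b c where "N v - {a} = {b, c}" "b \<noteq> c" by (auto simp: card_2_iff)
  then show thesis using that assms by blast
qed

end

locale local_opt = cubic_nbhd +
  fixes D :: "'a set"
  assumes dom: "dominating D"
    and opt_card: "\<lbrakk>R \<subseteq> D; A \<subseteq> V - D; card R + card A \<le> 13; dominating (D - R \<union> A)\<rbrakk>
      \<Longrightarrow> card R \<le> card A"
    and opt_inner: "\<lbrakk>R \<subseteq> D; A \<subseteq> V - D; card R + card A \<le> 13; dominating (D - R \<union> A); card R = card A\<rbrakk>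
      \<Longrightarrow> inner D \<le> inner (D - R \<union> A)"
    and opt_once: "\<lbrakk>R \<subseteq> D; A \<subseteq> V - D; card R + card A \<le> 13; dominating (D - R \<union> A); card R = card A;
        inner (D - R \<union> A) = inner D\<rbrakk>
      \<Longrightarrow> card (once D) \<le> card (once (D - R \<union> A))"
begin

text \<open>A vertex satisfying \<open>lone\<close> is needed in \<open>D\<close> only to dominate itself; these are the vertices whose
  own share of the charge may be too small.\<close>

definition dn :: "'a \<Rightarrow> 'a set" where "dn z = N z \<inter> D"
definition priv :: "'a \<Rightarrow> 'a set" where "priv v = {u \<in> N v - D. dn u = {v}}"
definition iso :: "'a \<Rightarrow> bool" where "iso v \<longleftrightarrow> v \<in> D \<and> dn v = {}"
definition lone :: "'a \<Rightarrow> bool" where "lone v \<longleftrightarrow> iso v \<and> priv v = {}"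
definition deg :: "'a \<Rightarrow> nat" where "deg u = card (dn u)"
definition twice :: "'a \<Rightarrow> nat" where "twice v = card {u \<in> N v. deg u = 2}"
definition nlone :: "'a \<Rightarrow> nat" where "nlone u = card {v \<in> dn u. lone v}"

lemma D_V: "D \<subseteq> V" using dom by (simp add: dominating_def)

lemma finite_D [simp]: "finite D" using finite_subset[OF D_V finite_V] .

lemma finite_dn [simp]: "finite (dn z)" by (simp add: dn_def)

lemma mem_dn: "v \<in> dn z \<longleftrightarrow> v \<in> D \<and> z \<in> N v"
  using N_sym_iff by (auto simp: dn_def)

lemma dn_nonempty: "z \<in> V \<Longrightarrow> z \<notin> D \<Longrightarrow> dn z \<noteq> {}"
  using dom by (auto simp: dominating_def dn_def)

lemma deg_le3: "deg z \<le> 3"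
proof (cases "z \<in> V")
  case True
  then show ?thesis using card_mono[of "N z" "N z \<inter> D"] card_N[of z] by (simp add: deg_def dn_def)
next
  case False
  then have "N z = {}" using N_V(2) by blast
  then show ?thesis by (simp add: deg_def dn_def)
qed

lemma deg_le2:
  assumes "p \<in> N r" "p \<notin> D"
  shows "deg r \<le> 2"
proof -
  have "dn r \<subseteq> N r - {p}" using assms by (auto simp: dn_def)
  then have "deg r \<le> card (N r - {p})" by (simp add: deg_def card_mono)
  then show ?thesis using assms card_N[of r] N_V(2)[OF assms(1)] by (simp add: card_Diff_subset)
qed

lemma deg3_N: "deg u = 3 \<Longrightarrow> u \<in> V \<Longrightarrow> N u \<subseteq> D"
  using deg_le2[of _ u] by fastforce

section \<open>Exchanges \<open>D - R \<union> A\<close> and their first consequences\<close>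

lemma dominating_exchange:
  assumes "R \<subseteq> D" "A \<subseteq> V"
    and "\<And>z. z \<in> R \<Longrightarrow> N z \<inter> A \<noteq> {} \<or> dn z - R \<noteq> {}"
    and "\<And>z. z \<in> V \<Longrightarrow> z \<notin> D \<Longrightarrow> dn z \<noteq> {} \<Longrightarrow> dn z \<subseteq> R \<Longrightarrow> z \<notin> A \<Longrightarrow> N z \<inter> A \<noteq> {}"
  shows "dominating (D - R \<union> A)"
  unfolding dominating_def
proof (intro conjI ballI)
  show "D - R \<union> A \<subseteq> V" using assms(2) D_V by blast
  fix z assume z: "z \<in> V - (D - R \<union> A)"
  show "N z \<inter> (D - R \<union> A) \<noteq> {}"
  proof (cases "z \<in> R")
    case True
    then show ?thesis using assms(3)[of z] z by (auto simp: dn_def)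
  next
    case False
    then have "z \<notin> D" "z \<in> V" "z \<notin> A" using z by auto
    then show ?thesis using assms(4)[of z] dn_nonempty[of z] by (auto simp: dn_def)
  qed
qed

text \<open>The bound 6 on \<open>card R\<close> keeps \<open>card R + card A\<close> within the
  radius 13; the variants below, with equal cardinalities, use the same bound.\<close>

lemma exchange_card:
  assumes "R \<subseteq> D" "A \<subseteq> V - D" "card R \<le> 6" "card A < card R"
    and "\<And>z. z \<in> R \<Longrightarrow> N z \<inter> A \<noteq> {} \<or> dn z - R \<noteq> {}"
    and "\<And>z. z \<in> V \<Longrightarrow> z \<notin> D \<Longrightarrow> dn z \<noteq> {} \<Longrightarrow> dn z \<subseteq> R \<Longrightarrow> z \<notin> A \<Longrightarrow> N z \<inter> A \<noteq> {}"
  shows False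
proof -
  have "dominating (D - R \<union> A)"
    using dominating_exchange[OF assms(1) _ assms(5,6)] assms(2) by blast
  from opt_card[OF assms(1,2) _ this] show False using assms(3,4) by linarith
qed

text \<open>The vertices of \<open>A\<close> are isolated in the new set, so no inner edge is
  gained, while every removed vertex takes its inner edges along. Summing \<open>deg\<close> over
  \<open>R\<close> counts the loss from the side of \<open>R\<close> only, hence an
  inequality.\<close>

lemma inner_exchange:
  assumes "R \<subseteq> D" "A \<subseteq> V - D" "\<And>a. a \<in> A \<Longrightarrow> N a \<inter> (D - R \<union> A) = {}"
  shows "inner (D - R \<union> A) + (\<Sum>u\<in>R. deg u) \<le> inner D"
proof -
  have "finite (V - D)" using finite_V by blast
  then have fA: "finite A" using assms(2) by (rule finite_subset[rotated])
  have "inner (D - R \<union> A) = (\<Sum>u\<in>D - R. card (N u \<inter> (D - R \<union> A))) + (\<Sum>u\<in>A. card (N u \<inter> (D - R \<union> A)))"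
    unfolding inner_def using fA assms by (intro sum.union_disjoint) auto
  also have "(\<Sum>u\<in>A. card (N u \<inter> (D - R \<union> A))) = 0" using assms(3) by simp
  also have "(\<Sum>u\<in>D - R. card (N u \<inter> (D - R \<union> A))) \<le> (\<Sum>u\<in>D - R. deg u)"
  proof (intro sum_mono)
    fix u assume u: "u \<in> D - R"
    have "N u \<inter> A = {}" using assms(3) u N_sym by blast
    then show "card (N u \<inter> (D - R \<union> A)) \<le> deg u"
      unfolding deg_def dn_def by (intro card_mono) auto
  qed
  finally have "inner (D - R \<union> A) + (\<Sum>u\<in>R. deg u) \<le> (\<Sum>u\<in>D - R. deg u) + (\<Sum>u\<in>R. deg u)" by simp
  also have "\<dots> = inner D"
    unfolding inner_def using sum.subset_diff[OF assms(1) finite_D, of deg] by (simp add: deg_def dn_def)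
  finally show ?thesis .
qed

text \<open>An admissible exchange of equal size cannot lower \<open>inner\<close>, so by
  \<open>inner_exchange\<close> the removed vertices had no inner edges to lose.\<close>

lemma exchange_inner:
  assumes "R \<subseteq> D" "A \<subseteq> V - D" "card R \<le> 6" "card A = card R"
    and "\<And>z. z \<in> R \<Longrightarrow> N z \<inter> A \<noteq> {} \<or> dn z - R \<noteq> {}"
    and "\<And>z. z \<in> V \<Longrightarrow> z \<notin> D \<Longrightarrow> dn z \<noteq> {} \<Longrightarrow> dn z \<subseteq> R \<Longrightarrow> z \<notin> A \<Longrightarrow> N z \<inter> A \<noteq> {}"
    and "\<And>a. a \<in> A \<Longrightarrow> N a \<inter> (D - R \<union> A) = {}"
    and "v \<in> R"
  shows "dn v = {}"
proof -
  have "dominating (D - R \<union> A)"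
    using dominating_exchange[OF assms(1) _ assms(5,6)] assms(2) by blast
  from opt_inner[OF assms(1,2) _ this] have "inner D \<le> inner (D - R \<union> A)" using assms(3,4) by linarith
  then have "(\<Sum>u\<in>R. deg u) = 0" using inner_exchange[OF assms(1,2,7)] by linarith
  then show ?thesis using assms(1,8) finite_subset[OF assms(1) finite_D] by (auto simp: deg_def)
qed

lemma exchange_once:
  assumes "R \<subseteq> D" "A \<subseteq> V - D" "card R \<le> 6" "card A = card R"
    and "\<And>z. z \<in> R \<Longrightarrow> N z \<inter> A \<noteq> {} \<or> dn z - R \<noteq> {}"
    and "\<And>z. z \<in> V \<Longrightarrow> z \<notin> D \<Longrightarrow> dn z \<noteq> {} \<Longrightarrow> dn z \<subseteq> R \<Longrightarrow> z \<notin> A \<Longrightarrow> N z \<inter> A \<noteq> {}"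
    and "\<And>a. a \<in> A \<Longrightarrow> N a \<inter> (D - R \<union> A) = {}"
  shows "card (once D) \<le> card (once (D - R \<union> A))"
proof -
  have d: "dominating (D - R \<union> A)"
    using dominating_exchange[OF assms(1) _ assms(5,6)] assms(2) by blast
  from opt_inner[OF assms(1,2) _ this] have "inner D \<le> inner (D - R \<union> A)" using assms(3,4) by linarith
  then have "inner (D - R \<union> A) = inner D" using inner_exchange[OF assms(1,2,7)] by linarith
  from opt_once[OF assms(1,2) _ d _ this] show ?thesis using assms(3,4) by linarith
qed

lemma finite_once [simp]: "finite (once D')"
  using finite_V by (simp add: once_def)

lemma mem_once: "u \<in> once D \<longleftrightarrow> u \<in> V \<and> u \<notin> D \<and> deg u = 1"
  by (auto simp: once_def deg_def dn_def)

lemma privI: "z \<notin> D \<Longrightarrow> dn z = {v} \<Longrightarrow> z \<in> priv v"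
  using mem_dn[of v z] by (simp add: priv_def)

lemma dn_subset_singleton: "dn z \<noteq> {} \<Longrightarrow> dn z \<subseteq> {v} \<Longrightarrow> dn z = {v}"
  by blast

text \<open>Without a private neighbour, \<open>v\<close> could simply be dropped: its neighbour in
  \<open>D\<close> dominates it.\<close>

lemma private_exists:
  assumes "v \<in> D" "dn v \<noteq> {}"
  shows "priv v \<noteq> {}"
proof
  assume e: "priv v = {}"
  show False
  proof (rule exchange_card[of "{v}" "{}"])
    fix z assume "z \<in> {v}" then show "N z \<inter> {} \<noteq> {} \<or> dn z - {v} \<noteq> {}"
      using assms N_irrefl by (auto simp: dn_def)
  next
    fix z assume "z \<in> V" "z \<notin> D" "dn z \<noteq> {}" "dn z \<subseteq> {v}"
    then have "z \<in> priv v" by (intro privI dn_subset_singleton)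
    then show "N z \<inter> {} \<noteq> {}" using e by simp
  qed (use assms in auto)
qed

text \<open>If \<open>u\<close> were the only private neighbour, exchanging \<open>v\<close> for
  \<open>u\<close> would preserve domination; \<open>u\<close> has no other neighbour in
  \<open>D\<close>, so the inner edges at \<open>v\<close> would vanish. Two private neighbours and
  one neighbour in \<open>D\<close> exhaust the degree.\<close>

lemma noniso_cases:
  assumes "v \<in> D" "dn v \<noteq> {}"
  obtains y r r' where "N v = {y, r, r'}" "r \<noteq> r'" "y \<in> D" "priv v = {r, r'}"
proof -
  obtain u where u: "u \<in> priv v" using private_exists[OF assms] by blast
  have uD: "u \<notin> D" "u \<in> N v" "dn u = {v}" using u by (auto simp: priv_def)
  have "\<exists>u'. u' \<in> priv v \<and> u' \<noteq> u"
  proof (rule ccontr)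
    assume "\<not> ?thesis"
    then have e: "priv v = {u}" using u by blast
    have "dn v = {}"
    proof (rule exchange_inner[of "{v}" "{u}"])
      fix z assume "z \<in> {v}" then show "N z \<inter> {u} \<noteq> {} \<or> dn z - {v} \<noteq> {}" using uD by auto
    next
      fix z assume z: "z \<in> V" "z \<notin> D" "dn z \<noteq> {}" "dn z \<subseteq> {v}" "z \<notin> {u}"
      then have "z \<in> priv v" by (intro privI dn_subset_singleton)
      then show "N z \<inter> {u} \<noteq> {}" using e z by simp
    next
      fix a assume "a \<in> {u}" then show "N a \<inter> (D - {v} \<union> {u}) = {}"
        using uD N_irrefl by (auto simp: dn_def)
    qed (use assms uD N_V in auto)
    then show False using assms by simp
  qed
  then obtain u' where u': "u' \<in> priv v" "u' \<noteq> u" by blast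
  obtain y where y: "y \<in> N v" "y \<in> D" using assms by (auto simp: dn_def)
  have "N v = {y, u, u'}" using u u' y by (intro N_eq3) (auto simp: priv_def)
  moreover from this have "priv v = {u, u'}" using u u' y by (auto simp: priv_def)
  ultimately show thesis using that[of y u u'] y u' by blast
qed

section \<open>Lone vertices and the neighbours they share\<close>

lemma lone_deg: "lone v \<Longrightarrow> u \<in> N v \<Longrightarrow> deg u \<ge> 2"
proof -
  assume a: "lone v" "u \<in> N v"
  have v: "v \<in> dn u" using a by (auto simp: lone_def iso_def mem_dn)
  have uD: "u \<notin> D" using a by (auto simp: lone_def iso_def dn_def)
  have "dn u \<noteq> {v}" using a uD by (auto simp: lone_def priv_def)
  then have "\<exists>w\<in>dn u. w \<noteq> v" using v by auto
  then obtain w where "w \<in> dn u" "w \<noteq> v" by blast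
  then have "card {v, w} \<le> deg u" using v unfolding deg_def by (intro card_mono) auto
  then show ?thesis using \<open>w \<noteq> v\<close> by simp
qed

lemma lone_D: "lone v \<Longrightarrow> v \<in> D" "lone v \<Longrightarrow> u \<in> N v \<Longrightarrow> u \<notin> D"
  by (auto simp: lone_def iso_def dn_def)

lemma lone_no_private: "lone v \<Longrightarrow> dn z = {v} \<Longrightarrow> False"
  using lone_deg[of v z] mem_dn[of v z] by (auto simp: deg_def)

text \<open>Otherwise \<open>u\<close> alone replaces \<open>v\<close> and \<open>x\<close>: it
  dominates both, and any other vertex losing all its dominators would have
  \<open>dn z = {v, x}\<close>, because a lone vertex is nobody's only dominator.\<close>

lemma lone_share:
  assumes "lone v" "lone x" "v \<noteq> x" "u \<in> N v" "u \<in> N x"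
  obtains u' where "u' \<in> N v" "u' \<in> N x" "u' \<noteq> u" "dn u' = {v, x}"
proof (rule ccontr)
  assume n: "\<not> thesis"
  show False
  proof (rule exchange_card[of "{v, x}" "{u}"])
    fix z assume z: "z \<in> V" "z \<notin> D" "dn z \<noteq> {}" "dn z \<subseteq> {v, x}" "z \<notin> {u}"
    then have "dn z = {v, x}" using lone_no_private[of v z] lone_no_private[of x z] assms by auto
    moreover from this have "z \<in> N v" "z \<in> N x" using mem_dn by blast+
    ultimately show "N z \<inter> {u} \<noteq> {}" using n that z by blast
  qed (use assms lone_D N_V in auto)
qed

lemma lone_share2:
  assumes "lone v" "lone x" "v \<noteq> x" "u \<in> N v" "u \<in> N x"
  obtains u1 u2 where "u1 \<noteq> u2" "dn u1 = {v, x}" "dn u2 = {v, x}"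
    "u1 \<in> N v" "u1 \<in> N x" "u2 \<in> N v" "u2 \<in> N x"
proof -
  obtain u1 where 1: "u1 \<in> N v" "u1 \<in> N x" "u1 \<noteq> u" "dn u1 = {v, x}" by (rule lone_share[OF assms])
  obtain u2 where 2: "u2 \<in> N v" "u2 \<in> N x" "u2 \<noteq> u1" "dn u2 = {v, x}"
    by (rule lone_share[OF assms(1-3) 1(1,2)])
  show thesis using that 1 2 by blast
qed

text \<open>A lone partner occupies two of the three neighbours of \<open>v\<close>, dominated by no
  one else, so there is room for one partner only.\<close>

lemma lone_partner_unique:
  assumes "lone v" "lone x" "lone y" "v \<noteq> x" "v \<noteq> y" "u \<in> N v" "u \<in> N x" "w \<in> N v" "w \<in> N y"
  shows "x = y"
proof (rule ccontr)
  assume "x \<noteq> y"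
  obtain u1 u2 where 1: "u1 \<noteq> u2" "dn u1 = {v, x}" "dn u2 = {v, x}" "u1 \<in> N v" "u2 \<in> N v"
    by (rule lone_share2[of v x u]) (use assms in auto)
  obtain w1 w2 where 2: "w1 \<noteq> w2" "dn w1 = {v, y}" "dn w2 = {v, y}" "w1 \<in> N v" "w2 \<in> N v"
    by (rule lone_share2[of v y w]) (use assms in auto)
  have "{v, x} \<noteq> {v, y}" using assms \<open>x \<noteq> y\<close> by (auto simp: doubleton_eq_iff)
  then have "u1 \<noteq> w1" "u1 \<noteq> w2" "u2 \<noteq> w1" "u2 \<noteq> w2" using 1 2 by metis+
  then show False using N_eq3[of u1 v u2 w1] 1 2 by auto
qed


text \<open>Away from \<open>R\<close> a vertex outside \<open>D\<close> keeps its dominators, of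
  which there is at least one. It can have exactly one afterwards only if it had one before and
  gained none.\<close>

lemma once_far:
  assumes "z \<in> once (D - R \<union> A)" "z \<notin> D" "N z \<inter> R = {}" "A \<inter> D = {}"
  shows "z \<in> once D" "N z \<inter> A = {}"
proof -
  have z: "z \<in> V" "card (N z \<inter> (D - R \<union> A)) = 1" using assms(1) by (auto simp: once_def)
  have e: "N z \<inter> (D - R \<union> A) = dn z \<union> (N z \<inter> A)" using assms(3) by (auto simp: dn_def)
  have "card (dn z) + card (N z \<inter> A) = 1"
    using z(2) unfolding e by (subst (asm) card_Un_disjoint) (use assms(4) in \<open>auto simp: dn_def\<close>)
  moreover have "card (dn z) \<noteq> 0" using dn_nonempty[OF z(1) assms(2)] by simp
  ultimately have "card (dn z) = 1" "card (N z \<inter> A) = 0" by linarith+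
  then show "z \<in> once D" "N z \<inter> A = {}" using z assms(2) by (auto simp: mem_once deg_def)
qed

lemma deg3_not_once:
  assumes "deg z = 3" "z \<in> V" "z \<notin> D" "card (N z \<inter> R) \<le> 1"
  shows "z \<notin> once (D - R \<union> A)"
proof
  assume a: "z \<in> once (D - R \<union> A)"
  have "N z \<subseteq> D" by (rule deg3_N) fact+
  then have "N z - (N z \<inter> R) \<subseteq> N z \<inter> (D - R \<union> A)" by blast
  then have "card (N z - (N z \<inter> R)) \<le> card (N z \<inter> (D - R \<union> A))" by (intro card_mono) auto
  moreover have "card (N z - (N z \<inter> R)) \<ge> 2"
    using assms(4) card_N[OF assms(2)] by (simp add: card_Diff_subset)
  ultimately show False using a by (simp add: once_def)
qed

section \<open>Isolated vertices of \<open>D\<close> with a single private neighbour\<close>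

lemma lone_iso: "lone v \<Longrightarrow> dn v = {}"
  by (simp add: lone_def iso_def)

lemma N_not_self: "u \<in> N v \<Longrightarrow> u \<noteq> v"
  using N_irrefl by blast

lemma deg_ge1: "z \<in> V \<Longrightarrow> z \<notin> D \<Longrightarrow> deg z \<ge> 1"
  using dn_nonempty[of z] by (simp add: deg_def Suc_le_eq card_gt_0_iff)

text \<open>Exchange \<open>x\<close> for \<open>p\<close>. At most \<open>x\<close> is new in
  \<open>once\<close>: \<open>u\<close> and \<open>u'\<close> lose only one of three dominators. On
  the other side \<open>p\<close> leaves \<open>once\<close>, and so would \<open>r\<close> if
  \<open>deg r = 1\<close>, as it gains the dominator \<open>p\<close>. This would improve the third
  objective.\<close>

lemma sole_private_flip:
  assumes "iso x" "priv x = {p}" "N x = {p, u, u'}" "deg u = 3" "deg u' = 3" "r \<in> N p" "r \<noteq> x"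
  shows "deg r = 2"
proof -
  have p: "p \<in> N x" "p \<notin> D" "dn p = {x}" "x \<in> D" "dn x = {}" using assms(1,2) by (auto simp: priv_def iso_def)
  have r: "r \<notin> D" "p \<in> N r" "r \<in> V" "r \<noteq> p"
    using assms(6,7) p N_sym N_V N_not_self[OF assms(6)] by (auto simp: dn_def)
  have uV: "u \<in> V" "u' \<in> V" "u \<notin> D" "u' \<notin> D" using assms(3) p N_V(1)[of _ x] by (auto simp: dn_def)
  have rx: "r \<notin> N x"
    using deg3_N[of u] deg3_N[of u'] assms(3-5) uV r p by auto
  have "deg r \<noteq> 1"
  proof
    assume d1: "deg r = 1"
    have "once (D - {x} \<union> {p}) \<subseteq> insert x (once D - {p, r})"
    proof
      fix z assume z: "z \<in> once (D - {x} \<union> {p})"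
      then have zD: "z \<in> V" "z \<notin> D - {x} \<union> {p}" by (auto simp: once_def)
      show "z \<in> insert x (once D - {p, r})"
      proof (cases "z = x")
        case False
        then have zD': "z \<notin> D" "z \<noteq> p" using zD by auto
        show ?thesis
        proof (cases "z \<in> N x")
          case True
          then have "deg z = 3" using assms(3-5) zD' by auto
          then have "z \<notin> once (D - {x} \<union> {p})" using zD zD'
            by (intro deg3_not_once) (auto intro: le_trans[OF card_mono[of "{x}"]])
          then show ?thesis using z by simp
        next
          case F: False
          then have "N z \<inter> {x} = {}" using N_sym by blast
          from once_far[OF z zD'(1) this] have "z \<in> once D" "N z \<inter> {p} = {}" using p by auto
          then show ?thesis using zD' r by auto
        qed
      qed simp
    qed
    then have "card (once (D - {x} \<union> {p})) \<le> card (insert x (once D - {p, r}))"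
      by (intro card_mono) auto
    also have "\<dots> \<le> Suc (card (once D - {p, r}))" by (rule card_insert_le_m1) auto
    also have "card (once D - {p, r}) = card (once D) - 2"
      using r p d1 N_V(1)[OF p(1)] by (subst card_Diff_subset) (auto simp: mem_once deg_def)
    finally have less: "card (once (D - {x} \<union> {p})) \<le> Suc (card (once D) - 2)" .
    have "{p, r} \<subseteq> once D" using r p d1 N_V(1)[OF p(1)] by (auto simp: mem_once deg_def)
    \<comment> \<open>Needed because \<open>card (once D) - 2\<close> is a truncated
      subtraction.\<close>
    then have ge: "card (once D) \<ge> 2" using r(4) card_mono[of "once D" "{p, r}"] by auto
    have "card (once D) \<le> card (once (D - {x} \<union> {p}))"
    proof (rule exchange_once)
      fix z assume "z \<in> V" "z \<notin> D" "dn z \<noteq> {}" "dn z \<subseteq> {x}" "z \<notin> {p}"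
      then have "z \<in> priv x" by (intro privI dn_subset_singleton)
      then show "N z \<inter> {p} \<noteq> {}" using \<open>z \<notin> {p}\<close> assms(2) by simp
    qed (use p N_V(1)[OF p(1)] N_irrefl in \<open>auto simp: dn_def\<close>)
    then show False using less ge by linarith
  qed
  moreover have "deg r \<le> 2" by (rule deg_le2[OF r(2)]) fact
  moreover have "deg r \<ge> 1" using r by (intro deg_ge1)
  ultimately show ?thesis by linarith
qed

lemma dn_subset_insertE:
  assumes "dn z \<subseteq> {v, x, y}" "dn z \<noteq> {}"
  shows "z \<in> N v \<or> z \<in> N x \<or> dn z = {y}"
  using assms mem_dn by blast

lemma card_insert3_le [simp]: "card {a, b, c} \<le> 6"
  by (simp add: card_insert_if)

text \<open>Here \<open>h\<close> replaces \<open>v\<close> and \<open>x\<close>, and \<open>r\<close> replaces \<open>y\<close>.\<close>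

lemma exchange_three:
  assumes "v \<in> D" "x \<in> D" "v \<noteq> x" "h \<in> N v" "h \<in> N x" "h \<notin> D"
    and "y \<in> D" "y \<noteq> v" "y \<noteq> x" "r \<in> N y" "r \<notin> D"
    and cover: "\<And>z. z \<in> N v \<union> N x \<Longrightarrow> dn z \<subseteq> {v, x, y} \<Longrightarrow> z \<notin> D \<Longrightarrow> z \<notin> {h, r} \<Longrightarrow> N z \<inter> {h, r} \<noteq> {}"
    and sole: "\<And>z. dn z = {y} \<Longrightarrow> z \<notin> D \<Longrightarrow> z \<notin> {h, r} \<Longrightarrow> N z \<inter> {h, r} \<noteq> {}"
  shows False
proof (rule exchange_card[of "{v, x, y}" "{h, r}"])
  show "card {h, r} < card {v, x, y}" using assms(3,8,9) by (simp add: card_insert_if)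
  fix z assume "z \<in> {v, x, y}"
  then show "N z \<inter> {h, r} \<noteq> {} \<or> dn z - {v, x, y} \<noteq> {}" using assms(4,5,10) by auto
next
  fix z assume z: "z \<in> V" "z \<notin> D" "dn z \<noteq> {}" "dn z \<subseteq> {v, x, y}" "z \<notin> {h, r}"
  then show "N z \<inter> {h, r} \<noteq> {}" using dn_subset_insertE[OF z(4,3)] cover sole by blast
qed (use assms(1-11) N_V in auto)

text \<open>If \<open>y\<close> were lone, \<open>u\<close> would replace \<open>v\<close> and
  \<open>x\<close>, and \<open>r\<close> would replace \<open>y\<close> and cover \<open>p\<close>.
  A neighbour of \<open>v\<close> that loses everything has degree 3 because of
  \<open>twice v = 0\<close>, so it is shared by the lone vertices \<open>v\<close> and
  \<open>y\<close>; these would then also share a vertex of degree 2, against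
  \<open>twice v = 0\<close>. The outcome is that \<open>r\<close> qualifies to give 1 to
  \<open>p\<close>.\<close>

lemma sole_private_no_lone:
  assumes "iso x" "priv x = {p}" "N x = {p, u, u'}" "deg u = 3" "deg u' = 3" "r \<in> N p" "r \<noteq> x"
    and "lone v" "v \<in> dn u" "twice v = 0" "y \<in> dn r"
  shows "\<not> lone y"
proof
  assume B: "lone y"
  have p: "p \<in> N x" "p \<notin> D" "dn p = {x}" "x \<in> D" "dn x = {}" using assms(1,2) by (auto simp: priv_def iso_def)
  have r: "r \<notin> D" "p \<in> N r" "r \<in> V" "r \<noteq> p" "deg r = 2"
    using assms(6,7) p N_sym N_V N_not_self[OF assms(6)] sole_private_flip[OF assms(1-7)]
    by (auto simp: dn_def)
  have uV: "u \<in> V" "u' \<in> V" "u \<notin> D" "u' \<notin> D" using assms(3) p N_V(1)[of _ x] by (auto simp: dn_def)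
  have v0: "deg z \<noteq> 2" if "z \<in> N v" for z using assms(10) that by (auto simp: twice_def)
  have uv: "u \<in> N v" "v \<in> D" using assms(9) by (auto simp: mem_dn)
  have ry: "r \<in> N y" "y \<in> D" using assms(11) by (auto simp: mem_dn)
  have neq: "v \<noteq> y" "v \<noteq> x" "x \<noteq> y" using ry r(5) v0 assms(2,8) B by (auto simp: lone_def)
  show False
  proof (rule exchange_three[of v x u y r])
    fix z assume z: "z \<in> N v \<union> N x" "dn z \<subseteq> {v, x, y}" "z \<notin> D" "z \<notin> {u, r}"
    show "N z \<inter> {u, r} \<noteq> {}"
    proof (cases "z \<in> N v")
      case True
      then have "deg z \<ge> 2" using assms(8) lone_deg by blast
      then have "deg z = 3" using v0[OF True] deg_le3[of z] by linarith
      have "dn z = {v, x, y}"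
        using z(2) \<open>deg z = 3\<close> neq by (intro card_subset_eq) (auto simp: deg_def)
      then have "z \<in> N y" using mem_dn[of y z] by simp
      obtain z' where "z' \<in> N v" "dn z' = {v, y}" by (rule lone_share[OF assms(8) B neq(1) True \<open>z \<in> N y\<close>])
      then show ?thesis using v0[of z'] neq by (auto simp: deg_def)
    next
      case False
      then have "dn z \<subseteq> {x, y}" using z(2) mem_dn[of v z] by blast
      then have "deg z \<le> card {x, y}" unfolding deg_def by (intro card_mono) auto
      then have "deg z \<le> 2" using neq by simp
      then show ?thesis using False z(1) assms(3-5) z(4) r assms(6) N_sym by auto
    qed
  qed (use neq uV r ry uv p assms(3) in \<open>auto dest: lone_no_private[OF B]\<close>)
qed

text \<open>If they were adjacent, \<open>u1\<close> alone would replace \<open>v\<close> and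
  \<open>x\<close>.\<close>

lemma lone_pair_not_adjacent:
  assumes "lone v" "lone x" "v \<noteq> x" "dn u1 = {v, x}" "dn u2 = {v, x}" "u1 \<noteq> u2"
    and "\<And>z. dn z \<subseteq> {v, x} \<Longrightarrow> dn z \<noteq> {} \<Longrightarrow> z \<notin> D \<Longrightarrow> z = u1 \<or> z = u2"
  shows "u2 \<notin> N u1"
proof
  assume a: "u2 \<in> N u1"
  have m: "u1 \<in> N v" "u1 \<in> N x" "u2 \<in> N v" "u2 \<in> N x" using assms(4,5) mem_dn by blast+
  show False
  proof (rule exchange_card[of "{v, x}" "{u1}"])
    fix z assume z: "z \<in> V" "z \<notin> D" "dn z \<noteq> {}" "dn z \<subseteq> {v, x}" "z \<notin> {u1}"
    then show "N z \<inter> {u1} \<noteq> {}" using assms(7)[of z] a N_sym by auto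
  qed (use assms m lone_D N_V in auto)
qed


section \<open>Pairs of lone vertices with two common neighbours\<close>

definition pair :: "'a \<Rightarrow> 'a \<Rightarrow> 'a \<Rightarrow> 'a \<Rightarrow> bool" where
  "pair v x u1 u2 \<longleftrightarrow> lone v \<and> lone x \<and> v \<noteq> x \<and> u1 \<noteq> u2 \<and> dn u1 = {v, x} \<and> dn u2 = {v, x}"

text \<open>With no third vertex dominated exactly by \<open>v\<close> and \<open>x\<close>,
  exchanging these two for \<open>u1\<close> and \<open>u2\<close> leaves nothing
  undominated.\<close>

definition exact_pair :: "'a \<Rightarrow> 'a \<Rightarrow> 'a \<Rightarrow> 'a \<Rightarrow> bool" where
  "exact_pair v x u1 u2 \<longleftrightarrow> pair v x u1 u2 \<and> (\<forall>z. z \<notin> D \<longrightarrow> dn z = {v, x} \<longrightarrow> z = u1 \<or> z = u2)"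

lemma pairD:
  assumes "pair v x u1 u2"
  shows "lone v" "lone x" "v \<noteq> x" "u1 \<noteq> u2" "dn u1 = {v, x}" "dn u2 = {v, x}"
    "v \<in> D" "x \<in> D" "u1 \<notin> D" "u2 \<notin> D" "u1 \<in> N v" "u1 \<in> N x" "u2 \<in> N v" "u2 \<in> N x"
    "u1 \<in> V" "u2 \<in> V" "dn v = {}" "dn x = {}"
proof -
  show *: "lone v" "lone x" "v \<noteq> x" "u1 \<noteq> u2" "dn u1 = {v, x}" "dn u2 = {v, x}"
    using assms by (auto simp: pair_def)
  show **: "u1 \<in> N v" "u1 \<in> N x" "u2 \<in> N v" "u2 \<in> N x" using *(5,6) mem_dn by blast+
  show "v \<in> D" "x \<in> D" "u1 \<notin> D" "u2 \<notin> D" "u1 \<in> V" "u2 \<in> V" "dn v = {}" "dn x = {}"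
    using * ** lone_D N_V lone_iso by blast+
qed

lemma exact_pairD:
  assumes "exact_pair v x u1 u2" "z \<notin> D" "dn z \<noteq> {}" "dn z \<subseteq> {v, x}"
  shows "z = u1 \<or> z = u2"
proof -
  have "dn z = {v, x}"
    using assms lone_no_private[of v z] lone_no_private[of x z] by (auto simp: exact_pair_def pair_def)
  then show ?thesis using assms by (auto simp: exact_pair_def)
qed

lemma exact_pair_thirds:
  assumes "exact_pair v x u1 u2"
  obtains r1 r2 where "N u1 = {v, x, r1}" "N u2 = {v, x, r2}" "r1 \<notin> D" "r2 \<notin> D"
    "r1 \<noteq> u2" "r2 \<noteq> u1" "r1 \<noteq> u1" "r2 \<noteq> u2" "r1 \<noteq> v" "r1 \<noteq> x" "r2 \<noteq> v" "r2 \<noteq> x"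
proof -
  have p: "pair v x u1 u2" using assms by (simp add: exact_pair_def)
  note P = pairD[OF p]
  have na: "u2 \<notin> N u1"
    by (rule lone_pair_not_adjacent[of v x]) (use P exact_pairD[OF assms] in auto)
  then have na': "u1 \<notin> N u2" using N_sym by blast
  obtain r1 where r1: "N u1 = {v, x, r1}" "r1 \<noteq> v" "r1 \<noteq> x"
    by (rule N_third[of v u1 x]) (use P N_sym in auto)
  obtain r2 where r2: "N u2 = {v, x, r2}" "r2 \<noteq> v" "r2 \<noteq> x"
    by (rule N_third[of v u2 x]) (use P N_sym in auto)
  have "r1 \<notin> D" "r2 \<notin> D" using r1 r2 P(5,6) by (auto simp: dn_def)
  moreover have "r1 \<noteq> u1" "r2 \<noteq> u2" using r1(1) r2(1) N_irrefl by auto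
  ultimately show thesis using that[of r1 r2] r1 r2 na na' by auto
qed

text \<open>After the exchange \<open>v\<close> and \<open>x\<close> have two dominators, so they
  stay out of \<open>once\<close>. Only their third neighbours can be new there, and a vertex beyond
  \<open>u1\<close> or \<open>u2\<close> that was dominated once drops out.\<close>

lemma exact_pair_swap:
  assumes "exact_pair v x u1 u2"
  shows "card (once D) \<le> card (once (D - {v, x} \<union> {u1, u2}))"
    and "z \<in> once (D - {v, x} \<union> {u1, u2}) \<Longrightarrow>
      z \<in> N v \<union> N x - {u1, u2} \<or> z \<in> once D \<and> z \<notin> N u1 \<and> z \<notin> N u2"
proof -
  have p: "pair v x u1 u2" using assms by (simp add: exact_pair_def)
  note P = pairD[OF p]
  obtain r1 r2 where r: "N u1 = {v, x, r1}" "N u2 = {v, x, r2}" "r1 \<notin> D" "r2 \<notin> D"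
    "r1 \<noteq> u2" "r2 \<noteq> u1" "r1 \<noteq> u1" "r2 \<noteq> u2" by (rule exact_pair_thirds[OF assms])
  show "card (once D) \<le> card (once (D - {v, x} \<union> {u1, u2}))"
  proof (rule exchange_once)
    fix z assume "z \<in> V" "z \<notin> D" "dn z \<noteq> {}" "dn z \<subseteq> {v, x}" "z \<notin> {u1, u2}"
    then show "N z \<inter> {u1, u2} \<noteq> {}" using exact_pairD[OF assms] by blast
  qed (use P r in auto)
  assume z: "z \<in> once (D - {v, x} \<union> {u1, u2})"
  then have zV: "z \<in> V" "z \<notin> D - {v, x} \<union> {u1, u2}" "card (N z \<inter> (D - {v, x} \<union> {u1, u2})) = 1"
    by (auto simp: once_def)
  have "z \<noteq> w" if "w \<in> {v, x}" for w
  proof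
    assume "z = w"
    then have "{u1, u2} \<subseteq> N z \<inter> (D - {v, x} \<union> {u1, u2})" using that P by auto
    from card_mono[OF _ this] show False using zV(3) P(4) by auto
  qed
  then have zD: "z \<notin> D" "z \<noteq> u1" "z \<noteq> u2" using zV by auto
  show "z \<in> N v \<union> N x - {u1, u2} \<or> z \<in> once D \<and> z \<notin> N u1 \<and> z \<notin> N u2"
  proof (cases "z \<in> N v \<union> N x")
    case False
    then have "N z \<inter> {v, x} = {}" using N_sym by blast
    from once_far[OF z zD(1) this] have "z \<in> once D" "N z \<inter> {u1, u2} = {}" using P by auto
    then show ?thesis using N_sym by blast
  qed (use zD in auto)
qed

text \<open>Swapping \<open>v\<close> and \<open>x\<close> for \<open>u1\<close> and \<open>u2\<close> changes neither the size of \<open>D\<close> nor its inner edges, so the third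
  component of the objective applies.\<close>

lemma open_pair_third:
  assumes "exact_pair v x u1 u2" "N v = {u1, u2, s}" "N x = {u1, u2, t}" "s \<noteq> t" "deg s = 3" "deg t = 3"
    and "r \<in> N u1" "r \<noteq> v" "r \<noteq> x"
  shows "deg r = 2" "y \<in> dn r \<Longrightarrow> \<not> lone y"
proof -
  have p: "pair v x u1 u2" using assms by (simp add: exact_pair_def)
  note P = pairD[OF p]
  obtain r1 r2 where rr: "N u1 = {v, x, r1}" "N u2 = {v, x, r2}" "r1 \<notin> D" "r2 \<notin> D"
    "r1 \<noteq> u2" "r2 \<noteq> u1" "r1 \<noteq> u1" "r2 \<noteq> u2" by (rule exact_pair_thirds[OF assms(1)])
  then have r: "r1 = r" "r \<notin> D" "r \<in> V" "u1 \<in> N r" using assms(7-9) N_V N_sym by auto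
  have st: "s \<in> V" "t \<in> V" "s \<notin> D" "t \<notin> D" "s \<in> N v" "t \<in> N x"
    using assms(2,3) N_V[of _ v] N_V[of _ x] P lone_D by auto
  have ne: "s \<noteq> u1" "s \<noteq> u2" "t \<noteq> u1" "t \<noteq> u2" using assms(5,6) P by (auto simp: deg_def)
  have "deg r \<noteq> 1"
  proof
    assume "deg r = 1"
    then have ro: "r \<in> once D" using r by (simp add: mem_once)
    have "once (D - {v, x} \<union> {u1, u2}) \<subseteq> once D - {r}"
    proof
      fix z assume z: "z \<in> once (D - {v, x} \<union> {u1, u2})"
      \<comment> \<open>As \<open>s\<close> and \<open>t\<close> differ, each loses only one of its
        three dominators and does not enter \<open>once\<close>; the exchange can only shrink that
        set.\<close>
      have "s \<notin> N x" "t \<notin> N v" using assms(2-4) ne by auto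
      then have "N s \<inter> {v, x} \<subseteq> {v}" "N t \<inter> {v, x} \<subseteq> {x}" using N_sym by blast+
      then have "card (N s \<inter> {v, x}) \<le> 1" "card (N t \<inter> {v, x}) \<le> 1"
        using card_mono[of "{_}"] by fastforce+
      then have "z \<noteq> s" "z \<noteq> t" 
        using z deg3_not_once[OF assms(5) st(1,3)] deg3_not_once[OF assms(6) st(2,4)] by blast+
      then have "z \<in> once D \<and> z \<notin> N u1" using exact_pair_swap(2)[OF assms(1) z] assms(2,3) by auto
      then show "z \<in> once D - {r}" using assms(7) by blast
    qed
    then have "card (once (D - {v, x} \<union> {u1, u2})) < card (once D)"
      using ro by (intro psubset_card_mono) auto
    then show False using exact_pair_swap(1)[OF assms(1)] by simp
  qed
  moreover have "deg r \<le> 2" by (rule deg_le2[OF r(4) P(9)])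
  moreover have "deg r \<ge> 1" using r by (intro deg_ge1)
  ultimately show "deg r = 2" by linarith
  assume y: "y \<in> dn r"
  show "\<not> lone y"
  proof
    assume B: "lone y"
    have ry: "y \<in> D" "r \<in> N y" using y by (auto simp: mem_dn)
    have rs: "r \<noteq> s" "r \<noteq> t" using deg3_N[of s] deg3_N[of t] st assms(5,6) r(4) P by auto
    have "r \<noteq> u1" "r \<noteq> u2" using r rr by auto
    then have yvx: "y \<noteq> v" "y \<noteq> x" using ry(2) assms(2,3) rs by auto
    \<comment> \<open>Here \<open>u2\<close> covers \<open>v\<close> and \<open>x\<close>, and
      \<open>r\<close> covers \<open>u1\<close> and \<open>y\<close>. Losing \<open>s\<close> or
      \<open>t\<close> would require it to be adjacent to all of \<open>v\<close>, \<open>x\<close>,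
      \<open>y\<close>, but each of them misses \<open>x\<close> or \<open>v\<close>.\<close>
    show False
    proof (rule exchange_three[of v x u2 y r])
      fix z assume z: "z \<in> N v \<union> N x" "dn z \<subseteq> {v, x, y}" "z \<notin> D" "z \<notin> {u2, r}"
      have c: "card {v, x, y} = 3" using yvx P by auto
      have "z \<noteq> w" if "w \<in> {s, t}" for w
      proof
        assume "z = w"
        then have "card (dn z) = 3" using that assms(5,6) by (auto simp: deg_def)
        then have "dn z = {v, x, y}" using z(2) c by (intro card_subset_eq) auto
        then have "z \<in> N v \<inter> N x" using mem_dn by blast
        then show False using that assms(2-4) ne \<open>z = w\<close> by auto
      qed
      then show "N z \<inter> {u2, r} \<noteq> {}" using z(1,4) assms(2,3) rr r by auto
    qed (use P ry r yvx in \<open>auto dest: lone_no_private[OF B]\<close>)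
  qed
qed

text \<open>The exchange of \<open>v\<close>, \<open>x\<close> for \<open>u1\<close>,
  \<open>u2\<close> can add only \<open>u3\<close> to \<open>once\<close>, while it would remove
  both \<open>r1\<close> and \<open>r2\<close> if they had degree 1; so one of them has degree 2. A
  lone dominator \<open>y\<close> of that one is impossible: it would replace \<open>y\<close> and
  cover its own neighbour among \<open>u1\<close>, \<open>u2\<close>, while the other of these two
  replaces \<open>v\<close> and \<open>x\<close>.\<close>

lemma twin_third:
  assumes "exact_pair v x u1 u2" "N v = {u1, u2, u3}" "N x = {u1, u2, u3}" "deg u3 = 3"
    and "N u1 = {v, x, r1}" "N u2 = {v, x, r2}" "r1 \<noteq> r2"
  shows "deg r1 = 2 \<and> (\<forall>y\<in>dn r1. \<not> lone y) \<or> deg r2 = 2 \<and> (\<forall>y\<in>dn r2. \<not> lone y)"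
proof -
  have p: "pair v x u1 u2" using assms by (simp add: exact_pair_def)
  note P = pairD[OF p]
  obtain r1' r2' where rr: "N u1 = {v, x, r1'}" "N u2 = {v, x, r2'}" "r1' \<notin> D" "r2' \<notin> D"
    "r1' \<noteq> u2" "r2' \<noteq> u1" "r1' \<noteq> u1" "r2' \<noteq> u2" "r1' \<noteq> v" "r1' \<noteq> x" "r2' \<noteq> v" "r2' \<noteq> x"
    by (rule exact_pair_thirds[OF assms(1)])
  have "r1' = r1" "r2' = r2" using rr assms(5,6) by auto
  note rr = rr[unfolded this]
  have r: "r1 \<in> V" "r2 \<in> V" "u1 \<in> N r1" "u2 \<in> N r2"
    using assms(5,6) N_V[of r1 u1] N_V[of r2 u2] N_sym by auto
  have u3: "u3 \<in> V" "u3 \<notin> D" "u3 \<in> N v" using assms(2) N_V[of u3 v] lone_D P by auto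
  have le: "deg r1 \<le> 2" "deg r2 \<le> 2" "deg r1 \<ge> 1" "deg r2 \<ge> 1"
    using deg_le2[OF r(3) P(9)] deg_le2[OF r(4) P(10)] deg_ge1 r rr by auto
  have "\<not> (deg r1 = 1 \<and> deg r2 = 1)"
  proof
    assume "deg r1 = 1 \<and> deg r2 = 1"
    then have ro: "{r1, r2} \<subseteq> once D" using r rr by (simp add: mem_once)
    have "once (D - {v, x} \<union> {u1, u2}) \<subseteq> insert u3 (once D - {r1, r2})"
      using exact_pair_swap(2)[OF assms(1)] assms(2,3,5,6) by blast
    then have "card (once (D - {v, x} \<union> {u1, u2})) \<le> card (insert u3 (once D - {r1, r2}))"
      by (intro card_mono) auto
    also have "\<dots> \<le> Suc (card (once D - {r1, r2}))" by (rule card_insert_le_m1) auto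
    also have "card (once D - {r1, r2}) = card (once D) - 2"
      using assms(7) ro by (subst card_Diff_subset) auto
    finally have "card (once (D - {v, x} \<union> {u1, u2})) \<le> Suc (card (once D) - 2)" .
    moreover have "card (once D) \<ge> 2" using card_mono[OF finite_once ro] assms(7) by simp
    ultimately show False using exact_pair_swap(1)[OF assms(1)] by linarith
  qed
  then have d: "deg r1 = 2 \<or> deg r2 = 2" using le by linarith
  have nb: False if B: "lone y" "y \<in> dn r" and ri: "r \<in> {r1, r2}" "deg r = 2" and
      w: "(r = r1 \<and> u = u2 \<and> u' = u1) \<or> (r = r2 \<and> u = u1 \<and> u' = u2)" for y r u u'
  proof -
    have ry: "y \<in> D" "r \<in> N y" using B by (auto simp: mem_dn)
    have "r \<noteq> u3" using ri assms(4) by auto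
    then have yvx: "y \<noteq> v" "y \<noteq> x" using ry(2) assms(2,3) rr ri w by auto
    show False
    proof (rule exchange_three[of v x u y r])
      fix z assume z: "z \<in> N v \<union> N x" "dn z \<subseteq> {v, x, y}" "z \<notin> D" "z \<notin> {u, r}"
      have c: "card {v, x, y} = 3" using yvx P by auto
      have "z \<noteq> u3"
      proof
        assume "z = u3"
        then have "dn z = {v, x, y}" using z(2) c assms(4) by (intro card_subset_eq) (auto simp: deg_def)
        then have "u3 \<in> N y" using mem_dn \<open>z = u3\<close> by blast
        then obtain u4 where "u4 \<in> N v" "dn u4 = {v, y}"
          using lone_share[OF P(1) B(1), of u3] yvx u3 by blast
        then show False using assms(2,4) P yvx by (auto simp: deg_def doubleton_eq_iff)
      qed
      then show "N z \<inter> {u, r} \<noteq> {}" using assms(2,3,5,6) z(1,4) w by auto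
    qed (use P ry r rr w yvx ri in \<open>auto dest: lone_no_private[OF B(1)]\<close>)
  qed
  show ?thesis using d nb[of _ r1 u2 u1] nb[of _ r2 u1 u2] by blast
qed

text \<open>If \<open>y\<close> had a neighbour in \<open>D\<close>, its private neighbours would be
  \<open>r\<close> and some \<open>r'\<close>, and \<open>{u1, u2, r'}\<close> would replace
  \<open>{v, x, y}\<close> with fewer inner edges. If \<open>r\<close> were the only private
  neighbour, \<open>u3\<close> and \<open>r\<close> would replace all three, as \<open>r\<close>
  covers \<open>u1\<close>, \<open>u2\<close> and \<open>y\<close>. Such a \<open>y\<close> can
  afford that \<open>r\<close> gives away 1.\<close>

lemma twin_common_third:
  assumes "exact_pair v x u1 u2" "N v = {u1, u2, u3}" "N x = {u1, u2, u3}" "deg u3 = 3"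
    and "N u1 = {v, x, r}" "N u2 = {v, x, r}" "dn r = {y}"
  shows "iso y" "card (priv y) \<ge> 2"
proof -
  have p: "pair v x u1 u2" using assms by (simp add: exact_pair_def)
  note P = pairD[OF p]
  obtain r1' r2' where rr: "N u1 = {v, x, r1'}" "N u2 = {v, x, r2'}" "r1' \<notin> D" "r2' \<notin> D"
    "r1' \<noteq> u2" "r2' \<noteq> u1" "r1' \<noteq> u1" "r2' \<noteq> u2" "r1' \<noteq> v" "r1' \<noteq> x" "r2' \<noteq> v" "r2' \<noteq> x"
    by (rule exact_pair_thirds[OF assms(1)])
  have "r1' = r" "r2' = r" using rr assms(5,6) by auto
  note rr = rr[unfolded this]
  have r: "r \<in> V" "u1 \<in> N r" "u2 \<in> N r"
    using assms(5,6) N_V[of r u1] N_sym by auto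
  have u3: "u3 \<in> V" "u3 \<notin> D" "u3 \<in> N v" using assms(2) N_V[of u3 v] lone_D P by auto
  have y: "y \<in> D" "r \<in> N y" "r \<in> priv y" using assms(7) mem_dn[of y r] privI[OF rr(3)] by auto
  have yvx: "y \<noteq> v" "y \<noteq> x" using y P by (auto simp: lone_def)
  show "iso y"
  proof (rule ccontr)
    assume "\<not> iso y"
    then have n: "dn y \<noteq> {}" using y by (simp add: iso_def)
    obtain c a b where c: "N y = {c, a, b}" "a \<noteq> b" "c \<in> D" "priv y = {a, b}"
      by (rule noniso_cases[OF y(1) n])
    then obtain r' where r': "priv y = {r, r'}" "r' \<noteq> r" using y(3) by auto
    then have r'': "r' \<notin> D" "dn r' = {y}" "r' \<in> N y" by (auto simp: priv_def)
    have n1: "r' \<noteq> u1" "r' \<noteq> u2" "r' \<notin> N u1" "r' \<notin> N u2" using r'' P yvx r'(2) rr(1,2) by auto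
    have "dn y = {}"
    proof (rule exchange_inner[of "{v, x, y}" "{u1, u2, r'}"])
      show "card {u1, u2, r'} = card {v, x, y}" using P yvx n1 by (simp add: card_insert_if)
      fix z assume "z \<in> {v, x, y}"
      then show "N z \<inter> {u1, u2, r'} \<noteq> {} \<or> dn z - {v, x, y} \<noteq> {}" using P r'' by auto
    next
      fix a assume a: "a \<in> {u1, u2, r'}"
      have "N r' \<inter> D = {y}" using r'' by (simp add: dn_def)
      then show "N a \<inter> (D - {v, x, y} \<union> {u1, u2, r'}) = {}"
        using a rr n1 N_irrefl[of r'] N_sym_iff[of u1 r'] N_sym_iff[of u2 r'] r'(2) P(7-10) by auto
    next
      fix z assume z: "z \<in> V" "z \<notin> D" "dn z \<noteq> {}" "dn z \<subseteq> {v, x, y}" "z \<notin> {u1, u2, r'}"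
      have zne: "z \<noteq> u3"
      proof
        assume "z = u3"
        have "card {v, x, y} = 3" using yvx P by auto
        then have "dn z = {v, x, y}"
          using z(4) assms(4) \<open>z = u3\<close> by (intro card_subset_eq) (auto simp: deg_def)
        then have "u3 \<in> N y" using mem_dn \<open>z = u3\<close> by blast
        then have "u3 \<in> priv y" using c u3 by auto
        then show False using assms(4) by (simp add: priv_def deg_def)
      qed
      consider "z \<in> N v" | "z \<in> N x" | "dn z = {y}" using dn_subset_insertE[OF z(4,3)] by blast
      moreover have zr: "z \<in> {r, r'}" if "dn z = {y}" using privI[OF z(2) that] r' by simp
      ultimately show "N z \<inter> {u1, u2, r'} \<noteq> {}"
        using assms(2,3) z(5) r zne by cases auto
    qed (use P y r'' N_V[of r' y] in auto)
    then show False using n by simp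
  qed
  show "card (priv y) \<ge> 2"
  proof (rule ccontr)
    assume "\<not> ?thesis"
    then have "card (priv y) \<le> card {r}" by simp
    then have e: "priv y = {r}" using y(3) card_seteq[of "priv y" "{r}"] by (auto simp: priv_def)
    show False
    proof (rule exchange_three[of v x u3 y r])
      fix z assume "z \<in> N v \<union> N x" "z \<notin> {u3, r}"
      then show "N z \<inter> {u3, r} \<noteq> {}" using assms(2,3,5,6) by auto
    next
      fix z assume "dn z = {y}" "z \<notin> D" "z \<notin> {u3, r}"
      then show "N z \<inter> {u3, r} \<noteq> {}" using privI[of z y] e by simp
    qed (use P y u3 yvx rr assms(3) in auto)
  qed
qed

text \<open>If the claim fails, every outer neighbour of the three common neighbours has exactly two
  dominators, both lone. All outer neighbours then turn out to have the same dominators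
  \<open>a\<close> and \<open>b\<close>, which closes a component of ten vertices with four of them
  in \<open>D\<close>; three suffice to dominate it.\<close>

lemma full_twin_some_third:
  assumes "lone v" "lone x" "v \<noteq> x" "N v = N x" "\<And>u. u \<in> N v \<Longrightarrow> dn u = {v, x}"
  obtains u r where "u \<in> N v" "r \<in> N u" "r \<notin> D" "nlone r < 2 \<or> deg r \<noteq> 2"
proof (rule ccontr)
  assume n: "\<not> thesis"
  note n' = that
  have "v \<in> V" using assms(1) lone_D D_V by blast
  then obtain u1 u2 u3 where U: "N v = {u1, u2, u3}" "u1 \<noteq> u2" "u1 \<noteq> u3" "u2 \<noteq> u3"
    using card_N[of v] by (metis card_3_iff)
  have BB: "\<exists>a b. a \<noteq> b \<and> lone a \<and> lone b \<and> dn r = {a, b}" if "u \<in> N v" "r \<in> N u" "r \<notin> D" for u r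
  proof -
    have "nlone r \<ge> 2" "deg r = 2" using n n'[OF that] by linarith+
    have "{w \<in> dn r. lone w} = dn r"
      using \<open>nlone r \<ge> 2\<close> \<open>deg r = 2\<close> by (intro card_seteq) (auto simp: nlone_def deg_def)
    then show ?thesis using \<open>deg r = 2\<close> by (auto simp: deg_def card_2_iff)
  qed
  have third: "\<exists>r. N u = {v, x, r} \<and> r \<noteq> v \<and> r \<noteq> x \<and> r \<notin> D \<and> r \<in> V \<and> u \<in> N r" if "u \<in> N v" for u
  proof -
    have "v \<in> N u" "x \<in> N u" using that assms(4) N_sym by blast+
    then obtain r where r: "N u = {v, x, r}" "r \<noteq> v" "r \<noteq> x" using N_third[of v u x] assms(3) by metis
    then have "r \<notin> D" using assms(5)[OF that] by (auto simp: dn_def)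
    then show ?thesis using r N_V[of r u] N_sym[of r u] by auto
  qed
  obtain r1 r2 r3 where r: "N u1 = {v, x, r1}" "N u2 = {v, x, r2}" "N u3 = {v, x, r3}"
    "r1 \<notin> D" "r2 \<notin> D" "r3 \<notin> D" "r1 \<in> V" "r2 \<in> V" "r3 \<in> V" "u1 \<in> N r1" "u2 \<in> N r2" "u3 \<in> N r3"
    using third[of u1] third[of u2] third[of u3] U by auto
  have D: "v \<in> D" "x \<in> D" "u1 \<notin> D" "u2 \<notin> D" "u3 \<notin> D" "u1 \<in> V" "u2 \<in> V" "u3 \<in> V"
    using lone_D assms(1,2) U N_V[of _ v] by auto
  have U': "N x = {u1, u2, u3}" using U assms(4) by simp
  \<comment> \<open>If \<open>a\<close> and \<open>b\<close> were adjacent, \<open>a\<close> would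
    cover \<open>v\<close>, \<open>x\<close> and \<open>b\<close>, and the outer neighbour
    \<open>s\<close> of \<open>c\<close> would cover \<open>c\<close> and a lone dominator
    \<open>w\<close> of \<open>s\<close>: two vertices in place of three.\<close>
  have adj: False
    if b: "b \<in> N a" and abc: "N v = {a, b, c}" "a \<noteq> b" "a \<noteq> c" "b \<noteq> c" for a b c
  proof -
    obtain ra rb s where s: "N a = {v, x, ra}" "N b = {v, x, rb}"
      "N c = {v, x, s}" "s \<notin> D" "s \<in> V" "c \<in> N s" "s \<noteq> v" "s \<noteq> x"
      using third[of a] third[of b] third[of c] abc(1) by auto
    have abD: "a \<notin> D" "b \<notin> D" "c \<notin> D" "a \<in> V" using abc(1) lone_D[OF assms(1)] N_V[of a v] by auto
    have "ra = b" using b s(1) abD D by auto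
    have "rb = a" using N_sym[OF b] s(2) abD D by auto
    have "a \<in> N v" "b \<in> N v" "c \<in> N v" using abc by auto
    have "c \<notin> N a" "c \<notin> N b" using s(1,2) \<open>ra = b\<close> \<open>rb = a\<close> abD D abc by auto
    then have sN: "s \<notin> N v" using abc(1) s(3,6) N_sym[of s a] N_sym[of s b] N_sym_iff[of c a] N_sym_iff[of c b] N_irrefl[of c] by auto
    obtain w w' where w: "lone w" "dn s = {w, w'}" using BB[of c s] s(3,4) \<open>c \<in> N v\<close> by auto
    then have wv: "w \<noteq> v" "w \<noteq> x" "w \<in> D" "s \<in> N w" using sN assms(4) mem_dn[of w s] by auto
    show False
    proof (rule exchange_three[of v x a w s])
      fix z assume "z \<in> N v \<union> N x" "z \<notin> {a, s}"
      then show "N z \<inter> {a, s} \<noteq> {}" using abc(1) assms(4) s(3) N_sym[OF b] by auto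
    qed (use wv D abD s assms(3,4) \<open>a \<in> N v\<close> in \<open>auto dest: lone_no_private[OF w(1)]\<close>)
  qed
  have nadj: "r1 \<notin> N v" "r2 \<notin> N v" "r3 \<notin> N v"
  proof -
    have "u2 \<notin> N u1" "u3 \<notin> N u1" "u3 \<notin> N u2"
      using adj[of u2 u1 u3] adj[of u3 u1 u2] adj[of u3 u2 u1] U by (auto simp: insert_commute)
    then show "r1 \<notin> N v" "r2 \<notin> N v" "r3 \<notin> N v"
      using r(1-3,10-12) N_irrefl N_sym_iff[of u1 u2] N_sym_iff[of u1 u3] N_sym_iff[of u2 u3]
      unfolding U(1) by blast+
  qed
  obtain a b where ab: "a \<noteq> b" "lone a" "lone b" "dn r1 = {a, b}" using BB[of u1 r1] U r by auto
  \<comment> \<open>If the dominators of \<open>r1\<close> and \<open>s\<close> are disjoint pairs,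
    \<open>{r1, s, w}\<close> replaces \<open>{v, x, a, c}\<close>; no vertex depends on
    \<open>a\<close> and \<open>c\<close> alone because \<open>b\<close> is the only partner of
    \<open>a\<close>. If the pairs meet, uniqueness of partners makes them equal.\<close>
  have common: "dn s = {a, b}"
    if *: "N v = {u1, u, w}" "u1 \<noteq> u" "u1 \<noteq> w" "u \<noteq> w" "N u = {v, x, s}" "s \<notin> D" "s \<notin> N v" for u w s
  proof -
    obtain c d where cd: "c \<noteq> d" "lone c" "lone d" "dn s = {c, d}" using BB[of u s] * by auto
    have m: "r1 \<in> N a" "r1 \<in> N b" "s \<in> N c" "s \<in> N d" using ab cd mem_dn by blast+
    have abD: "a \<in> D" "b \<in> D" "c \<in> D" "d \<in> D" using ab cd lone_D by blast+
    have ne: "a \<notin> {v, x}" "b \<notin> {v, x}" "c \<notin> {v, x}" "d \<notin> {v, x}"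
      using m nadj *(7) assms(4) by auto
    have "dn r1 \<inter> dn s \<noteq> {}"
    proof
      assume disj: "dn r1 \<inter> dn s = {}"
      then have acd: "a \<noteq> c" "b \<noteq> c" using ab cd by auto
      show False
      proof (rule exchange_card[of "{v, x, a, c}" "{r1, s, w}"])
        have "card {r1, s, w} \<le> 3" by (simp add: card_insert_if)
        moreover have "card {v, x, a, c} = 4" using ne acd assms(3) by auto
        ultimately show "card {r1, s, w} < card {v, x, a, c}" by linarith
        show "card {v, x, a, c} \<le> 6" using \<open>card {v, x, a, c} = 4\<close> by simp
        fix z assume "z \<in> {v, x, a, c}"
        then show "N z \<inter> {r1, s, w} \<noteq> {} \<or> dn z - {v, x, a, c} \<noteq> {}" using *(1) assms(4) m by auto
      next
        fix z assume z: "z \<in> V" "z \<notin> D" "dn z \<noteq> {}" "dn z \<subseteq> {v, x, a, c}" "z \<notin> {r1, s, w}"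
        show "N z \<inter> {r1, s, w} \<noteq> {}"
        proof (cases "z \<in> N v")
          case True
          then show ?thesis using *(1,5) r(1) z(5) by auto
        next
          case False
          then have "dn z \<subseteq> {a, c}" using z(4) mem_dn assms(4) by blast
          then consider "dn z = {a}" | "dn z = {c}" | "dn z = {a, c}" using z(3) by blast
          then show ?thesis
          proof cases
            case 3
            then have "z \<in> N a" "z \<in> N c" using mem_dn by blast+
            then have "b = c"
              using lone_partner_unique[of a b c r1 z] ab cd m acd by blast
            then show ?thesis using acd by simp
          qed (use lone_no_private ab cd in blast)+
        qed
      qed (use D abD r * N_V[of s u] N_V[of w v] lone_D(2)[OF assms(1), of w] in auto)
    qed
    then consider "a = c" | "a = d" | "b = c" | "b = d" using ab cd by auto
    then show ?thesis
    proof cases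
      case 1 then show ?thesis using lone_partner_unique[of a b d r1 s] ab cd m by blast
    next
      case 2 then show ?thesis using lone_partner_unique[of a b c r1 s] ab cd m by blast
    next
      case 3 then show ?thesis using lone_partner_unique[of b a d r1 s] ab cd m by blast
    next
      case 4 then show ?thesis using lone_partner_unique[of b a c r1 s] ab cd m by blast
    qed
  qed
  have r23: "dn r2 = {a, b}" "dn r3 = {a, b}"
    using common[of u2 u3 r2] common[of u3 u2 r3] U r nadj by auto
  have inN: "r1 \<in> N a" "r2 \<in> N a" "r3 \<in> N a" "r1 \<in> N b" "r2 \<in> N b" "r3 \<in> N b" "a \<in> D" "b \<in> D"
    using ab(4) r23 mem_dn by blast+
  \<comment> \<open>An outer neighbour common to two of the \<open>u\<close>'s would have four
    neighbours.\<close>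
  have distinct: False if "u \<in> N s" "u' \<in> N s" "u \<noteq> u'" "u \<notin> D" "u' \<notin> D" "a \<in> N s" "b \<in> N s" for u u' s
  proof -
    have "u \<noteq> a" "u \<noteq> b" "u' \<noteq> a" "u' \<noteq> b" using that inN by blast+
    then show False using N_eq3[of a s b u] that ab(1) by auto
  qed
  have rne: "r1 \<noteq> r2" "r1 \<noteq> r3" "r2 \<noteq> r3"
    using distinct[of u1 r1 u2] distinct[of u1 r1 u3] distinct[of u2 r2 u3] r U D inN N_sym by blast+
  have Nab: "N a = {r1, r2, r3}" "N b = {r1, r2, r3}" using inN rne by (intro N_eq3; simp)+
  have ne: "a \<notin> {v, x}" "b \<notin> {v, x}" using inN nadj assms(4) by auto
  \<comment> \<open>In the component, \<open>u1\<close> covers \<open>v\<close>, \<open>x\<close>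
    and \<open>r1\<close>; \<open>r2\<close> covers \<open>u2\<close>, \<open>a\<close> and
    \<open>b\<close>; \<open>u3\<close> covers \<open>r3\<close>.\<close>
  show False
  proof (rule exchange_card[of "{v, x, a, b}" "{u1, r2, u3}"])
    have c4: "card {v, x, a, b} = 4" using ne ab(1) assms(3) by auto
    moreover have "card {u1, r2, u3} \<le> 3" by (simp add: card_insert_if)
    ultimately show "card {u1, r2, u3} < card {v, x, a, b}" by linarith
    show "card {v, x, a, b} \<le> 6" using c4 by simp
    fix z assume "z \<in> {v, x, a, b}"
    then show "N z \<inter> {u1, r2, u3} \<noteq> {} \<or> dn z - {v, x, a, b} \<noteq> {}" using U(1) U' Nab by auto
  next
    fix z assume z: "z \<in> V" "z \<notin> D" "dn z \<noteq> {}" "dn z \<subseteq> {v, x, a, b}" "z \<notin> {u1, r2, u3}"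
    then have "z \<in> N v \<union> N x \<union> N a \<union> N b" using mem_dn by blast
    then show "N z \<inter> {u1, r2, u3} \<noteq> {}" using U(1) U' Nab r z(5) by auto
  qed (use D r inN in auto)
qed

text \<open>Replace \<open>x\<close>, \<open>y\<close>, \<open>w\<close> by \<open>u\<close> and
  \<open>h\<close>. The twin \<open>v\<close> stays and dominates all of \<open>N x\<close>;
  \<open>u\<close> covers \<open>x\<close> and \<open>r\<close>; \<open>h\<close> is a common
  neighbour of \<open>y\<close> and \<open>w\<close>. Hence, if the sole private neighbour of
  \<open>y\<close> has to give to a full twin pair, no lone vertex taxes what \<open>y\<close>
  receives from its neighbours of degree 3.\<close>

lemma full_twin_private_third:
  assumes "lone v" "lone x" "v \<noteq> x" "N v = N x" "\<And>u. u \<in> N v \<Longrightarrow> dn u = {v, x}"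
    and "u \<in> N v" "r \<in> N u" "r \<notin> D" "iso y" "priv y = {r}" "N y = {r, q, q'}" "deg q = 3" "w \<in> dn q" "lone w"
  shows False
proof -
  have y: "y \<in> D" "dn y = {}" "dn r = {y}" using assms(9,10) by (auto simp: iso_def priv_def)
  have D: "v \<in> D" "x \<in> D" "u \<notin> D" "u \<in> V" "u \<in> N x"
    using lone_D assms(1,2,4,6) N_V[of _ v] by auto
  have q: "q \<notin> D" "q' \<notin> D" "q \<in> V" "q' \<in> V" "q \<in> N y" "q' \<in> N y" "r \<in> N y"
    using y assms(11) N_V[of _ y] by (auto simp: dn_def)
  have w: "w \<in> D" "q \<in> N w" using assms(13) by (auto simp: mem_dn)
  have q3: "q \<notin> N v" "q \<notin> N x" using assms(3-5,12) by (auto simp: deg_def)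
  have ne: "w \<noteq> v" "w \<noteq> x" "w \<noteq> y" "y \<noteq> x" "y \<noteq> v"
    using w q3 assms(1,2,10,14) by (auto simp: lone_def)
  \<comment> \<open>If \<open>q'\<close> is dominated by \<open>w\<close> and \<open>y\<close> alone
    it would be lost, so it is chosen itself.\<close>
  obtain h where h: "h \<in> {q, q'}" "h \<in> N w" "\<And>z. dn z = {w, y} \<Longrightarrow> z \<in> N y \<Longrightarrow> z = h"
  proof (cases "dn q' = {w, y}")
    case True
    then have "q' \<in> N w" using mem_dn by blast
    moreover have "dn q \<noteq> {w, y}" using ne assms(12) by (auto simp: deg_def)
    moreover have "dn r \<noteq> {w, y}" using y ne by auto
    ultimately show thesis using that[of q'] assms(11) by auto
  next
    case False
    moreover have "dn r \<noteq> {w, y}" using y ne by auto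
    ultimately show thesis using that[of q] assms(11) w by auto
  qed
  show False
  proof (rule exchange_card[of "{x, y, w}" "{u, h}"])
    show "card {u, h} < card {x, y, w}" using ne by (simp add: card_insert_if)
    fix z assume "z \<in> {x, y, w}"
    then show "N z \<inter> {u, h} \<noteq> {} \<or> dn z - {x, y, w} \<noteq> {}" using D q h by auto
  next
    fix z assume z: "z \<in> V" "z \<notin> D" "dn z \<noteq> {}" "dn z \<subseteq> {x, y, w}" "z \<notin> {u, h}"
    have "z \<notin> N x" using z(4) assms(3-5) ne by auto
    then have "dn z \<subseteq> {y, w}" using z(4) mem_dn by blast
    then consider "dn z = {y}" | "dn z = {w}" | "dn z = {w, y}" using z(3) by blast
    then show "N z \<inter> {u, h} \<noteq> {}"
    proof cases
      case 1
      then have "z = r" using privI[OF z(2)] assms(10) by auto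
      then show ?thesis using assms(7) N_sym by blast
    next
      case 2
      then show ?thesis using lone_no_private[OF assms(14)] by blast
    next
      case 3
      then have "z \<in> N y" using mem_dn by blast
      then show ?thesis using h(3)[OF 3] z(5) by simp
    qed
  qed (use D y w q h in auto)
qed


text \<open>A vertex \<open>r\<close> outside \<open>D\<close> first passes \<open>give r z\<close> to its neighbours \<open>z\<close> outside \<open>D\<close>; then every vertex \<open>u\<close>
  outside \<open>D\<close> hands \<open>share u v\<close> to its neighbours \<open>v\<close> in \<open>D\<close>. The amounts are chosen so that the tight
  configurations of \<open>charge_one_private\<close>, \<open>charge_lonely\<close> and \<open>charge_paired\<close> reach \<open>38/5\<close> exactly.\<close>

definition full :: "'a \<Rightarrow> bool" where
  "full z \<longleftrightarrow> (\<exists>v x. lone v \<and> lone x \<and> v \<noteq> x \<and> N v = N x \<and> (\<forall>u\<in>N v. dn u = {v, x}) \<and> z \<in> N v)"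

text \<open>The situation of \<open>twin_common_third\<close>: the common third neighbour
  \<open>r\<close> gives 1/2 to each of \<open>u1\<close> and \<open>u2\<close>.\<close>

definition double :: "'a \<Rightarrow> 'a \<Rightarrow> bool" where
  "double r z \<longleftrightarrow> deg r = 1 \<and> (\<exists>v x u1 u2 u3. exact_pair v x u1 u2 \<and> N v = {u1, u2, u3} \<and> N x = {u1, u2, u3}
     \<and> deg u3 = 3 \<and> N u1 = {v, x, r} \<and> N u2 = {v, x, r} \<and> z \<in> {u1, u2})"

text \<open>A vertex of degree 2 without a lone dominator owes 1 to each dominator and can spare 1
  for its single neighbour outside \<open>D\<close>. The amount 1/5 is what a \<open>full\<close>
  twin pair lacks: each twin collects \<open>3 * 3/2\<close>, needs \<open>23/5\<close>, and
  receives half of the gift.\<close>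

definition give :: "'a \<Rightarrow> 'a \<Rightarrow> real" where
  "give r z = (if deg r = 2 \<and> nlone r = 0 then 1 else if double r z then 1/2
     else if full z \<and> (deg r = 1 \<or> deg r = 2 \<and> nlone r = 1) then 1/5 else 0)"

definition expense :: "'a \<Rightarrow> real" where "expense r = (\<Sum>z\<in>N r - D. give r z)"
definition income :: "'a \<Rightarrow> real" where "income z = (\<Sum>r\<in>N z - D. give r z)"

text \<open>Paid by each of the two other dominators of a vertex of degree 3 to its lone one. An
  unpaired lone vertex with \<open>twice v = 0\<close> needs \<open>23/15 = 1 + 2 * 4/15\<close>
  from each neighbour; if some neighbour has degree 2 and pays \<open>9/5\<close>, then
  \<open>7/5 = 1 + 2 * 1/5\<close> from the others suffices.\<close>

definition tax :: "'a \<Rightarrow> real" where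
  "tax u = (if \<exists>v\<in>dn u. lone v \<and> twice v = 0 then 4/15 else 1/5)"

text \<open>For two lone dominators the last summand is a tenth of the difference of their
  \<open>twice\<close> values, moved from the one with more neighbours of degree 2 to the other; it
  cancels in the sum. On degree 3 with two lone dominators,
  \<open>11/10 + 11/10 + 4/5 = 3\<close>.\<close>

definition share :: "'a \<Rightarrow> 'a \<Rightarrow> real" where
  "share u v =
    (if deg u = 1 then 3 + income u - expense u
     else if deg u = 2 then
       (if nlone u = 2 then 3/2 + income u / 2 + ((\<Sum>x\<in>dn u. real (twice x)) - 2 * real (twice v)) / 10
        else if nlone u = 1 \<and> lone v then 2 - expense u else 1)
     else
       (if nlone u = 2 then (if lone v then 11/10 else 4/5)
        else if nlone u = 1 then (if lone v then 1 + 2 * tax u else 1 - tax u) else 1))"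

section \<open>Discharging: no vertex outside \<open>D\<close> hands out more than it has\<close>

lemma nlone_sum: "nlone u = (\<Sum>v\<in>dn u. if lone v then 1 else 0)"
  by (simp add: nlone_def sum.inter_filter[symmetric])

lemma give_nonneg: "0 \<le> give r z"
  by (simp add: give_def)

lemma income_nonneg: "0 \<le> income z"
  unfolding income_def by (intro sum_nonneg give_nonneg)

lemma give_le_inn:
  assumes "r \<in> N z" "r \<notin> D"
  shows "give r z \<le> income z"
  unfolding income_def by (rule member_le_sum) (use assms give_nonneg in auto)

lemma card_N_Diff_D:
  assumes "u \<in> V"
  shows "card (N u - D) = 3 - deg u"
proof -
  have "N u - D = N u - dn u" by (auto simp: dn_def)
  then show ?thesis using card_N[OF assms] by (simp add: deg_def card_Diff_subset dn_def)
qed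

lemma expense_le:
  assumes "u \<in> V" "\<And>z. z \<in> N u - D \<Longrightarrow> give u z \<le> c"
  shows "expense u \<le> (3 - real (deg u)) * c"
proof -
  have "expense u \<le> real (card (N u - D)) * c" unfolding expense_def using assms(2) by (rule sum_bounded_above)
  then show ?thesis using card_N_Diff_D[OF assms(1)] deg_le3[of u] by (simp add: of_nat_diff)
qed

lemma give_le_half: "deg r = 1 \<Longrightarrow> give r z \<le> 1/2"
  by (simp add: give_def)

lemma give_le_fifth: "\<not> double r z \<Longrightarrow> deg r \<noteq> 2 \<or> nlone r \<noteq> 0 \<Longrightarrow> give r z \<le> 1/5"
  by (simp add: give_def)

lemma tax_bounds: "1/5 \<le> tax u" "tax u \<le> 4/15"
  by (simp_all add: tax_def)

text \<open>Among three lone dominators of one vertex, each would have two partners.\<close>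

lemma nlone_le2:
  assumes "u \<notin> D"
  shows "nlone u \<le> 2"
proof (rule ccontr)
  assume "\<not> ?thesis"
  then have "3 \<le> card {v \<in> dn u. lone v}" by (simp add: nlone_def)
  then obtain T where T: "T \<subseteq> {v \<in> dn u. lone v}" "card T = 3" by (rule obtain_subset_with_card_n)
  then obtain a b c where "T = {a, b, c}" "a \<noteq> b" "a \<noteq> c" "b \<noteq> c" by (metis card_3_iff)
  then have "lone a" "lone b" "lone c" "u \<in> N a" "u \<in> N b" "u \<in> N c" using T mem_dn by blast+
  then show False using lone_partner_unique[of a b c u u] \<open>a \<noteq> b\<close> \<open>a \<noteq> c\<close> \<open>b \<noteq> c\<close> by blast
qed

lemma sum_share:
  assumes "u \<in> V" "u \<notin> D"
  shows "(\<Sum>v\<in>dn u. share u v) \<le> 3 + income u - expense u"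
proof -
  have "deg u \<ge> 1" "deg u \<le> 3" using deg_ge1[OF assms] deg_le3 by auto
  then consider "deg u = 1" | "deg u = 2" | "deg u = 3" by linarith
  then show ?thesis
  proof cases
    case 1
    then obtain v where "dn u = {v}" by (auto simp: deg_def card_1_singleton_iff)
    then show ?thesis using 1 by (simp add: share_def)
  next
    case 2
    then obtain a b where ab: "dn u = {a, b}" "a \<noteq> b" by (auto simp: deg_def card_2_iff)
    then have nlone: "nlone u = (if lone a then 1 else 0) + (if lone b then 1 else 0)" by (simp add: nlone_sum)
    have "expense u \<le> 1" using expense_le[OF assms(1), of 1] 2 by (simp add: give_def)
    moreover have "expense u = 0" if "nlone u = 2"
      unfolding expense_def using 2 that by (intro sum.neutral) (auto simp: give_def double_def)
    ultimately show ?thesis using 2 ab nlone income_nonneg[of u]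
      by (cases "lone a"; cases "lone b") (simp_all add: share_def field_simps)
  next
    case 3
    then obtain a b c where abc: "dn u = {a, b, c}" "a \<noteq> b" "a \<noteq> c" "b \<noteq> c"
      unfolding deg_def by (metis card_3_iff)
    then have nlone: "nlone u = (if lone a then 1 else 0) + (if lone b then 1 else 0) + (if lone c then 1 else 0)"
      by (simp add: nlone_sum)
    have "N u - D = {}" using deg3_N[OF 3 assms(1)] by blast
    then have "expense u = 0" unfolding expense_def by (simp only: sum.empty)
    then show ?thesis using 3 abc nlone income_nonneg[of u] nlone_le2[OF assms(2)]
      by (cases "lone a"; cases "lone b"; cases "lone c") (simp_all add: share_def)
  qed
qed

lemma double_owner:
  assumes "double r z" "dn r = {y}"
  shows "iso y" "card (priv y) \<ge> 2"
  using assms twin_common_third unfolding double_def by blast+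

lemma share_ge_private:
  assumes "u \<in> V" "deg u = 1"
  shows "share u v \<ge> 2"
  using expense_le[OF assms(1) give_le_half[OF assms(2)]] assms(2) income_nonneg[of u]
  by (simp add: share_def)

text \<open>Such an owner excludes \<open>double\<close> gifts, so \<open>u\<close> spends at most
  1/5 on each of two neighbours and keeps \<open>13/5\<close>.\<close>

lemma share_ge_private':
  assumes "u \<in> V" "u \<notin> D" "dn u = {y}" "\<not> iso y \<or> card (priv y) < 2"
  shows "share u v \<ge> 13/5"
proof -
  have "\<not> double u z" for z using double_owner[OF _ assms(3)] assms(4) by fastforce
  then have "give u z \<le> 1/5" for z
    using assms(3) by (intro give_le_fifth) (auto simp: deg_def)
  then have "expense u \<le> (3 - real (deg u)) * (1/5)" by (intro expense_le[OF assms(1)])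
  then show ?thesis using assms(3) income_nonneg[of u] by (simp add: share_def deg_def)
qed

text \<open>The worst case \<open>11/15\<close> is \<open>1 - 4/15\<close>, the higher tax.\<close>

lemma share_nonlone:
  assumes "u \<notin> D" "deg u \<noteq> 1" "\<not> lone v" "v \<in> dn u"
  shows "share u v \<ge> 11/15"
    and "\<lbrakk>nlone u \<noteq> 1 \<or> tax u = 1/5\<rbrakk> \<Longrightarrow> share u v \<ge> 4/5"
    and "deg u = 2 \<or> nlone u = 0 \<Longrightarrow> share u v \<ge> 1"
proof -
  have n2: "nlone u \<noteq> 2" if "deg u = 2"
  proof
    assume "nlone u = 2"
    then have "{w \<in> dn u. lone w} = dn u" using that by (intro card_subset_eq) (auto simp: nlone_def deg_def)
    then show False using assms(3,4) by blast
  qed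
  show "share u v \<ge> 11/15" "\<lbrakk>nlone u \<noteq> 1 \<or> tax u = 1/5\<rbrakk> \<Longrightarrow> share u v \<ge> 4/5"
    "deg u = 2 \<or> nlone u = 0 \<Longrightarrow> share u v \<ge> 1"
    using n2 assms tax_bounds[of u] by (auto simp: share_def)
qed

section \<open>Every vertex of \<open>D\<close> collects at least \<open>38/5\<close>\<close>

abbreviation charge :: "'a \<Rightarrow> real" where
  "charge v \<equiv> 3 + (\<Sum>u\<in>N v - D. share u v)"

lemma charge_noniso:
  assumes "v \<in> D" "dn v \<noteq> {}"
  shows "charge v \<ge> 38/5"
proof -
  obtain y r r' where r: "N v = {y, r, r'}" "r \<noteq> r'" "y \<in> D" "priv v = {r, r'}"
    by (rule noniso_cases[OF assms])
  then have rD: "r \<notin> D" "r' \<notin> D" "dn r = {v}" "dn r' = {v}" "r \<in> V" "r' \<in> V"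
    using N_V[of r v] N_V[of r' v] by (auto simp: priv_def)
  have "N v - D = {r, r'}" using r rD by auto
  moreover have "share r v \<ge> 13/5" "share r' v \<ge> 13/5"
    using share_ge_private' rD assms by (auto simp: iso_def)
  ultimately show ?thesis using r(2) by simp
qed

lemma iso_N_Diff: "iso v \<Longrightarrow> N v - D = N v"
  by (auto simp: iso_def dn_def)

text \<open>The bound 2 per private neighbour allows for \<open>double\<close> gifts, and
  \<open>2 + 2 + 11/15\<close> still exceeds the required \<open>23/5\<close>.\<close>

lemma charge_two_private:
  assumes "iso v" "card (priv v) \<ge> 2"
  shows "charge v \<ge> 38/5"
proof -
  obtain a b where ab: "a \<in> priv v" "b \<in> priv v" "a \<noteq> b"
    using obtain_subset_with_card_n[OF assms(2)] by (metis card_2_iff insert_subset)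
  then have abN: "a \<in> N v" "b \<in> N v" "deg a = 1" "deg b = 1" by (auto simp: priv_def deg_def)
  obtain c where c: "N v = {a, b, c}" "c \<noteq> a" "c \<noteq> b" by (rule N_third[OF abN(1,2) ab(3)])
  have V: "a \<in> V" "b \<in> V" "c \<in> V" using c N_V[of _ v] by auto
  have cD: "c \<notin> D" "v \<in> dn c" using c assms(1) mem_dn[of v c] by (auto simp: iso_def dn_def)
  have "\<not> lone v" using ab by (auto simp: lone_def)
  then have "share c v \<ge> 11/15"
    using share_ge_private[OF V(3), of v] share_nonlone(1)[OF cD(1) _ _ cD(2)] by (cases "deg c = 1") auto
  then show ?thesis using share_ge_private[OF V(1) abN(3), of v] share_ge_private[OF V(2) abN(4), of v]
      iso_N_Diff[OF assms(1)] c ab by simp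
qed

text \<open>If \<open>p\<close> has a \<open>full\<close> neighbour outside \<open>D\<close>,
  \<open>13/5 + 1 + 1 = 23/5\<close> is tight. Otherwise \<open>p\<close> keeps its 3. If the higher
  tax may apply with \<open>q\<close>, \<open>q'\<close> both of degree 3, \<open>p\<close> has
  income 1; if the lower one does, \<open>3 + 4/5 + 4/5\<close> is tight; if \<open>q\<close> or
  \<open>q'\<close> has degree 2, that one pays 1.\<close>

lemma charge_one_private:
  assumes "iso v" "card (priv v) = 1"
  shows "charge v \<ge> 38/5"
proof -
  obtain p where p: "priv v = {p}" using assms(2) by (auto simp: card_1_singleton_iff)
  then have "p \<in> priv v" by simp
  then have pN: "p \<in> N v" "p \<notin> D" "dn p = {v}" "deg p = 1" by (auto simp: priv_def deg_def)
  obtain q q' where q: "N v = {p, q, q'}" "p \<noteq> q" "p \<noteq> q'" "q \<noteq> q'" by (rule N_others[OF pN(1)])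
  have V: "p \<in> V" "q \<in> V" "q' \<in> V" using q N_V[of _ v] by auto
  have qD: "q \<notin> D" "q' \<notin> D" "v \<in> dn q" "v \<in> dn q'"
    using q assms(1) mem_dn[of v q] mem_dn[of v q'] by (auto simp: iso_def dn_def)
  have nlonev: "\<not> lone v" using p by (simp add: lone_def)
  have d1: "deg z \<noteq> 1" if "z \<in> {q, q'}" for z
  proof
    assume "deg z = 1"
    then have "dn z = {v}" using that qD by (auto simp: deg_def card_1_singleton_iff)
    then have "z \<in> priv v" using that qD by (intro privI) auto
    then show False using p q that by auto
  qed
  have d23: "deg z = 2 \<or> deg z = 3" if "z \<in> {q, q'}" for z
    using d1[OF that] deg_le3[of z] deg_ge1[of z] that V qD by fastforce
  have ch: "charge v = 3 + share p v + share q v + share q' v"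
    using iso_N_Diff[OF assms(1)] q by simp
  have ge: "share q v \<ge> 11/15" "share q' v \<ge> 11/15"
    using share_nonlone(1) d1 nlonev qD by auto
  have sp: "share p v \<ge> 13/5" by (rule share_ge_private'[OF V(1) pN(2,3)]) (use assms in simp)
  have ndbl: "\<not> double p z" for z using double_owner(2)[OF _ pN(3), of z] assms(2) by fastforce
  show ?thesis
  proof (cases "\<exists>z\<in>N p - D. full z")
    case True
    then obtain z a b where z: "z \<in> N p" "lone a" "lone b" "a \<noteq> b" "N a = N b" "\<And>u. u \<in> N a \<Longrightarrow> dn u = {a, b}" "z \<in> N a"
      unfolding full_def by blast
    have pz: "p \<in> N z" using z(1) N_sym by blast
    have no: "w \<notin> dn y" if "lone w" "y \<in> {q, q'}" "deg y = 3" for w y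
    proof
      assume w: "w \<in> dn y"
      show False
        using full_twin_private_third[OF z(2-7) pz pN(2) assms(1) p, of y "if y = q then q' else q" w] q that w
        by (auto simp: insert_commute split: if_splits)
    qed
    have "deg y = 2 \<or> nlone y = 0" if "y \<in> {q, q'}" for y
      using d23[OF that] no[OF _ that] by (auto simp: nlone_def)
    then have "share q v \<ge> 1" "share q' v \<ge> 1" using share_nonlone(3) d1 nlonev qD by auto
    then show ?thesis using ch sp by linarith
  next
    case False
    then have "expense p = 0"
      unfolding expense_def using ndbl pN(4) by (intro sum.neutral) (auto simp: give_def)
    then have sp: "share p v = 3 + income p" using pN(4) by (simp add: share_def)
    show ?thesis
    proof (cases "deg q = 3 \<and> deg q' = 3 \<and> (\<exists>w y. y \<in> {q, q'} \<and> w \<in> dn y \<and> lone w \<and> twice w = 0)")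
      case True
      then obtain w y where w: "y \<in> {q, q'}" "w \<in> dn y" "lone w" "twice w = 0" by blast
      define y' where "y' = (if y = q then q' else q)"
      have y: "N v = {p, y, y'}" "deg y = 3" "deg y' = 3" using w q True by (auto simp: y'_def)
      obtain r r' where r: "N p = {v, r, r'}" "v \<noteq> r" using N_others[of v p] pN(1) N_sym by metis
      have rN: "r \<in> N p" "r \<notin> D" "p \<in> N r" using r pN(3) N_sym[of r p] by (auto simp: dn_def)
      have "deg r = 2" using sole_private_flip[OF assms(1) p y rN(1)] r by auto
      moreover have "\<not> lone s" if "s \<in> dn r" for s
        using sole_private_no_lone[OF assms(1) p y rN(1) _ w(3,2,4) that] r by auto
      then have "nlone r = 0" by (simp add: nlone_def)
      ultimately have "income p \<ge> 1" using give_le_inn[OF rN(1,2)] by (simp add: give_def)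
      then show ?thesis using ch sp ge by linarith
    next
      case F: False
      show ?thesis
      proof (cases "deg q = 3 \<and> deg q' = 3")
        case True
        then have "tax q = 1/5" "tax q' = 1/5" using F by (auto simp: tax_def)
        then have "share q v \<ge> 4/5" "share q' v \<ge> 4/5" using share_nonlone(2) d1 nlonev qD by auto
        then show ?thesis using ch sp income_nonneg[of p] by linarith
      next
        case False
        then have "deg q = 2 \<or> deg q' = 2" using d23 by blast
        then have "share q v \<ge> 1 \<or> share q' v \<ge> 1" using share_nonlone(3) d1 nlonev qD by auto
        then show ?thesis using ch sp ge income_nonneg[of p] by linarith
      qed
    qed
  qed
qed

lemma nlone_eq1:
  assumes "lone v" "u \<in> N v" "\<And>x. lone x \<Longrightarrow> u \<in> N x \<Longrightarrow> x = v"
  shows "nlone u = 1"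
proof -
  have "{w \<in> dn u. lone w} = {v}" using assms mem_dn lone_D by blast
  then show ?thesis by (simp add: nlone_def)
qed

lemma share_lonely:
  assumes "lone v" "u \<in> N v" "nlone u = 1"
  shows "deg u = 2 \<Longrightarrow> share u v \<ge> 9/5" "share u v \<ge> 7/5"
    "deg u \<noteq> 2 \<Longrightarrow> twice v = 0 \<Longrightarrow> share u v \<ge> 23/15"
proof -
  have u: "u \<in> V" "v \<in> dn u" using assms N_V lone_D mem_dn by blast+
  have "deg u \<ge> 2" using lone_deg assms by blast
  show *: "share u v \<ge> 9/5" if "deg u = 2"
  proof -
    have "expense u \<le> (3 - real (deg u)) * (1/5)"
      by (intro expense_le[OF u(1)] give_le_fifth) (use that assms(3) in \<open>auto simp: double_def\<close>)
    then show ?thesis using that assms(1,3) by (simp add: share_def)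
  qed
  have ge: "share u v = 1 + 2 * tax u" if "deg u \<noteq> 2"
    using that \<open>deg u \<ge> 2\<close> assms by (simp add: share_def)
  show "share u v \<ge> 7/5" using * ge tax_bounds[of u] by (cases "deg u = 2") auto
  show "share u v \<ge> 23/15" if "deg u \<noteq> 2" "twice v = 0"
    using ge[OF that(1)] that(2) assms(1) u(2) by (auto simp: tax_def)
qed

text \<open>Both cases are tight: \<open>3 * 23/15\<close> and \<open>9/5 + 2 * 7/5\<close> equal
  \<open>23/5\<close>.\<close>

lemma charge_lonely:
  assumes "lone v" "\<And>x u. lone x \<Longrightarrow> u \<in> N v \<Longrightarrow> u \<in> N x \<Longrightarrow> x = v"
  shows "charge v \<ge> 38/5"
proof -
  have "v \<in> V" using assms(1) lone_D D_V by blast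
  then obtain a b c where abc: "N v = {a, b, c}" "a \<noteq> b" "a \<noteq> c" "b \<noteq> c"
    using card_N[of v] by (metis card_3_iff)
  have n: "nlone u = 1" if "u \<in> N v" for u using nlone_eq1[OF assms(1) that] assms(2) that by blast
  have ch: "charge v = 3 + share a v + share b v + share c v"
    using iso_N_Diff[of v] assms(1) abc by (simp add: lone_def)
  show ?thesis
  proof (cases "twice v = 0")
    case True
    have "share u v \<ge> 23/15" if "u \<in> N v" for u
      using share_lonely(3)[OF assms(1) that n[OF that] _ True] True that by (auto simp: twice_def)
    then have "share a v \<ge> 23/15" "share b v \<ge> 23/15" "share c v \<ge> 23/15" using abc by auto
    then show ?thesis using ch by linarith
  next
    case False
    then obtain u where u: "u \<in> N v" "deg u = 2" by (auto simp: twice_def)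
    then have "share u v \<ge> 9/5" using share_lonely(1)[OF assms(1)] n by auto
    moreover have "share u v \<ge> 7/5" if "u \<in> N v" for u using share_lonely(2)[OF assms(1) that n[OF that]] .
    then have "share a v \<ge> 7/5" "share b v \<ge> 7/5" "share c v \<ge> 7/5" using abc by auto
    ultimately show ?thesis using ch u(1) abc by auto
  qed
qed

text \<open>With \<open>s\<close>, \<open>t\<close> the third neighbours, the tight sums are
  \<open>2 * (3/2 - 1/10) + 9/5\<close> and \<open>2 * (3/2 + 1/10) + 7/5\<close> for
  \<open>s \<noteq> t\<close>, and, for twins, \<open>3 * 3/2 + 1/10\<close> if
  \<open>deg s = 2\<close> and \<open>3 + 1/2 + 11/10\<close> if \<open>deg s = 3\<close>. The
  tenths in \<open>share\<close> balance the first two.\<close>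

lemma charge_paired:
  assumes "lone v" "lone x" "v \<noteq> x" "u \<in> N v" "u \<in> N x"
  shows "charge v \<ge> 38/5"
proof -
  obtain u1 u2 where u: "u1 \<noteq> u2" "dn u1 = {v, x}" "dn u2 = {v, x}"
    "u1 \<in> N v" "u1 \<in> N x" "u2 \<in> N v" "u2 \<in> N x" by (rule lone_share2[OF assms])
  then have p: "pair v x u1 u2" using assms by (simp add: pair_def)
  note P = pairD[OF p]
  obtain s where s: "N v = {u1, u2, s}" "s \<noteq> u1" "s \<noteq> u2" by (rule N_third[OF u(4,6,1)])
  obtain t where t: "N x = {u1, u2, t}" "t \<noteq> u1" "t \<noteq> u2" by (rule N_third[OF u(5,7,1)])
  have d2: "deg u1 = 2" "deg u2 = 2" using u assms by (auto simp: deg_def)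
  have n2: "nlone u1 = 2" "nlone u2 = 2" using u assms by (auto simp: nlone_sum)
  have ch: "charge v = 3 + share u1 v + share u2 v + share s v"
    using iso_N_Diff[of v] assms(1) s u(1) by (simp add: lone_def)
  have sh: "share u1 v = 3/2 + income u1 / 2 + (real (twice x) - real (twice v)) / 10"
    "share u2 v = 3/2 + income u2 / 2 + (real (twice x) - real (twice v)) / 10"
    using d2 n2 u assms(3) by (simp_all add: share_def field_simps)
  have fil: "{z \<in> {u1, u2, w}. deg z = 2} = (if deg w = 2 then {u1, u2, w} else {u1, u2})" for w
    using d2 by auto
  have tv: "twice v = (if deg s = 2 then 3 else 2)" "twice x = (if deg t = 2 then 3 else 2)"
    unfolding twice_def s(1) t(1) fil using s(2,3) t(2,3) u(1) by simp_all
  have sV: "s \<in> N v" "t \<in> N x" "s \<in> V" "t \<in> V" "s \<notin> D" "t \<notin> D"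
    using s t N_V[of s v] N_V[of t x] lone_D assms by auto
  have dge: "deg s \<ge> 2" "deg t \<ge> 2" "deg s \<le> 3" "deg t \<le> 3" using lone_deg assms sV deg_le3 by auto
  note i0 = income_nonneg[of u1] income_nonneg[of u2]
  show ?thesis
  proof (cases "s = t")
    case False
    have e: "exact_pair v x u1 u2"
      unfolding exact_pair_def
    proof (intro conjI allI impI p)
      fix z assume "dn z = {v, x}"
      then have "z \<in> N v" "z \<in> N x" using mem_dn by blast+
      then show "z = u1 \<or> z = u2" using s t False by auto
    qed
    have "s \<notin> N x" using False s t by auto
    have ns: "nlone s = 1"
    proof (rule nlone_eq1[OF assms(1) sV(1)])
      fix y assume "lone y" "s \<in> N y"
      then show "y = v" using lone_partner_unique[of v x y u s] assms sV \<open>s \<notin> N x\<close> by blast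
    qed
    note L = share_lonely[OF assms(1) sV(1) ns]
    consider "deg s = 2" | "deg s = 3" "deg t = 2" | "deg s = 3" "deg t = 3" using dge by linarith
    then show ?thesis
    proof cases
      case 1
      then show ?thesis using L(1)[OF 1] ch sh tv i0 by (auto split: if_splits)
    next
      case 2
      then show ?thesis using L(2) ch sh tv i0 by auto
    next
      case 3
      obtain r1 r2 where r: "N u1 = {v, x, r1}" "r1 \<notin> D" "r1 \<noteq> v" "r1 \<noteq> x"
        by (rule exact_pair_thirds[OF e])
      have "r1 \<in> N u1" using r by simp
      note T = open_pair_third[OF e s(1) t(1) False 3 this r(3,4)]
      have "nlone r1 = 0" using T(2) by (auto simp: nlone_def)
      then have "income u1 \<ge> 1" using give_le_inn[OF \<open>r1 \<in> N u1\<close> r(2)] T(1) by (simp add: give_def)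
      then show ?thesis using L(2) ch sh tv i0 3 by auto
    qed
  next
    case True
    then have tts: "twice x = twice v" using tv by simp
    have Nvx: "N v = N x" using s t True by simp
    show ?thesis
    proof (cases "deg s = 2")
      case ds: True
      have "dn s = {v, x}"
      proof -
        have "{v, x} \<subseteq> dn s" using sV True P mem_dn by blast
        moreover have "card (dn s) = card {v, x}" using ds assms(3) by (simp add: deg_def)
        ultimately show ?thesis using card_subset_eq[of "dn s" "{v, x}"] by simp
      qed
      then have all: "dn z = {v, x}" if "z \<in> N v" for z using that s u by auto
      have dn2: "share z v = 3/2 + income z / 2" if "z \<in> N v" for z
        using all[OF that] assms tts by (simp add: share_def deg_def nlone_sum)
      obtain z r where z: "z \<in> N v" "r \<in> N z" "r \<notin> D" "nlone r < 2 \<or> deg r \<noteq> 2"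
        by (rule full_twin_some_third[OF assms(1-3) Nvx all])
      have fz: "full z" unfolding full_def using assms(1-3) Nvx all z(1) by blast
      have "z \<notin> D" "r \<in> V" "z \<in> N r" using z assms(1) lone_D N_V(1)[of r z] N_sym by blast+
      then have "deg r \<le> 2" "deg r \<ge> 1" using deg_le2[of z r] deg_ge1[of r] z(3) by auto
      then have "give r z \<ge> 1/5" using z(4) fz by (auto simp: give_def)
      then have "income z \<ge> 1/5" using give_le_inn[OF z(2,3)] by linarith
      moreover have "z = u1 \<or> z = u2 \<or> z = s" using z(1) s(1) by simp
      ultimately have "income u1 + income u2 + income s \<ge> 1/5" using i0 income_nonneg[of s] by fastforce
      then show ?thesis using ch dn2[of u1] dn2[of u2] dn2[of s] u(4,6) sV(1) by simp
    next
      case ds: False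
      then have ds: "deg s = 3" using dge by linarith
      have e: "exact_pair v x u1 u2"
        unfolding exact_pair_def
      proof (intro conjI allI impI p)
        fix z assume z: "dn z = {v, x}"
        then have "z \<in> N v" using mem_dn by blast
        moreover have "z \<noteq> s" using z ds assms(3) by (auto simp: deg_def)
        ultimately show "z = u1 \<or> z = u2" using s by auto
      qed
      have "nlone s \<ge> 2"
      proof -
        have "{v, x} \<subseteq> {w \<in> dn s. lone w}" using assms sV True P mem_dn by blast
        then have "card {v, x} \<le> nlone s" unfolding nlone_def by (intro card_mono) auto
        then show ?thesis using assms(3) by simp
      qed
      then have "nlone s = 2" using nlone_le2[OF sV(5)] by simp
      then have ss: "share s v = 11/10" using ds assms(1) by (simp add: share_def)
      have Nx: "N x = {u1, u2, s}" using s Nvx by simp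
      obtain r1 r2 where r: "N u1 = {v, x, r1}" "N u2 = {v, x, r2}" "r1 \<notin> D" "r2 \<notin> D"
        by (rule exact_pair_thirds[OF e])
      have rN: "r1 \<in> N u1" "r2 \<in> N u2" using r by auto
      \<comment> \<open>Either one of two distinct third neighbours gives 1, or the common one gives
        1/2 twice.\<close>
      have "income u1 + income u2 \<ge> 1"
      proof (cases "r1 = r2")
        case False
        have "give r1 u1 = 1 \<or> give r2 u2 = 1"
          using twin_third[OF e s(1) Nx ds r(1,2) False] by (auto simp: give_def nlone_def)
        then show ?thesis using give_le_inn[OF rN(1) r(3)] give_le_inn[OF rN(2) r(4)] i0 by linarith
      next
        case True
        have "r1 \<in> V" using rN N_V by blast
        have "{u1, u2} \<subseteq> N r1 - D" using rN True N_sym P by blast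
        then have "card {u1, u2} \<le> 3 - deg r1"
          unfolding card_N_Diff_D[OF \<open>r1 \<in> V\<close>, symmetric] by (intro card_mono) auto
        then have "deg r1 = 1" using deg_ge1[OF \<open>r1 \<in> V\<close> r(3)] u(1) by simp
        have "double r1 u1" "double r1 u2"
          unfolding double_def using \<open>deg r1 = 1\<close> e s(1) Nx ds r(1,2) True by blast+
        then have "give r1 u1 \<ge> 1/2" "give r2 u2 \<ge> 1/2" using True by (auto simp: give_def)
        then show ?thesis using give_le_inn[OF rN(1) r(3)] give_le_inn[OF rN(2) r(4)] by linarith
      qed
      then show ?thesis using ch sh tts ss by simp
    qed
  qed
qed

lemma charge_ge:
  assumes "v \<in> D"
  shows "charge v \<ge> 38/5"
proof (cases "iso v")
  case False
  then show ?thesis using charge_noniso assms by (simp add: iso_def)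
next
  case True
  have "finite (priv v)" by (simp add: priv_def)
  then have "card (priv v) = 0 \<Longrightarrow> lone v" using True by (simp add: lone_def)
  then consider "card (priv v) \<ge> 2" | "card (priv v) = 1" | "lone v" by linarith
  then show ?thesis
    using charge_two_private[OF True] charge_one_private[OF True] charge_lonely[of v] charge_paired[of v]
    by cases blast+
qed

text \<open>Double counting: each gift is the expense of one vertex outside \<open>D\<close> and the
  income of another, so gifts cancel and \<open>D\<close> holds at most 3 per vertex of the
  graph.\<close>

theorem local_opt_bound: "38 * card D \<le> 15 * card V"
proof -
  have fV: "finite (V - D)" using finite_V by simp
  have "38/5 * real (card D) \<le> (\<Sum>v\<in>D. charge v)"
    using sum_bounded_below[of D "38/5" charge] charge_ge by (simp add: mult.commute)
  also have "\<dots> = 3 * real (card D) + (\<Sum>v\<in>D. \<Sum>u\<in>N v - D. share u v)"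
    by (simp add: sum.distrib)
  also have "(\<Sum>v\<in>D. \<Sum>u\<in>N v - D. share u v) = (\<Sum>v\<in>D. \<Sum>u | u \<in> V - D \<and> u \<in> N v. share u v)"
    by (intro sum.cong refl) (use N_V in auto)
  also have "\<dots> = (\<Sum>u\<in>V - D. \<Sum>v | v \<in> D \<and> u \<in> N v. share u v)"
    by (rule sum.swap_restrict) (use fV in auto)
  also have "\<dots> = (\<Sum>u\<in>V - D. \<Sum>v\<in>dn u. share u v)"
    by (intro sum.cong refl) (auto simp: mem_dn)
  also have "\<dots> \<le> (\<Sum>u\<in>V - D. 3 + income u - expense u)"
    by (intro sum_mono sum_share) auto
  also have "\<dots> = 3 * real (card (V - D)) + (\<Sum>u\<in>V - D. income u) - (\<Sum>u\<in>V - D. expense u)"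
    by (simp add: sum.distrib sum_subtractf)
  also have "(\<Sum>u\<in>V - D. expense u) = (\<Sum>u\<in>V - D. \<Sum>z | z \<in> V - D \<and> z \<in> N u. give u z)"
    unfolding expense_def by (intro sum.cong refl) (use N_V in auto)
  also have "\<dots> = (\<Sum>z\<in>V - D. \<Sum>u | u \<in> V - D \<and> z \<in> N u. give u z)"
    by (rule sum.swap_restrict) (use fV in auto)
  also have "\<dots> = (\<Sum>u\<in>V - D. income u)"
    unfolding income_def by (intro sum.cong refl) (use N_V N_sym_iff in auto)
  finally have "38/5 * real (card D) \<le> 3 * (real (card D) + real (card (V - D)))" by simp
  also have "real (card D) + real (card (V - D)) = real (card V)"
    using card_Diff_subset[OF finite_D D_V] card_mono[OF finite_V D_V] by simp
  finally have "real (38 * card D) \<le> real (15 * card V)" by simp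
  then show ?thesis by linarith
qed

end

section \<open>Weighted local search\<close>

context cubic_nbhd begin

text \<open>One weight sum with a table of eight numbers as parameter, so that a single search
  program serves both objectives.\<close>

definition potential :: "(nat \<Rightarrow> nat) \<Rightarrow> 'a set \<Rightarrow> nat" where
  "potential w D = (\<Sum>u\<in>V. w ((if u \<in> D then 4 else 0) + card (N u \<inter> D)))"

definition minimal_near :: "(nat \<Rightarrow> nat) \<Rightarrow> 'a set \<Rightarrow> bool" where
  "minimal_near w D \<longleftrightarrow> D \<subseteq> V \<and>
     (\<forall>X\<subseteq>V. card X \<le> 13 \<longrightarrow> potential w D \<le> potential w (D - X \<union> (X - D)))"

text \<open>Index \<open>4 + k\<close> is the weight of a vertex in \<open>D\<close> with \<open>k\<close> neighbours in \<open>D\<close>, index \<open>k\<close> that of a vertex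
  outside. With \<open>m\<close> vertices, \<open>m + 1\<close> outweighs the third component of the objective and
  \<open>4 m\<^sup>2 + 4 m + 1 > 3 m (m + 1) + m\<close> the last two together.\<close>

definition table_dom :: "(nat \<Rightarrow> nat) \<Rightarrow> bool" where
  "table_dom w \<longleftrightarrow> (let m = card V; b = 4 * (m * m) + 4 * m + 1 in
     w 0 = b + b \<and> w 1 = 1 \<and> w 2 = 0 \<and> w 3 = 0 \<and>
     w 4 = b \<and> w 5 = b + (m + 1) \<and> w 6 = b + 2 * (m + 1) \<and> w 7 = b + 3 * (m + 1))"

text \<open>An outside vertex with fewer than two neighbours in \<open>D\<close> costs 2 and a
  vertex of \<open>D\<close> costs 1, so inserting an offending vertex always pays. The complement
  of a valid \<open>D\<close> induces maximum degree at most 1: a dissociation set.\<close>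

definition table_diss :: "(nat \<Rightarrow> nat) \<Rightarrow> bool" where
  "table_diss w \<longleftrightarrow> w 0 = 2 \<and> w 1 = 2 \<and> w 2 = 0 \<and> w 3 = 0 \<and> w 4 = 1 \<and> w 5 = 1 \<and> w 6 = 1 \<and> w 7 = 1"

lemma card_N_Int: "card (N u \<inter> D) \<le> 3"
proof (cases "u \<in> V")
  case True
  then show ?thesis using card_mono[of "N u" "N u \<inter> D"] card_N[of u] by simp
next
  case False
  then have "N u = {}" using N_V(2) by blast
  then show ?thesis by simp
qed

lemma card_N_Diff: "u \<in> V \<Longrightarrow> card (N u - D) = 3 - card (N u \<inter> D)"
  using card_N[of u] by (metis Diff_Int2 Int_absorb card_Diff_subset_Int finite_Int finite_N inf_commute)

text \<open>Inserting \<open>z\<close> changes counts only at its neighbours. Outside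
  \<open>D\<close> the weights do not increase with the count; neighbours in \<open>D\<close> are
  left to the last hypothesis.\<close>

lemma potential_insert_less:
  assumes "z \<in> V" "z \<notin> D" "w (4 + card (N z \<inter> D)) < w (card (N z \<inter> D))"
    and "w 1 \<le> w 0" "w 2 \<le> w 1" "w 3 \<le> w 2"
    and "\<And>u. u \<in> D \<Longrightarrow> u \<in> N z \<Longrightarrow> w (4 + card (N u \<inter> insert z D)) \<le> w (4 + card (N u \<inter> D))"
  shows "potential w (insert z D) < potential w D"
proof -
  let ?f = "\<lambda>D u. w ((if u \<in> D then 4 else 0) + card (N u \<inter> D))"
  have Nz: "N z \<inter> insert z D = N z \<inter> D" using N_irrefl by blast
  have le: "?f (insert z D) u \<le> ?f D u" if "u \<in> V - {z}" for u
  proof (cases "u \<in> N z")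
    case False
    then have "N u \<inter> insert z D = N u \<inter> D" using N_sym by blast
    then show ?thesis using that by simp
  next
    case True
    show ?thesis
    proof (cases "u \<in> D")
      case True
      then show ?thesis using assms(7)[OF True \<open>u \<in> N z\<close>] by simp
    next
      case F: False
      have "N u \<inter> insert z D = insert z (N u \<inter> D)" using N_sym[OF True] by blast
      then have c: "card (N u \<inter> insert z D) = Suc (card (N u \<inter> D))" using assms(2) by simp
      then have "card (N u \<inter> D) \<le> 2" using card_N_Int[of u "insert z D"] by simp
      then consider "card (N u \<inter> D) = 0" | "card (N u \<inter> D) = 1" | "card (N u \<inter> D) = 2" by linarith
      then have "w (Suc (card (N u \<inter> D))) \<le> w (card (N u \<inter> D))"
        using assms(4-6) by cases (simp_all add: numeral_2_eq_2 numeral_3_eq_3)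
      then show ?thesis using F that c by simp
    qed
  qed
  have "potential w (insert z D) = ?f (insert z D) z + (\<Sum>u\<in>V - {z}. ?f (insert z D) u)"
    unfolding potential_def by (rule sum.remove) (use finite_V assms in auto)
  also have "\<dots> < ?f D z + (\<Sum>u\<in>V - {z}. ?f D u)"
    using assms(2,3) Nz by (intro add_less_le_mono sum_mono le) auto
  also have "\<dots> = potential w D"
    unfolding potential_def by (rule sum.remove[symmetric]) (use finite_V assms in auto)
  finally show ?thesis .
qed

lemma minimal_near_insert:
  assumes "minimal_near w D" "z \<in> V" "z \<notin> D"
  shows "potential w D \<le> potential w (insert z D)"
proof -
  have "potential w D \<le> potential w (D - {z} \<union> ({z} - D))"
    using assms unfolding minimal_near_def by auto
  moreover have "D - {z} \<union> ({z} - D) = insert z D" using assms(3) by blast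
  ultimately show ?thesis by simp
qed

lemma minimal_near_exchange:
  assumes "minimal_near w D" "R \<subseteq> D" "A \<subseteq> V - D" "card R + card A \<le> 13"
  shows "potential w D \<le> potential w (D - R \<union> A)"
proof -
  have "R \<union> A \<subseteq> V" "card (R \<union> A) \<le> 13"
    using assms card_Un_le[of R A] unfolding minimal_near_def by auto
  then have "potential w D \<le> potential w (D - (R \<union> A) \<union> ((R \<union> A) - D))"
    using assms(1) unfolding minimal_near_def by blast
  moreover have "D - (R \<union> A) \<union> ((R \<union> A) - D) = D - R \<union> A" using assms(2,3) by blast
  ultimately show ?thesis by simp
qed

text \<open>An undominated vertex weighs \<open>2 b\<close> and only \<open>b\<close> once inserted;
  it has no neighbour in \<open>D\<close> whose weight could rise.\<close>

lemma minimal_near_dominating: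
  assumes "table_dom w" "minimal_near w D"
  shows "dominating D"
  unfolding dominating_def
proof (intro conjI ballI notI)
  show "D \<subseteq> V" using assms(2) by (simp add: minimal_near_def)
  fix z assume z: "z \<in> V - D" "N z \<inter> D = {}"
  have "potential w (insert z D) < potential w D"
    by (rule potential_insert_less) (use z assms(1) N_sym in \<open>auto simp: table_dom_def Let_def\<close>)
  then show False using minimal_near_insert[OF assms(2), of z] z by simp
qed

lemma inner_le: "D \<subseteq> V \<Longrightarrow> inner D \<le> 3 * card V"
proof -
  assume D: "D \<subseteq> V"
  have "inner D \<le> (\<Sum>u\<in>D. 3)" unfolding inner_def by (intro sum_mono card_N_Int)
  then show ?thesis using card_mono[OF finite_V D] by simp
qed

lemma once_le: "card (once D) \<le> card V"
  unfolding once_def by (intro card_mono finite_V) auto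

lemma potential_dominating:
  assumes "table_dom w" "dominating D"
  defines "m \<equiv> card V"
  shows "potential w D = card D * (4 * (m * m) + 4 * m + 1) + inner D * (m + 1) + card (once D)"
proof -
  let ?b = "4 * (m * m) + 4 * m + 1"
  have D: "D \<subseteq> V" using assms(2) by (simp add: dominating_def)
  have w: "w (4 + k) = ?b + k * (m + 1)" if k: "k \<le> 3" for k
  proof -
    consider "k = 0" | "k = 1" | "k = 2" | "k = 3" using k by linarith
    then show ?thesis using assms(1) unfolding table_dom_def Let_def m_def by cases simp_all
  qed
  have w': "w k = (if k = 1 then 1 else 0)" if k: "k \<le> 3" "k \<noteq> 0" for k
  proof -
    consider "k = 1" | "k = 2" | "k = 3" using k by linarith
    then show ?thesis using assms(1) unfolding table_dom_def Let_def m_def by cases simp_all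
  qed
  have "potential w D = (\<Sum>u\<in>V - D. w ((if u \<in> D then 4 else 0) + card (N u \<inter> D)))
      + (\<Sum>u\<in>D. w ((if u \<in> D then 4 else 0) + card (N u \<inter> D)))"
    unfolding potential_def by (rule sum.subset_diff[OF D finite_V])
  also have "(\<Sum>u\<in>D. w ((if u \<in> D then 4 else 0) + card (N u \<inter> D))) = (\<Sum>u\<in>D. ?b + card (N u \<inter> D) * (m + 1))"
    by (intro sum.cong refl) (simp add: w card_N_Int)
  also have "\<dots> = card D * ?b + inner D * (m + 1)"
    by (subst sum.distrib) (simp only: sum_constant of_nat_id inner_def sum_distrib_right)
  also have "(\<Sum>u\<in>V - D. w ((if u \<in> D then 4 else 0) + card (N u \<inter> D)))
      = (\<Sum>u\<in>V - D. if card (N u \<inter> D) = 1 then 1 else 0)"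
  proof (intro sum.cong refl)
    fix u assume u: "u \<in> V - D"
    then have "card (N u \<inter> D) \<noteq> 0" using assms(2) by (simp add: dominating_def)
    then show "w ((if u \<in> D then 4 else 0) + card (N u \<inter> D)) = (if card (N u \<inter> D) = 1 then 1 else 0)"
      using w'[OF card_N_Int] u by simp
  qed
  also have "\<dots> = card (once D)"
    using finite_V by (simp add: once_def sum.inter_filter[symmetric])
  finally show ?thesis by simp
qed

text \<open>Positional notation: the bounds on the lower digits of the right-hand side exclude a
  carry.\<close>

lemma lexicographic_less:
  fixes a a' b b' c c' m :: nat
  assumes "a * (4 * (m * m) + 4 * m + 1) + b * (m + 1) + c \<le> a' * (4 * (m * m) + 4 * m + 1) + b' * (m + 1) + c'"
    and "b' \<le> 3 * m" "c' \<le> m"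
  shows "a \<le> a'" "a = a' \<Longrightarrow> b \<le> b'" "a = a' \<Longrightarrow> b = b' \<Longrightarrow> c \<le> c'"
proof -
  let ?W = "4 * (m * m) + 4 * m + 1"
  show "a \<le> a'"
  proof (rule ccontr)
    assume "\<not> a \<le> a'"
    then have "(a' + 1) * ?W \<le> a * ?W" by (intro mult_le_mono) auto
    moreover have "b' * (m + 1) \<le> 3 * m * (m + 1)" using assms(2) by (intro mult_le_mono) auto
    ultimately show False using assms(1,3) by (simp add: algebra_simps)
  qed
  show "b \<le> b'" if "a = a'"
  proof (rule ccontr)
    assume "\<not> b \<le> b'"
    then have "(b' + 1) * (m + 1) \<le> b * (m + 1)" by (intro mult_le_mono) auto
    then show False using assms(1,3) that by (simp add: algebra_simps)
  qed
  show "c \<le> c'" if "a = a'" "b = b'" using assms(1) that by simp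
qed

theorem minimal_near_dom_bound:
  assumes "table_dom w" "minimal_near w D"
  shows "38 * card D \<le> 15 * card V" "dominating D"
proof -
  show dom: "dominating D" by (rule minimal_near_dominating[OF assms])
  have DV: "D \<subseteq> V" using dom by (simp add: dominating_def)
  note pot = potential_dominating[OF assms(1)]
  have lex: "potential w D \<le> potential w (D - R \<union> A)" "card (D - R \<union> A) + card R = card D + card A"
    "inner (D - R \<union> A) \<le> 3 * card V" "card (once (D - R \<union> A)) \<le> card V"
    if "R \<subseteq> D" "A \<subseteq> V - D" "card R + card A \<le> 13" for R A
  proof -
    have f: "finite D" "finite A" "finite R" using finite_V that DV by (auto intro: finite_subset)
    have "card (D - R \<union> A) = card (D - R) + card A"
      by (rule card_Un_disjoint) (use f that in auto)
    moreover have "card (D - R) + card R = card D" using card_Diff_subset[OF f(3) that(1)] card_mono[OF f(1) that(1)] by simp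
    ultimately show "card (D - R \<union> A) + card R = card D + card A" by simp
    show "potential w D \<le> potential w (D - R \<union> A)" by (rule minimal_near_exchange[OF assms(2) that])
    show "inner (D - R \<union> A) \<le> 3 * card V" by (rule inner_le) (use that DV in blast)
    show "card (once (D - R \<union> A)) \<le> card V" by (rule once_le)
  qed
  interpret local_opt V N D
  proof
    fix R A assume *: "R \<subseteq> D" "A \<subseteq> V - D" "card R + card A \<le> 13" "dominating (D - R \<union> A)"
    note L = lexicographic_less[OF lex(1)[OF *(1-3), unfolded pot[OF dom] pot[OF *(4)]] lex(3,4)[OF *(1-3)]]
    show "card R \<le> card A" using L(1) lex(2)[OF *(1-3)] by linarith
    show "inner D \<le> inner (D - R \<union> A)" if "card R = card A"
      using L(2) lex(2)[OF *(1-3)] that by linarith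
    show "card (once D) \<le> card (once (D - R \<union> A))" if "card R = card A" "inner (D - R \<union> A) = inner D"
      using L(3) lex(2)[OF *(1-3)] that by linarith
  qed (rule dom)
  show "38 * card D \<le> 15 * card V" by (rule local_opt_bound)
qed

section \<open>Sets containing two neighbours of every other vertex\<close>

lemma sum_card_N_swap:
  assumes "A \<subseteq> D" "D \<subseteq> V"
  shows "(\<Sum>s\<in>A. card (N s - D)) = (\<Sum>w\<in>V - D. card (N w \<inter> A))"
proof -
  have fin: "finite A" "finite (V - D)" using assms finite_V by (auto intro: finite_subset)
  have "(\<Sum>s\<in>A. card (N s - D)) = (\<Sum>s\<in>A. \<Sum>w | w \<in> V - D \<and> w \<in> N s. 1)"
  proof (intro sum.cong refl)
    fix s
    have "N s - D = {w. w \<in> V - D \<and> w \<in> N s}" using N_V by blast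
    then show "card (N s - D) = (\<Sum>w | w \<in> V - D \<and> w \<in> N s. 1)" by simp
  qed
  also have "\<dots> = (\<Sum>w\<in>V - D. \<Sum>s | s \<in> A \<and> w \<in> N s. 1)"
    by (rule sum.swap_restrict[OF fin])
  also have "\<dots> = (\<Sum>w\<in>V - D. card (N w \<inter> A))"
  proof (intro sum.cong refl)
    fix w
    have "N w \<inter> A = {s. s \<in> A \<and> w \<in> N s}" using N_sym by blast
    then show "(\<Sum>s | s \<in> A \<and> w \<in> N s. 1) = card (N w \<inter> A)" by simp
  qed
  finally show ?thesis .
qed

lemma potential_dissociation:
  assumes "table_diss w" "D \<subseteq> V" "\<And>u. u \<in> V - D \<Longrightarrow> card (N u \<inter> D) \<ge> 2"
  shows "potential w D = card D"
proof -
  have "w ((if u \<in> D then 4 else 0) + card (N u \<inter> D)) = (if u \<in> D then 1 else 0)" if "u \<in> V" for u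
  proof (cases "u \<in> D")
    case True
    consider "card (N u \<inter> D) = 0" | "card (N u \<inter> D) = 1" | "card (N u \<inter> D) = 2" | "card (N u \<inter> D) = 3"
      using card_N_Int[of u D] by linarith
    then show ?thesis using True assms(1) unfolding table_diss_def by cases simp_all
  next
    case False
    then have "card (N u \<inter> D) \<ge> 2" using assms(3) that by blast
    then consider "card (N u \<inter> D) = 2" | "card (N u \<inter> D) = 3" using card_N_Int[of u D] by linarith
    then show ?thesis using False assms(1) unfolding table_diss_def by cases (simp_all add: eval_nat_numeral)
  qed
  then have "potential w D = (\<Sum>u\<in>V. if u \<in> D then 1 else 0)" unfolding potential_def by (intro sum.cong) auto
  also have "\<dots> = card {u \<in> V. u \<in> D}" using finite_V by (simp add: sum.inter_filter[symmetric])
  also have "{u \<in> V. u \<in> D} = D" using assms(2) by blast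
  finally show ?thesis .
qed

text \<open>Count the edges leaving \<open>D\<close>, those at vertices with a single outside
  neighbour (the set \<open>T\<close>) twice. Every vertex of \<open>D\<close> then contributes at
  least 2, and exchanges show that every outside vertex receives at most 3, so
  \<open>2 |D| \<le> 3 |V - D|\<close>.\<close>

theorem minimal_near_diss_bound:
  assumes "table_diss w" "minimal_near w D"
  shows "\<And>u. u \<in> V - D \<Longrightarrow> card (N u \<inter> D) \<ge> 2" "5 * card D \<le> 3 * card V"
proof -
  have DV: "D \<subseteq> V" using assms(2) by (simp add: minimal_near_def)
  then have fD: "finite D" using finite_V by (rule finite_subset)
  show valid: "card (N u \<inter> D) \<ge> 2" if u: "u \<in> V - D" for u
  proof (rule ccontr)
    assume "\<not> ?thesis"
    then have "card (N u \<inter> D) = 0 \<or> card (N u \<inter> D) = 1" by linarith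
    then have w: "w (4 + card (N u \<inter> D)) < w (card (N u \<inter> D))" using assms(1) by (auto simp: table_diss_def)
    have eq: "w (4 + card (N v \<inter> E)) = 1" for v E
    proof -
      consider "card (N v \<inter> E) = 0" | "card (N v \<inter> E) = 1" | "card (N v \<inter> E) = 2" | "card (N v \<inter> E) = 3"
        using card_N_Int[of v E] by linarith
      then show ?thesis using assms(1) unfolding table_diss_def by cases simp_all
    qed
    have "potential w (insert u D) < potential w D"
      by (rule potential_insert_less) (use u w eq assms(1) in \<open>auto simp: table_diss_def\<close>)
    then show False using minimal_near_insert[OF assms(2), of u] u by simp
  qed
  have opt: "card R \<le> card A"
    if *: "R \<subseteq> D" "A \<subseteq> V - D" "card R + card A \<le> 13" "\<And>u. u \<in> V - (D - R \<union> A) \<Longrightarrow> card (N u \<inter> (D - R \<union> A)) \<ge> 2"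
    for R A
  proof -
    have f: "finite A" "finite R" using *(1,2) finite_V fD by (auto intro: finite_subset)
    have sub: "D - R \<union> A \<subseteq> V" using * DV by blast
    have "card D \<le> card (D - R \<union> A)"
      using minimal_near_exchange[OF assms(2) *(1-3)] potential_dissociation[OF assms(1) DV valid]
        potential_dissociation[OF assms(1) sub *(4)] by simp
    also have "card (D - R \<union> A) = card (D - R) + card A"
      by (rule card_Un_disjoint) (use f fD * in auto)
    finally show ?thesis using card_Diff_subset[OF f(2) *(1)] card_mono[OF fD *(1)] by simp
  qed
  have pos: "card (N s - D) \<ge> 1" if s: "s \<in> D" for s
  proof (rule ccontr)
    assume "\<not> ?thesis"
    then have Ns: "N s \<subseteq> D" by (simp add: not_le)
    have "card {s} \<le> card ({} :: 'a set)"
    proof (rule opt)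
      fix u assume u: "u \<in> V - (D - {s} \<union> {})"
      show "2 \<le> card (N u \<inter> (D - {s} \<union> {}))"
      proof (cases "u = s")
        case True
        have "N s \<inter> (D - {s} \<union> {}) = N s" using Ns N_irrefl by blast
        then show ?thesis using True card_N[of s] s DV by auto
      next
        case False
        then have "N u \<inter> (D - {s} \<union> {}) = N u \<inter> D" using u Ns N_sym by blast
        then show ?thesis using valid[of u] u False by auto
      qed
    qed (use s in auto)
    then show False by simp
  qed
  define T where "T = {s \<in> D. card (N s - D) = 1}"
  have TD: "T \<subseteq> D" by (auto simp: T_def)
  have T1: "N s - D = {w}" if "s \<in> T" "w \<in> N s" "w \<notin> D" for s w
  proof -
    have "card (N s - D) = 1" using that by (simp add: T_def)
    then obtain x where x: "N s - D = {x}" by (auto simp: card_1_singleton_iff)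
    have "w \<in> N s - D" using that by simp
    then show ?thesis unfolding x by simp
  qed
  \<comment> \<open>Deleting \<open>s\<close> leaves \<open>s\<close> and \<open>w\<close> two
    neighbours in \<open>D\<close> each and affects no other outside vertex.\<close>
  have noT: "s \<notin> T" if w: "w \<in> V - D" "N w \<subseteq> D" "s \<in> N w" for w s
  proof
    assume sT: "s \<in> T"
    have ws: "w \<in> N s" using N_sym[OF w(3)] .
    have Ns: "N s - D = {w}" using T1[OF sT ws] w(1) by blast
    have sD: "s \<in> D" "s \<in> V" using sT TD DV by auto
    have "card {s} \<le> card ({} :: 'a set)"
    proof (rule opt)
      fix u assume u: "u \<in> V - (D - {s} \<union> {})"
      consider "u = s" | "u = w" | "u \<noteq> s" "u \<noteq> w" by blast
      then show "2 \<le> card (N u \<inter> (D - {s} \<union> {}))"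
      proof cases
        case 1
        have "N s \<inter> (D - {s} \<union> {}) = N s - {w}" using Ns N_irrefl by blast
        then show ?thesis using 1 card_N[OF sD(2)] ws by simp
      next
        case 2
        have "N w \<inter> (D - {s} \<union> {}) = N w - {s}" using w(2) by blast
        then show ?thesis using 2 card_N[of w] w by simp
      next
        case 3
        then have "s \<notin> N u" using Ns u N_sym by blast
        then have "N u \<inter> (D - {s} \<union> {}) = N u \<inter> D" by blast
        then show ?thesis using valid[of u] u 3 by auto
      qed
    qed (use sD in auto)
    then show False by simp
  qed
  \<comment> \<open>Otherwise \<open>w\<close> replaces \<open>s1\<close> and \<open>s2\<close>:
    each of them keeps two neighbours in the new set, even if they are adjacent to each
    other.\<close>
  have unique: "s1 = s2" if w: "w \<in> V - D" "s1 \<in> N w" "s2 \<in> N w" "s1 \<in> T" "s2 \<in> T" for w s1 s2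
  proof (rule ccontr)
    assume ne: "s1 \<noteq> s2"
    have ws: "w \<in> N s1" "w \<in> N s2" using N_sym w by blast+
    have Ns: "N s1 - D = {w}" "N s2 - D = {w}" using T1 ws w by blast+
    have sD: "s1 \<in> D" "s2 \<in> D" using w TD by auto
    have "card {s1, s2} \<le> card {w}"
    proof (rule opt)
      fix u assume u: "u \<in> V - (D - {s1, s2} \<union> {w})"
      have two: "2 \<le> card (N s \<inter> (D - {s1, s2} \<union> {w}))" if "s \<in> D" "N s - D = {w}" "s = s1 \<and> t = s2 \<or> s = s2 \<and> t = s1" for s t
      proof -
        have "N s - {t} \<subseteq> N s \<inter> (D - {s1, s2} \<union> {w})" using that N_irrefl[of s] by auto
        then have "card (N s - {t}) \<le> card (N s \<inter> (D - {s1, s2} \<union> {w}))" by (intro card_mono) auto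
        moreover have "card (N s - {t}) \<ge> 2" using card_N[of s] that(1) DV by (auto simp: card_Diff_singleton_if)
        ultimately show ?thesis by linarith
      qed
      consider "u = s1" | "u = s2" | "u \<noteq> s1" "u \<noteq> s2" by blast
      then show "2 \<le> card (N u \<inter> (D - {s1, s2} \<union> {w}))"
      proof cases
        case 1 then show ?thesis using two[of s1 s2] sD Ns by blast
      next
        case 2 then show ?thesis using two[of s2 s1] sD Ns by blast
      next
        case 3
        then have uD: "u \<notin> D" "u \<noteq> w" "u \<in> V" using u by auto
        then have "s1 \<notin> N u" "s2 \<notin> N u" using Ns N_sym by blast+
        then have "N u \<inter> D \<subseteq> N u \<inter> (D - {s1, s2} \<union> {w})" by blast
        then have "card (N u \<inter> D) \<le> card (N u \<inter> (D - {s1, s2} \<union> {w}))" by (intro card_mono) auto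
        then show ?thesis using valid[of u] uD by auto
      qed
    qed (use sD w ne in \<open>auto simp: card_insert_if\<close>)
    then show False using ne by simp
  qed
  \<comment> \<open>Three dominators exclude \<open>T\<close> altogether; two or fewer leave room
    for one vertex of \<open>T\<close>.\<close>
  have each: "card (N w \<inter> D) + card (N w \<inter> T) \<le> 3" if w: "w \<in> V - D" for w
  proof (cases "N w \<subseteq> D")
    case True
    then have "N w \<inter> T = {}" using noT w by blast
    then show ?thesis using card_N_Int[of w D] by simp
  next
    case False
    then obtain y where "y \<in> N w" "y \<notin> D" by blast
    then have "card (N w \<inter> D) \<le> card (N w - {y})" by (intro card_mono) auto
    then have "card (N w \<inter> D) \<le> 2" using \<open>y \<in> N w\<close> card_N[of w] w by simp
    moreover have "card (N w \<inter> T) \<le> 1"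
      using unique[OF w] by (simp add: card_le_Suc0_iff_eq)
    ultimately show ?thesis by linarith
  qed
  have "(\<Sum>s\<in>D. 2) \<le> (\<Sum>s\<in>D. card (N s - D) + (if s \<in> T then 1 else 0))"
    by (intro sum_mono) (use pos in \<open>fastforce simp: T_def\<close>)
  also have "\<dots> = (\<Sum>s\<in>D. card (N s - D)) + (\<Sum>s\<in>D. if s \<in> T then 1 else 0)" by (rule sum.distrib)
  also have "(\<Sum>s\<in>D. if s \<in> T then 1 else 0) = card T"
    using fD by (simp add: sum.inter_filter[symmetric] T_def)
  also have "card T = (\<Sum>s\<in>T. card (N s - D))" by (simp add: T_def)
  also have "(\<Sum>s\<in>D. card (N s - D)) + (\<Sum>s\<in>T. card (N s - D)) = (\<Sum>w\<in>V - D. card (N w \<inter> D) + card (N w \<inter> T))"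
    using sum_card_N_swap[OF order_refl DV] sum_card_N_swap[OF TD DV] by (simp add: sum.distrib)
  also have "\<dots> \<le> (\<Sum>w\<in>V - D. 3)" by (intro sum_mono each)
  finally have "2 * card D \<le> 3 * card (V - D)" by simp
  then show "5 * card D \<le> 3 * card V" using card_Diff_subset[OF fD DV] card_mono[OF finite_V DV] by simp
qed

section \<open>Feasible deletion sets: lower bounds and repair\<close>

definition good :: "'a \<Rightarrow> 'a set \<Rightarrow> bool" where
  "good p S \<longleftrightarrow> p \<notin> S \<and> (\<forall>v\<in>V. v \<notin> S \<longrightarrow> v \<noteq> p \<longrightarrow> card (N p \<inter> S) < card (N v \<inter> S))"

text \<open>Deleting \<open>S\<close> lowers the degree of \<open>v\<close> to
  \<open>3 - card (N v \<inter> S)\<close>, so every survivor other than \<open>p\<close> has more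
  neighbours in \<open>S\<close> than \<open>p\<close>. With at least \<open>k\<close> each,
  counting edges between \<open>S\<close> and the survivors gives
  \<open>k (n - 1 - |S|) \<le> 3 |S|\<close>; take \<open>k = 1\<close> and
  \<open>k = 2\<close>.\<close>

lemma good_card_ge:
  assumes "good p S" "S \<subseteq> V" "p \<in> V"
  shows "card V - 1 \<le> 4 * card S" "N p \<inter> S \<noteq> {} \<Longrightarrow> 2 * (card V - 1) \<le> 5 * card S"
proof -
  have fS: "finite S" using assms finite_V by (auto intro: finite_subset)
  have pS: "p \<in> V - S" using assms by (simp add: good_def)
  have c: "card (V - S - {p}) + card S = card V - 1"
    using pS card_Diff_subset[OF fS assms(2)] card_mono[OF finite_V assms(2)] card_Diff_singleton[OF pS]
      card_gt_0_iff[of "V - S"] finite_V by auto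
  have up: "k * card (V - S - {p}) \<le> 3 * card S" if "\<And>v. v \<in> V - S - {p} \<Longrightarrow> k \<le> card (N v \<inter> S)" for k
  proof -
    have "k * card (V - S - {p}) = (\<Sum>v\<in>V - S - {p}. k)" by simp
    also have "\<dots> \<le> (\<Sum>v\<in>V - S - {p}. card (N v \<inter> S))" by (rule sum_mono[OF that])
    also have "\<dots> \<le> (\<Sum>v\<in>V - S. card (N v \<inter> S))" using finite_V by (intro sum_mono2) auto
    also have "\<dots> = (\<Sum>s\<in>S. card (N s - S))" by (rule sum_card_N_swap[OF order_refl assms(2), symmetric])
    also have "\<dots> \<le> (\<Sum>s\<in>S. 3)"
    proof (rule sum_mono)
      fix s assume "s \<in> S"
      then have "s \<in> V" using assms(2) by blast
      then show "card (N s - S) \<le> 3" by (simp add: card_N_Diff)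
    qed
    finally show ?thesis by simp
  qed
  have "1 * card (V - S - {p}) \<le> 3 * card S" using assms(1) by (intro up) (auto simp: good_def)
  then show "card V - 1 \<le> 4 * card S" using c by linarith
  assume "N p \<inter> S \<noteq> {}"
  then have "card (N p \<inter> S) > 0" by (simp add: card_gt_0_iff)
  then have "2 * card (V - S - {p}) \<le> 3 * card S" using assms(1) by (intro up) (fastforce simp: good_def)
  then show "2 * (card V - 1) \<le> 5 * card S" using c by linarith
qed

text \<open>If \<open>p\<close> loses two neighbours and another vertex survives, survivors other
  than \<open>p\<close> must lose all three of theirs. The third neighbour of \<open>p\<close>
  cannot, since \<open>p\<close> survives.\<close>

lemma good_cases:
  assumes "good p S" "S \<subseteq> V" "p \<in> V"
  shows "card (N p \<inter> S) = 0 \<or> card (N p \<inter> S) = 1 \<or> S = V - {p}"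
proof (rule ccontr)
  assume n: "\<not> ?thesis"
  have pS: "p \<notin> S" using assms(1) by (simp add: good_def)
  obtain v where v: "v \<in> V" "v \<notin> S" "v \<noteq> p" using n assms(2) pS by blast
  have "card (N p \<inter> S) < card (N v \<inter> S)" using assms(1) v by (simp add: good_def)
  then have "card (N p \<inter> S) = 2" using n card_N_Int[of v S] by linarith
  then have "card (N p - S) = 1" using card_N_Diff[OF assms(3)] by simp
  then obtain b where b: "N p - S = {b}" by (auto simp: card_1_singleton_iff)
  then have bN: "b \<in> N p" "b \<notin> S" by auto
  then have "b \<in> V" "b \<noteq> p" "p \<in> N b" using N_V N_irrefl N_sym by blast+
  then have "2 < card (N b \<inter> S)" using assms(1) bN \<open>card (N p \<inter> S) = 2\<close> by (auto simp: good_def)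
  moreover have "card (N b \<inter> S) \<le> card (N b - {p})" using pS by (intro card_mono) auto
  ultimately show False using card_N[OF \<open>b \<in> V\<close>] \<open>p \<in> N b\<close> by simp
qed

text \<open>Remove the closed neighbourhood \<open>C\<close> of \<open>p\<close> from
  \<open>D\<close> and cover the set \<open>U\<close> left undominated: a vertex outside
  \<open>C\<close> by itself, a neighbour of \<open>p\<close> by one of its neighbours in
  \<open>S0\<close>, which lies outside \<open>C\<close>. Besides 3 neighbours of \<open>p\<close>,
  at most the 6 vertices behind them are affected, so \<open>4 + 9\<close> vertices change.\<close>

lemma repair_dominating:
  assumes "dominating D" "good p S0" "p \<in> V" "S0 \<subseteq> V" "N p \<inter> S0 = {}"
  obtains X where "X \<subseteq> V" "card X \<le> 13" "good p (D - X \<union> (X - D))"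
proof -
  define C where "C = insert p (N p)"
  define U where "U = {z \<in> V - {p}. z \<notin> D - C \<and> N z \<inter> (D - C) = {}}"
  define g where "g z = (if z \<in> C then SOME y. y \<in> N z \<inter> S0 else z)" for z
  have pS: "p \<notin> S0" using assms(2) by (simp add: good_def)
  have g1: "g z \<in> N z \<inter> S0" if "z \<in> U" "z \<in> C" for z
  proof -
    have "z \<in> N p" using that by (auto simp: U_def C_def)
    then have "z \<in> V" "z \<notin> S0" "z \<noteq> p" using assms(5) N_V N_irrefl by blast+
    then have "card (N z \<inter> S0) > 0" using assms(2) by (auto simp: good_def)
    then have "\<exists>y. y \<in> N z \<inter> S0" by (auto simp: card_gt_0_iff)
    then have "(SOME y. y \<in> N z \<inter> S0) \<in> N z \<inter> S0" by (rule someI_ex)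
    then show ?thesis using that(2) by (simp add: g_def)
  qed
  have gC: "g z \<notin> C" "g z \<in> V" if "z \<in> U" for z
    using g1[OF that] assms(4,5) pS that by (auto simp: C_def g_def U_def split: if_splits)
  have U_sub: "U \<subseteq> N p \<union> (\<Union>a\<in>N p. N a - {p})"
  proof
    fix z assume z: "z \<in> U"
    then have zV: "z \<in> V" "z \<noteq> p" "z \<notin> D - C" "N z \<inter> (D - C) = {}" by (auto simp: U_def)
    show "z \<in> N p \<union> (\<Union>a\<in>N p. N a - {p})"
    proof (cases "z \<in> N p")
      case False
      then have "z \<notin> D" using zV by (auto simp: C_def)
      then obtain c where c: "c \<in> N z" "c \<in> D" using assms(1) zV(1) unfolding dominating_def by blast
      then have "c \<in> C" using zV by blast
      moreover have "c \<noteq> p" using c(1) False N_sym by blast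
      ultimately show ?thesis using c N_sym zV by (auto simp: C_def)
    qed simp
  qed
  have "card (\<Union>a\<in>N p. N a - {p}) \<le> (\<Sum>a\<in>N p. card (N a - {p}))" by (rule card_UN_le) simp
  also have "\<dots> = (\<Sum>a\<in>N p. 2)"
    by (intro sum.cong refl) (use card_N N_V N_sym in auto)
  finally have "card (\<Union>a\<in>N p. N a - {p}) \<le> 6" using card_N[OF assms(3)] by simp
  moreover have "card (N p \<union> (\<Union>a\<in>N p. N a - {p})) \<le> card (N p) + card (\<Union>a\<in>N p. N a - {p})"
    by (rule card_Un_le)
  moreover have "card U \<le> card (N p \<union> (\<Union>a\<in>N p. N a - {p}))"
    by (rule card_mono[OF _ U_sub]) auto
  ultimately have cU: "card U \<le> 9" using card_N[OF assms(3)] by linarith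
  define S where "S = (D - C) \<union> g ` U"
  define X where "X = (D - S) \<union> (S - D)"
  have fU: "finite U" using finite_V by (simp add: U_def)
  have DV: "D \<subseteq> V" using assms(1) by (simp add: dominating_def)
  have "X \<subseteq> C \<union> g ` U" by (auto simp: X_def S_def)
  then have "card X \<le> card (C \<union> g ` U)" using fU by (intro card_mono) (auto simp: C_def)
  also have "\<dots> \<le> card C + card (g ` U)" by (rule card_Un_le)
  also have "\<dots> \<le> 4 + 9"
    using card_image_le[OF fU, of g] cU card_N[OF assms(3)] N_irrefl[of p]
    by (intro add_mono) (auto simp: C_def)
  finally have cX: "card X \<le> 13" by simp
  have XV: "X \<subseteq> V" using gC DV by (auto simp: X_def S_def)
  have eq: "D - X \<union> (X - D) = S" by (auto simp: X_def)
  have SC: "S \<inter> C = {}" using gC by (auto simp: S_def)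
  have "good p S"
    unfolding good_def
  proof (intro conjI ballI impI)
    show "p \<notin> S" using SC by (auto simp: C_def)
    fix v assume v: "v \<in> V" "v \<notin> S" "v \<noteq> p"
    have "N p \<inter> S = {}" using SC by (auto simp: C_def)
    moreover have "N v \<inter> S \<noteq> {}"
    proof (cases "v \<in> U")
      case True
      have "v \<in> C"
      proof (rule ccontr)
        assume "v \<notin> C"
        then have "g v = v" by (simp add: g_def)
        then show False using True v(2) by (force simp: S_def)
      qed
      then show ?thesis using g1[OF True] True by (auto simp: S_def)
    next
      case False
      then show ?thesis using v by (auto simp: U_def S_def)
    qed
    ultimately show "card (N p \<inter> S) < card (N v \<inter> S)" by (simp add: card_gt_0_iff)
  qed
  then show thesis using that[OF XV cX] eq by simp
qed

text \<open>Keep \<open>p\<close> and its neighbours \<open>b\<close>, \<open>c\<close> outside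
  \<open>S0\<close>, and delete all other neighbours of these three. As \<open>b\<close> and
  \<open>c\<close> need two neighbours in \<open>S0\<close> and \<open>p\<close> is none, their
  other neighbours all lie in \<open>S0\<close>; so \<open>b\<close>, \<open>c\<close> are not
  adjacent and lose two neighbours each, while \<open>p\<close> loses only \<open>a\<close>. At most
  \<open>3 + 9\<close> vertices change.\<close>

lemma repair_dissociation:
  assumes "D \<subseteq> V" "\<And>u. u \<in> V - D \<Longrightarrow> card (N u \<inter> D) \<ge> 2" "good p S0" "p \<in> V" "card (N p \<inter> S0) = 1"
  obtains X where "X \<subseteq> V" "card X \<le> 13" "good p (D - X \<union> (X - D))"
proof -
  have pS: "p \<notin> S0" using assms(3) by (simp add: good_def)
  obtain a where a: "N p \<inter> S0 = {a}" using assms(5) by (auto simp: card_1_singleton_iff)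
  then have aN: "a \<in> N p" by blast
  obtain b c where bc: "N p = {a, b, c}" "a \<noteq> b" "a \<noteq> c" "b \<noteq> c" by (rule N_others[OF aN])
  have sub: "N e - {p} \<subseteq> S0" "p \<in> N e" "e \<in> V" "e \<notin> S0" if "e \<in> {b, c}" for e
  proof -
    show e: "e \<notin> S0" "p \<in> N e" "e \<in> V" using that a bc N_sym[of e p] N_V[of e p] by auto
    have "e \<noteq> p" using e N_irrefl by blast
    then have "2 \<le> card (N e \<inter> S0)" using assms(3,5) e by (fastforce simp: good_def)
    moreover have "card (N e - {p}) = 2" using card_N[OF e(3)] e(2) by simp
    moreover have "N e \<inter> S0 \<subseteq> N e - {p}" using pS by blast
    ultimately have "N e \<inter> S0 = N e - {p}" by (intro card_seteq) auto
    then show "N e - {p} \<subseteq> S0" by blast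
  qed
  define S where "S = (D \<union> (N p \<union> N b \<union> N c)) - {p, b, c}"
  define X where "X = (D - S) \<union> (S - D)"
  have "X \<subseteq> {p, b, c} \<union> (N p \<union> N b \<union> N c)" by (auto simp: X_def S_def)
  then have "card X \<le> card ({p, b, c} \<union> (N p \<union> N b \<union> N c))" by (intro card_mono) auto
  also have "\<dots> \<le> card {p, b, c} + (card (N p) + card (N b) + card (N c))"
    by (intro order_trans[OF card_Un_le] add_mono order_refl)
  also have "\<dots> \<le> 3 + (3 + 3 + 3)"
    using card_N[of b] card_N[of c] card_N[of p] sub(3) assms(4) by (intro add_mono) (auto simp: card_insert_if)
  finally have cX: "card X \<le> 13" by simp
  have XV: "X \<subseteq> V" using assms(1) N_sub by (auto simp: X_def S_def)
  have eq: "D - X \<union> (X - D) = S" by (auto simp: X_def)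
  have ap: "a \<noteq> p" using aN N_irrefl by blast
  have "good p S"
    unfolding good_def
  proof (intro conjI ballI impI)
    show "p \<notin> S" by (simp add: S_def)
    fix v assume v: "v \<in> V" "v \<notin> S" "v \<noteq> p"
    have "N p \<inter> S = {a}" using bc ap by (auto simp: S_def)
    moreover have "2 \<le> card (N v \<inter> S)"
    proof (cases "v \<in> {b, c}")
      case True
      have "N v - {p} \<subseteq> N v \<inter> S"
        using sub(1)[OF True] sub(4)[of b] sub(4)[of c] True by (auto simp: S_def)
      then have "card (N v - {p}) \<le> card (N v \<inter> S)" by (intro card_mono) auto
      then show ?thesis using card_N[OF v(1)] sub(2)[OF True] by simp
    next
      case False
      then have nv: "v \<notin> D" "v \<notin> N p" "v \<notin> N b" "v \<notin> N c" using v by (auto simp: S_def)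
      then have "N v \<inter> D \<subseteq> N v \<inter> S" using N_sym by (auto simp: S_def)
      then have "card (N v \<inter> D) \<le> card (N v \<inter> S)" by (intro card_mono) auto
      then show ?thesis using assms(2)[of v] nv v by auto
    qed
    ultimately show "card (N p \<inter> S) < card (N v \<inter> S)" by simp
  qed
  then show thesis using that[OF XV cX] eq by simp
qed

end

section \<open>Programs and their running time\<close>

text \<open>A Hoare triple for total correctness with a bound on the number of steps.\<close>

definition runs :: "com \<Rightarrow> store \<Rightarrow> nat \<Rightarrow> (store \<Rightarrow> bool) \<Rightarrow> bool" where
  "runs c s T Q \<longleftrightarrow> (\<exists>t s'. exec c s t s' \<and> t \<le> T \<and> Q s')"

lemma runs_mono:
  assumes "runs c s T Q" "T \<le> T'" "\<And>s'. Q s' \<Longrightarrow> Q' s'"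
  shows "runs c s T' Q'"
  using assms unfolding runs_def by (meson le_trans)

lemma runs_Skip: "Q s \<Longrightarrow> runs Skip s 1 Q"
  unfolding runs_def using exec.Skip by blast

lemma runs_Write:
  assumes "Q (s(x := (s x)(aval a s := aval b s)))"
  shows "runs (Write x a b) s (acost a + acost b + 1) Q"
  unfolding runs_def using assms exec.Write by blast

lemma runs_Seq:
  assumes "runs c1 s T1 P" "\<And>s'. P s' \<Longrightarrow> runs c2 s' T2 Q"
  shows "runs (Seq c1 c2) s (T1 + T2) Q"
  using assms unfolding runs_def by (meson exec.Seq add_mono)

lemma runs_Cond:
  assumes "bval b s \<Longrightarrow> runs c1 s T1 Q" "\<not> bval b s \<Longrightarrow> runs c2 s T2 Q"
  shows "runs (Cond b c1 c2) s (bcost b + max T1 T2 + 1) Q"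
proof (cases "bval b s")
  case True
  then obtain t s' where "exec c1 s t s'" "t \<le> T1" "Q s'" using assms(1) unfolding runs_def by blast
  then show ?thesis unfolding runs_def using exec.Cond_True[OF True] by fastforce
next
  case False
  then obtain t s' where "exec c2 s t s'" "t \<le> T2" "Q s'" using assms(2) unfolding runs_def by blast
  then show ?thesis unfolding runs_def using exec.Cond_False[OF False] by fastforce
qed

lemma runs_Loop:
  fixes f :: "store \<Rightarrow> nat"
  assumes body: "\<And>s. I s \<Longrightarrow> bval b s \<Longrightarrow> runs c s T (\<lambda>s'. I s' \<and> f s' < f s)"
    and "I s" "f s \<le> m"
  shows "runs (Loop b c) s ((m + 1) * (T + bcost b + 1)) (\<lambda>s'. I s' \<and> \<not> bval b s')"
  using assms(2,3)
proof (induction m arbitrary: s)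
  case 0
  have "\<not> bval b s" using body[OF 0(1)] 0(2) by (auto simp: runs_def)
  then show ?case unfolding runs_def using exec.Loop_False[of b s c] 0(1) by fastforce
next
  case (Suc m)
  show ?case
  proof (cases "bval b s")
    case False
    then show ?thesis unfolding runs_def using exec.Loop_False[of b s c] Suc.prems(1) by fastforce
  next
    case True
    obtain t1 s1 where 1: "exec c s t1 s1" "t1 \<le> T" "I s1" "f s1 < f s"
      using body[OF Suc.prems(1) True] unfolding runs_def by blast
    then obtain t2 s2 where 2: "exec (Loop b c) s1 t2 s2" "t2 \<le> (m + 1) * (T + bcost b + 1)" "I s2" "\<not> bval b s2"
      using Suc.IH[OF 1(3)] Suc.prems(2) unfolding runs_def by fastforce
    have "exec (Loop b c) s (bcost b + t1 + t2 + 1) s2" by (rule exec.Loop_True[OF True 1(1) 2(1)])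
    moreover have "bcost b + t1 + t2 + 1 \<le> (Suc m + 1) * (T + bcost b + 1)" using 1(2) 2(2) by simp
    ultimately show ?thesis unfolding runs_def using 2 by blast
  qed
qed

definition upd :: "string \<Rightarrow> nat \<Rightarrow> nat \<Rightarrow> store \<Rightarrow> store" where
  "upd v c k s = s(v := (s v)(c := k))"

text \<open>The counter may be any cell of an array, so that nested loops can keep a whole tuple in
  one array.\<close>

definition For :: "string \<Rightarrow> nat \<Rightarrow> aexp \<Rightarrow> com \<Rightarrow> com" where
  "For v c b body = Seq (Write v (Const c) (Const 0))
     (Loop (Less (Read v (Const c)) b) (Seq body (Write v (Const c) (Plus (Read v (Const c)) (Const 1)))))"

text \<open>\<open>I k\<close> speaks of the store whose counter already holds \<open>k\<close>; the
  body therefore has to establish \<open>I (Suc k)\<close> for the store after the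
  increment.\<close>

lemma runs_For:
  assumes body: "\<And>k s. k < m \<Longrightarrow> I k s \<Longrightarrow> s v c = k \<Longrightarrow> runs body s T (\<lambda>s'. s' v c = k \<and> I (Suc k) (upd v c (Suc k) s'))"
    and bnd: "\<And>k s. k \<le> m \<Longrightarrow> I k s \<Longrightarrow> aval b s = m"
    and init: "I 0 (upd v c 0 s)"
  shows "runs (For v c b body) s ((m + 1) * (T + acost b + 10) + 3) (\<lambda>s'. I m s')"
proof -
  let ?b = "Less (Read v (Const c)) b"
  let ?I = "\<lambda>s. s v c \<le> m \<and> I (s v c) s"
  have L: "runs (Loop ?b (Seq body (Write v (Const c) (Plus (Read v (Const c)) (Const 1))))) (upd v c 0 s)
    ((m + 1) * ((T + 6) + bcost ?b + 1)) (\<lambda>s'. ?I s' \<and> \<not> bval ?b s')"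
  proof (rule runs_Loop[where f = "\<lambda>s. m - s v c"])
    fix s assume s: "?I s" "bval ?b s"
    then have lt: "s v c < m" using bnd by auto
    \<comment> \<open>The fixed-point equation for \<open>s'\<close> just says that its counter has
      the new value.\<close>
    have "runs (Seq body (Write v (Const c) (Plus (Read v (Const c)) (Const 1)))) s (T + 6)
      (\<lambda>s'. s' = upd v c (Suc (s v c)) s' \<and> I (Suc (s v c)) s')"
    proof (rule runs_Seq)
      show "runs body s T (\<lambda>s'. s' v c = s v c \<and> I (Suc (s v c)) (upd v c (Suc (s v c)) s'))"
        using body[OF lt, of s] s by blast
    next
      fix s' assume s': "s' v c = s v c \<and> I (Suc (s v c)) (upd v c (Suc (s v c)) s')"
      show "runs (Write v (Const c) (Plus (Read v (Const c)) (Const 1))) s' 6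
        (\<lambda>s'. s' = upd v c (Suc (s v c)) s' \<and> I (Suc (s v c)) s')"
        by (rule runs_mono[OF runs_Write[where Q = "\<lambda>x. x = upd v c (Suc (s v c)) s'"]])
           (use s' in \<open>auto simp: upd_def\<close>)
    qed
    then show "runs (Seq body (Write v (Const c) (Plus (Read v (Const c)) (Const 1)))) s (T + 6)
      (\<lambda>s'. ?I s' \<and> m - s' v c < m - s v c)"
    proof (rule runs_mono[OF _ order_refl])
      fix s' assume a: "s' = upd v c (Suc (s v c)) s' \<and> I (Suc (s v c)) s'"
      then have "s' v c = Suc (s v c)" by (metis fun_upd_same upd_def)
      then show "?I s' \<and> m - s' v c < m - s v c" using a lt by auto
    qed
  qed (use init in \<open>auto simp: upd_def\<close>)
  have "runs (For v c b body) s (3 + (m + 1) * ((T + 6) + bcost ?b + 1)) (\<lambda>s'. ?I s' \<and> \<not> bval ?b s')"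
    unfolding For_def
  proof (rule runs_Seq)
    show "runs (Write v (Const c) (Const 0)) s 3 (\<lambda>s'. s' = upd v c 0 s)"
      by (rule runs_mono[OF runs_Write[where Q = "\<lambda>x. x = upd v c 0 s"]]) (auto simp: upd_def)
  qed (use L in simp)
  then show ?thesis
  proof (rule runs_mono)
    fix s' assume a: "?I s' \<and> \<not> bval ?b s'"
    then have "s' v c = m" using bnd[of "s' v c" s'] by auto
    then show "I m s'" using a by auto
  qed simp
qed

definition pbound :: "(nat \<Rightarrow> nat) \<Rightarrow> bool" where
  "pbound f \<longleftrightarrow> (\<exists>q :: nat poly. \<forall>n. f n \<le> poly q n)"

lemma pbound_const [intro, simp]: "pbound (\<lambda>_. c)"
  unfolding pbound_def by (rule exI[of _ "[:c:]"]) simp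

lemma pbound_id [intro, simp]: "pbound (\<lambda>n. n)"
  unfolding pbound_def by (rule exI[of _ "[:0, 1:]"]) simp

lemma pbound_add [intro]: "pbound f \<Longrightarrow> pbound g \<Longrightarrow> pbound (\<lambda>n. f n + g n)"
  unfolding pbound_def by (metis add_mono poly_add)

lemma pbound_mult [intro]: "pbound f \<Longrightarrow> pbound g \<Longrightarrow> pbound (\<lambda>n. f n * g n)"
  unfolding pbound_def by (metis mult_le_mono poly_mult)

section \<open>Program fragments and frame conditions\<close>

abbreviation rd :: "string \<Rightarrow> aexp" where "rd x \<equiv> Read x (Const 0)"

definition keep :: "string set \<Rightarrow> store \<Rightarrow> store \<Rightarrow> bool" where
  "keep W s s' \<longleftrightarrow> (\<forall>a. a \<notin> W \<longrightarrow> s' a = s a)"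

text \<open>Cells from \<open>n\<close> on are ignored, which makes cell \<open>n\<close> a harmless
  dummy.\<close>

definition supp :: "nat \<Rightarrow> (nat \<Rightarrow> nat) \<Rightarrow> nat set" where
  "supp n f = {v. v < n \<and> f v \<noteq> 0}"

definition count_nbrs :: com where
  "count_nbrs = For ''i'' 0 (rd ''n'') (Seq (Write ''dc'' (rd ''i'') (Const 0))
     (For ''j'' 0 (rd ''n'') (Cond
        (Conj (Equal (Read ''adj'' (Plus (Read ''row'' (rd ''i'')) (rd ''j''))) (Const 1))
              (Neg (Equal (Read ''X'' (rd ''j'')) (Const 0))))
        (Write ''dc'' (rd ''i'') (Plus (Read ''dc'' (rd ''i'')) (Const 1))) Skip)))"

definition weigh_X :: com where
  "weigh_X = Seq count_nbrs (Seq (Write ''val'' (Const 0) (Const 0))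
     (For ''i'' 0 (rd ''n'') (Cond (Equal (Read ''X'' (rd ''i'')) (Const 0))
        (Write ''val'' (Const 0) (Plus (rd ''val'') (Read ''wt'' (Read ''dc'' (rd ''i'')))))
        (Write ''val'' (Const 0) (Plus (rd ''val'') (Read ''wt'' (Plus (Const 4) (Read ''dc'' (rd ''i'')))))))))"

definition copy :: "string \<Rightarrow> string \<Rightarrow> com" where
  "copy a b = For ''i'' 0 (rd ''n'') (Write b (rd ''i'') (Read a (rd ''i'')))"

text \<open>The counters run up to \<open>n\<close> inclusive; toggling the cell \<open>n\<close> has no effect on the set, so that the tuples of
  length 13 cover all exchanges of at most 13 vertices.\<close>

primrec toggles :: "nat \<Rightarrow> com" where
  "toggles 0 = Skip"
| "toggles (Suc k) = Seq (toggles k)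
     (Write ''X'' (Read ''x'' (Const k)) (Minus (Const 1) (Read ''X'' (Read ''x'' (Const k)))))"

primrec nest :: "nat \<Rightarrow> com \<Rightarrow> com" where
  "nest 0 body = body"
| "nest (Suc k) body = For ''x'' k (Plus (rd ''n'') (Const 1)) (nest k body)"

text \<open>The exchange is tried on a scratch copy \<open>X\<close>, so a rejected one needs no
  undoing.\<close>

definition attempt :: com where
  "attempt = Seq (copy ''D'' ''X'') (Seq weigh_X (Seq (Write ''cur'' (Const 0) (rd ''val''))
     (Seq (toggles 13) (Seq weigh_X (Cond (Less (rd ''val'') (rd ''cur''))
        (Seq (copy ''X'' ''D'') (Write ''chg'' (Const 0) (Const 1))) Skip)))))"

definition local_search :: com where
  "local_search = Seq (Write ''chg'' (Const 0) (Const 1))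
     (Loop (Neg (Equal (rd ''chg'') (Const 0))) (Seq (Write ''chg'' (Const 0) (Const 0)) (nest 13 attempt)))"

text \<open>A success overwrites \<open>sol\<close>, so the last one survives; any will do, because
  all differ from \<open>D\<close> in at most 13 vertices.\<close>

definition probe :: com where
  "probe = Seq (copy ''D'' ''X'') (Seq (toggles 13) (Seq count_nbrs (Seq (Write ''ok'' (Const 0) (Const 1))
     (Seq (Cond (Equal (Read ''X'' (rd ''p'')) (Const 0)) Skip (Write ''ok'' (Const 0) (Const 0)))
     (Seq (For ''i'' 0 (rd ''n'') (Cond (Conj (Equal (Read ''X'' (rd ''i'')) (Const 0))
          (Conj (Neg (Equal (rd ''i'') (rd ''p''))) (Neg (Less (Read ''dc'' (rd ''p'')) (Read ''dc'' (rd ''i''))))))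
        (Write ''ok'' (Const 0) (Const 0)) Skip))
     (Cond (Equal (rd ''ok'') (Const 1)) (copy ''X'' ''sol'') Skip))))))"

lemma keep_refl [simp]: "keep W s s"
  by (simp add: keep_def)

lemma keep_trans: "keep W s s' \<Longrightarrow> keep W s' s'' \<Longrightarrow> keep W s s''"
  by (simp add: keep_def)

lemma keep_mono: "keep W s s' \<Longrightarrow> W \<subseteq> W' \<Longrightarrow> keep W' s s'"
  unfolding keep_def by blast

lemma keep_upd [simp]: "v \<in> W \<Longrightarrow> keep W s (upd v c k s') = keep W s s'"
  by (auto simp: keep_def upd_def)

lemma upd_same [simp]: "upd v c k s v = (s v)(c := k)"
  by (simp add: upd_def)

lemma upd_other [simp]: "a \<noteq> v \<Longrightarrow> upd v c k s a = s a"
  by (simp add: upd_def)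

lemma runs_Write_upd:
  assumes "Q (upd x (aval a s) (aval b s) s)" "acost a + acost b + 1 \<le> T"
  shows "runs (Write x a b) s T Q"
  using runs_mono[OF runs_Write[where Q = Q] assms(2)] assms(1) by (simp add: upd_def)

lemma supp_cong: "(\<And>v. v < n \<Longrightarrow> f v = g v) \<Longrightarrow> supp n f = supp n g"
  by (auto simp: supp_def)

lemma card_filter_Suc:
  "card {j. j < Suc k \<and> P j} = (if P k then Suc (card {j. j < k \<and> P j}) else card {j. j < k \<and> P j})"
proof -
  have "{j. j < Suc k \<and> P j} = (if P k then insert k {j. j < k \<and> P j} else {j. j < k \<and> P j})"
    by (auto simp: less_Suc_eq)
  then show ?thesis by simp
qed

section \<open>Correctness of the fragments\<close>

locale mdd_instance = cubic_nbhd "{..<n}" N for n :: nat and N :: "nat \<Rightarrow> nat set" +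
  fixes p :: nat
  assumes p_less: "p < n"
begin

text \<open>\<open>row\<close> stores multiples of \<open>n\<close> because the machine cannot
  multiply; its entry at index \<open>n\<close> supplies \<open>n * n\<close> for the weight
  table.\<close>

definition env :: "store \<Rightarrow> bool" where
  "env s \<longleftrightarrow> s ''n'' 0 = n \<and> s ''p'' 0 = p \<and> (\<forall>i\<le>n. s ''row'' i = i * n) \<and>
     (\<forall>i<n. \<forall>j<n. s ''adj'' (i * n + j) = (if j \<in> N i then 1 else 0))"

lemma env_keep: "env s \<Longrightarrow> keep W s s' \<Longrightarrow> ''n'' \<notin> W \<Longrightarrow> ''p'' \<notin> W \<Longrightarrow> ''row'' \<notin> W \<Longrightarrow> ''adj'' \<notin> W \<Longrightarrow> env s'"
  by (simp add: env_def keep_def)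

lemma runs_copy:
  assumes "env s" "a \<noteq> ''i''" "b \<noteq> ''i''" "a \<noteq> b" "b \<notin> {''n'', ''p'', ''row'', ''adj''}"
  shows "runs (copy a b) s ((n + 1) * 20 + 3) (\<lambda>s'. keep {b, ''i''} s s' \<and> (\<forall>v<n. s' b v = s a v))"
proof -
  have "runs (copy a b) s ((n + 1) * (6 + acost (rd ''n'') + 10) + 3)
    (\<lambda>s'. keep {b, ''i''} s s' \<and> (\<forall>v<n. s' b v = s a v))"
    unfolding copy_def
  proof (rule runs_For[where I = "\<lambda>k s'. keep {b, ''i''} s s' \<and> (\<forall>v<k. s' b v = s a v)"])
    fix k s' assume k: "k < n" and I: "keep {b, ''i''} s s' \<and> (\<forall>v<k. s' b v = s a v)" and i: "s' ''i'' 0 = k"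
    have "s' a = s a" using I assms by (simp add: keep_def)
    then show "runs (Write b (rd ''i'') (Read a (rd ''i''))) s' 6
      (\<lambda>s'. s' ''i'' 0 = k \<and> keep {b, ''i''} s (upd ''i'' 0 (Suc k) s') \<and> (\<forall>v<Suc k. upd ''i'' 0 (Suc k) s' b v = s a v))"
      using I i assms by (intro runs_Write_upd) (auto simp: less_Suc_eq)
  next
    fix k s' assume "keep {b, ''i''} s s' \<and> (\<forall>v<k. s' b v = s a v)"
    then show "aval (rd ''n'') s' = n" using assms by (auto simp: env_def keep_def)
  qed (use assms in auto)
  then show ?thesis by (rule runs_mono) auto
qed

lemma runs_count_nbrs:
  assumes "env s"
  shows "runs count_nbrs s ((n + 1) * ((n + 1) * 60 + 30) + 3)
    (\<lambda>s'. keep {''dc'', ''i'', ''j''} s s' \<and> (\<forall>u<n. s' ''dc'' u = card (N u \<inter> supp n (s ''X''))))"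
proof -
  let ?P = "\<lambda>u j. j \<in> N u \<and> s ''X'' j \<noteq> 0"
  have P: "card {j. j < n \<and> ?P u j} = card (N u \<inter> supp n (s ''X''))" for u
    by (rule arg_cong[where f = card]) (auto simp: supp_def)
  let ?I = "\<lambda>k s'. keep {''dc'', ''i'', ''j''} s s' \<and> (\<forall>u<k. s' ''dc'' u = card (N u \<inter> supp n (s ''X'')))"
  have "runs count_nbrs s ((n + 1) * ((4 + ((n + 1) * (45 + acost (rd ''n'') + 10) + 3)) + acost (rd ''n'') + 10) + 3) (?I n)"
    unfolding count_nbrs_def
  proof (rule runs_For[where I = ?I])
    fix k s1 assume k: "k < n" and I: "?I k s1" and i: "s1 ''i'' 0 = k"
    let ?J = "\<lambda>m s'. keep {''dc'', ''i'', ''j''} s s' \<and> s' ''i'' 0 = k \<and> (\<forall>u<k. s' ''dc'' u = card (N u \<inter> supp n (s ''X'')))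
       \<and> s' ''dc'' k = card {j. j < m \<and> ?P k j}"
    let ?body = "Cond (Conj (Equal (Read ''adj'' (Plus (Read ''row'' (rd ''i'')) (rd ''j''))) (Const 1))
              (Neg (Equal (Read ''X'' (rd ''j'')) (Const 0))))
        (Write ''dc'' (rd ''i'') (Plus (Read ''dc'' (rd ''i'')) (Const 1))) Skip"
    show "runs (Seq (Write ''dc'' (rd ''i'') (Const 0)) (For ''j'' 0 (rd ''n'') ?body)) s1
       (4 + ((n + 1) * (45 + acost (rd ''n'') + 10) + 3)) (\<lambda>s'. s' ''i'' 0 = k \<and> ?I (Suc k) (upd ''i'' 0 (Suc k) s'))"
    proof (rule runs_Seq)
      show "runs (Write ''dc'' (rd ''i'') (Const 0)) s1 4 (?J 0)"
        using I i by (intro runs_Write_upd) auto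
    next
      fix s2 assume s2: "?J 0 s2"
      have "runs (For ''j'' 0 (rd ''n'') ?body) s2 ((n + 1) * (45 + acost (rd ''n'') + 10) + 3) (?J n)"
      proof (rule runs_For[where I = ?J])
        fix m s3 assume m: "m < n" and J: "?J m s3" and j: "s3 ''j'' 0 = m"
        let ?b = "Conj (Equal (Read ''adj'' (Plus (Read ''row'' (rd ''i'')) (rd ''j''))) (Const 1))
              (Neg (Equal (Read ''X'' (rd ''j'')) (Const 0)))"
        have e: "s3 ''X'' = s ''X''" "s3 ''row'' k = k * n" "s3 ''adj'' (k * n + m) = (if m \<in> N k then 1 else 0)"
          "s3 ''i'' 0 = k" "s3 ''dc'' k = card {j. j < m \<and> ?P k j}"
          using J assms k m by (auto simp: keep_def env_def)
        have bv: "bval ?b s3 \<longleftrightarrow> ?P k m" using e(1-4) j by simp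
        have dcu: "((s3 ''dc'')(k := c)) u = card (N u \<inter> supp n (s ''X''))" if "u < k" for u c
          using J that by simp
        have kp: "keep {''dc'', ''i'', ''j''} s s3" using J by blast
        have "runs ?body s3 (bcost ?b + max 9 1 + 1) (\<lambda>s'. s' ''j'' 0 = m \<and> ?J (Suc m) (upd ''j'' 0 (Suc m) s'))"
        proof (rule runs_Cond)
          assume "bval ?b s3"
          then have c: "card {j. j < Suc m \<and> ?P k j} = Suc (card {j. j < m \<and> ?P k j})"
            using bv card_filter_Suc[of m "?P k"] by presburger
          show "runs (Write ''dc'' (rd ''i'') (Plus (Read ''dc'' (rd ''i'')) (Const 1))) s3 9
             (\<lambda>s'. s' ''j'' 0 = m \<and> ?J (Suc m) (upd ''j'' 0 (Suc m) s'))"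
            unfolding c using kp dcu e(4,5) j by (intro runs_Write_upd) simp_all
        next
          assume "\<not> bval ?b s3"
          then have c: "card {j. j < Suc m \<and> ?P k j} = card {j. j < m \<and> ?P k j}"
            using bv card_filter_Suc[of m "?P k"] by presburger
          show "runs Skip s3 1 (\<lambda>s'. s' ''j'' 0 = m \<and> ?J (Suc m) (upd ''j'' 0 (Suc m) s'))"
            unfolding c using J j by (intro runs_Skip) simp
        qed
        then show "runs ?body s3 45 (\<lambda>s'. s' ''j'' 0 = m \<and> ?J (Suc m) (upd ''j'' 0 (Suc m) s'))"
          by (rule runs_mono) auto
      next
        fix m s3 assume "?J m s3"
        then show "aval (rd ''n'') s3 = n" using assms by (auto simp: env_def keep_def)
      qed (use s2 in auto)
      then show "runs (For ''j'' 0 (rd ''n'') ?body) s2 ((n + 1) * (45 + acost (rd ''n'') + 10) + 3)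
          (\<lambda>s'. s' ''i'' 0 = k \<and> ?I (Suc k) (upd ''i'' 0 (Suc k) s'))"
      proof (rule runs_mono[OF _ order_refl])
        fix s' assume J: "?J n s'"
        then have "s' ''dc'' u = card (N u \<inter> supp n (s ''X''))" if "u < Suc k" for u
          using that P[of k] by (cases "u = k") auto
        then show "s' ''i'' 0 = k \<and> ?I (Suc k) (upd ''i'' 0 (Suc k) s')" using J by simp
      qed
    qed
  next
    fix k s' assume "?I k s'"
    then show "aval (rd ''n'') s' = n" using assms by (auto simp: env_def keep_def)
  qed auto
  then show ?thesis by (rule runs_mono) (auto simp: algebra_simps)
qed

lemma runs_weigh_X:
  assumes "env s"
  shows "runs weigh_X s ((n + 1) * ((n + 1) * 60 + 80) + 20)
    (\<lambda>s'. keep {''dc'', ''i'', ''j'', ''val''} s s' \<and> s' ''val'' 0 = potential (s ''wt'') (supp n (s ''X'')))"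
proof -
  let ?D = "supp n (s ''X'')"
  let ?W = "{''dc'', ''i'', ''j'', ''val''}"
  let ?c = "\<lambda>s'. keep ?W s s' \<and> (\<forall>u<n. s' ''dc'' u = card (N u \<inter> ?D))"
  let ?I = "\<lambda>k s'. ?c s' \<and> s' ''val'' 0 = (\<Sum>u<k. s ''wt'' ((if u \<in> ?D then 4 else 0) + card (N u \<inter> ?D)))"
  let ?b = "Equal (Read ''X'' (rd ''i'')) (Const 0)"
  let ?c1 = "Write ''val'' (Const 0) (Plus (rd ''val'') (Read ''wt'' (Read ''dc'' (rd ''i''))))"
  let ?c2 = "Write ''val'' (Const 0) (Plus (rd ''val'') (Read ''wt'' (Plus (Const 4) (Read ''dc'' (rd ''i'')))))"
  have "runs weigh_X s (((n + 1) * ((n + 1) * 60 + 30) + 3) + (3 + ((n + 1) * (30 + acost (rd ''n'') + 10) + 3))) (?I n)"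
    unfolding weigh_X_def
  proof (rule runs_Seq[OF runs_count_nbrs[OF assms]], rule runs_Seq)
    fix s' assume s': "keep {''dc'', ''i'', ''j''} s s' \<and> (\<forall>u<n. s' ''dc'' u = card (N u \<inter> ?D))"
    then have "keep ?W s s'" by (auto elim: keep_mono)
    then show "runs (Write ''val'' (Const 0) (Const 0)) s' 3 (?I 0)"
      using s' by (intro runs_Write_upd) auto
  next
    fix s' assume s': "?I 0 s'"
    show "runs (For ''i'' 0 (rd ''n'') (Cond ?b ?c1 ?c2)) s' ((n + 1) * (30 + acost (rd ''n'') + 10) + 3) (?I n)"
    proof (rule runs_For[where I = ?I])
      fix k s1 assume k: "k < n" and I: "?I k s1" and i: "s1 ''i'' 0 = k"
      have e: "s1 ''X'' = s ''X''" "s1 ''wt'' = s ''wt''" using I by (simp_all add: keep_def)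
      have m: "k \<in> ?D \<longleftrightarrow> s ''X'' k \<noteq> 0" using k by (simp add: supp_def)
      have "runs (Cond ?b ?c1 ?c2) s1 (bcost ?b + max 16 16 + 1) (\<lambda>s'. s' ''i'' 0 = k \<and> ?I (Suc k) (upd ''i'' 0 (Suc k) s'))"
        by (rule runs_Cond; rule runs_Write_upd) (use I i e m k in auto)
      then show "runs (Cond ?b ?c1 ?c2) s1 30 (\<lambda>s'. s' ''i'' 0 = k \<and> ?I (Suc k) (upd ''i'' 0 (Suc k) s'))"
        by (rule runs_mono) auto
    next
      fix k s' assume "?I k s'"
      then show "aval (rd ''n'') s' = n" using assms by (auto simp: env_def keep_def)
    qed (use s' in auto)
  qed
  then show ?thesis by (rule runs_mono) (auto simp: algebra_simps potential_def)
qed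

text \<open>Parity matters because a tuple may name a vertex several times.\<close>

definition toggled :: "nat \<Rightarrow> (nat \<Rightarrow> nat) \<Rightarrow> nat set \<Rightarrow> nat set" where
  "toggled k a D = {v. v < n \<and> (v \<in> D \<longleftrightarrow> even (card {i. i < k \<and> a i = v}))}"

lemma runs_toggles:
  "runs (toggles k) s (k * 10 + 1)
    (\<lambda>s'. keep {''X''} s s' \<and> supp n (s' ''X'') = toggled k (s ''x'') (supp n (s ''X'')))"
proof (induction k)
  case 0
  have "runs Skip s 1 (\<lambda>s'. keep {''X''} s s' \<and> supp n (s' ''X'') = toggled 0 (s ''x'') (supp n (s ''X'')))"
    by (rule runs_Skip) (auto simp: toggled_def supp_def)
  then show ?case by simp
next
  case (Suc k)
  have "runs (toggles (Suc k)) s ((k * 10 + 1) + 10)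
    (\<lambda>s'. keep {''X''} s s' \<and> supp n (s' ''X'') = toggled (Suc k) (s ''x'') (supp n (s ''X'')))"
    unfolding toggles.simps
  proof (rule runs_Seq[OF Suc])
    fix s' assume a: "keep {''X''} s s' \<and> supp n (s' ''X'') = toggled k (s ''x'') (supp n (s ''X''))"
    have x: "s' ''x'' = s ''x''" using a by (simp add: keep_def)
    have m: "s' ''X'' v \<noteq> 0 \<longleftrightarrow> (s ''X'' v \<noteq> 0 \<longleftrightarrow> even (card {i. i < k \<and> s ''x'' i = v}))" if "v < n" for v
    proof -
      have "v \<in> supp n (s' ''X'') \<longleftrightarrow> v \<in> toggled k (s ''x'') (supp n (s ''X''))" using a by simp
      then show ?thesis using that by (simp add: supp_def toggled_def)
    qed
    let ?u = "s ''x'' k"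
    have c: "card {i. i < Suc k \<and> s ''x'' i = v} = card {i. i < k \<and> s ''x'' i = v} + (if ?u = v then 1 else 0)" for v
      by (simp add: card_filter_Suc)
    have "supp n ((s' ''X'')(?u := 1 - s' ''X'' ?u)) = toggled (Suc k) (s ''x'') (supp n (s ''X''))"
    proof (rule set_eqI)
      fix v
      show "v \<in> supp n ((s' ''X'')(?u := 1 - s' ''X'' ?u)) \<longleftrightarrow> v \<in> toggled (Suc k) (s ''x'') (supp n (s ''X''))"
      proof (cases "v < n")
        case True
        have "v \<in> supp n ((s' ''X'')(?u := 1 - s' ''X'' ?u)) \<longleftrightarrow> (if ?u = v then s' ''X'' v = 0 else s' ''X'' v \<noteq> 0)"
          using True by (auto simp: supp_def)
        also have "\<dots> \<longleftrightarrow> v \<in> toggled (Suc k) (s ''x'') (supp n (s ''X''))"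
          using m[OF True] True unfolding toggled_def supp_def mem_Collect_eq c by (cases "?u = v") auto
        finally show ?thesis .
      qed (simp add: supp_def toggled_def)
    qed
    then show "runs (Write ''X'' (Read ''x'' (Const k)) (Minus (Const 1) (Read ''X'' (Read ''x'' (Const k))))) s' 10
      (\<lambda>s'. keep {''X''} s s' \<and> supp n (s' ''X'') = toggled (Suc k) (s ''x'') (supp n (s ''X'')))"
      by (intro runs_Write_upd) (use a x in simp_all)
  qed
  then show ?case by (rule runs_mono) auto
qed

end

text \<open>Extends the frame condition back to an earlier store \<open>s\<close> while keeping the
  local one.\<close>

lemma runs_chain:
  assumes "runs c s1 T (\<lambda>s'. keep W s1 s' \<and> Q s')" "keep W0 s s1" "W \<subseteq> W0"
  shows "runs c s1 T (\<lambda>s'. keep W0 s s' \<and> keep W s1 s' \<and> Q s')"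
  using assms(1) by (rule runs_mono) (use assms(2,3) keep_mono keep_trans in blast)+

definition forget :: "store \<Rightarrow> store" where
  "forget s = s(''x'' := (\<lambda>_. 0))"

lemma forget_other [simp]: "a \<noteq> ''x'' \<Longrightarrow> forget s a = s a"
  by (simp add: forget_def)

lemma forget_upd [simp]: "forget (upd ''x'' k c s) = forget s"
  by (simp add: forget_def upd_def)

primrec nest_time :: "nat \<Rightarrow> nat \<Rightarrow> nat \<Rightarrow> nat" where
  "nest_time n T 0 = T"
| "nest_time n T (Suc k) = (n + 2) * (nest_time n T k + 14) + 3"

text \<open>\<open>G\<close> relates the states before and after any part of the sweep and \<open>B a\<close> the states around the
  execution of the body for the tuple \<open>a\<close> of loop counters, both up to the counters themselves.\<close>

definition swept :: "(store \<Rightarrow> store \<Rightarrow> bool) \<Rightarrow> ((nat \<Rightarrow> nat) \<Rightarrow> store \<Rightarrow> store \<Rightarrow> bool) \<Rightarrow>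
    nat \<Rightarrow> nat \<Rightarrow> store \<Rightarrow> store \<Rightarrow> bool" where
  "swept G B n k s s' \<longleftrightarrow> (\<forall>i\<ge>k. s' ''x'' i = s ''x'' i) \<and> G (forget s) (forget s') \<and>
     (\<forall>a. (\<forall>i<k. a i \<le> n) \<longrightarrow> (\<forall>i\<ge>k. a i = s ''x'' i) \<longrightarrow>
       (\<exists>s1 s2. G (forget s) s1 \<and> B a s1 s2 \<and> G s2 (forget s')))"

lemma sweptE:
  assumes "swept G B n k s s'" "\<forall>i<k. b i \<le> n"
  obtains a s1 s2 where "\<forall>i<k. a i = b i"
    "G (forget s) s1" "B a s1 s2" "G s2 (forget s')"
proof -
  \<comment> \<open>Beyond \<open>k\<close> the tuple is completed with the counters found in the
    store, as \<open>swept\<close> demands.\<close>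
  define a where "a i = (if i < k then b i else s ''x'' i)" for i
  have "\<forall>i<k. a i \<le> n" "\<forall>i\<ge>k. a i = s ''x'' i" using assms(2) by (simp_all add: a_def)
  then obtain s1 s2 where "G (forget s) s1 \<and> B a s1 s2 \<and> G s2 (forget s')"
    using assms(1) unfolding swept_def by blast
  moreover have "\<forall>i<k. a i = b i" by (simp add: a_def)
  ultimately show thesis using that by blast
qed

text \<open>The outer loop has covered the tuples with \<open>a k < m\<close> after \<open>m\<close>
  rounds; transitivity of \<open>G\<close> joins the states before, around and after a particular
  execution of the body.\<close>

lemma runs_nest:
  assumes body: "\<And>s. I (forget s) \<Longrightarrow>
      runs body s T (\<lambda>s'. I (forget s') \<and> s' ''x'' = s ''x'' \<and> B (s ''x'') (forget s) (forget s'))"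
    and n: "\<And>s. I (forget s) \<Longrightarrow> s ''n'' 0 = n"
    and BG: "\<And>a s s'. B a s s' \<Longrightarrow> G s s'" and refl: "\<And>s. G s s"
    and trans: "\<And>s s' s''. G s s' \<Longrightarrow> G s' s'' \<Longrightarrow> G s s''"
    and "I (forget s)"
  shows "runs (nest k body) s (nest_time n T k) (\<lambda>s'. I (forget s') \<and> swept G B n k s s')"
  using assms(6)
proof (induction k arbitrary: s)
  case 0
  have "runs body s T (\<lambda>s'. I (forget s') \<and> s' ''x'' = s ''x'' \<and> B (s ''x'') (forget s) (forget s'))"
    by (rule body) fact
  then show ?case unfolding nest.simps nest_time.simps
  proof (rule runs_mono[OF _ order_refl])
    fix s' assume a: "I (forget s') \<and> s' ''x'' = s ''x'' \<and> B (s ''x'') (forget s) (forget s')"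
    have "\<exists>s1 s2. G (forget s) s1 \<and> B b s1 s2 \<and> G s2 (forget s')" if "\<forall>i\<ge>0. b i = s ''x'' i" for b
    proof -
      have "b = s ''x''" using that by auto
      then show ?thesis using a refl by blast
    qed
    then show "I (forget s') \<and> swept G B n 0 s s'" using a BG by (auto simp: swept_def)
  qed
next
  case (Suc k)
  let ?I = "\<lambda>m s'. I (forget s') \<and> (\<forall>i\<ge>Suc k. s' ''x'' i = s ''x'' i) \<and>
    G (forget s) (forget s') \<and> (\<forall>a. (\<forall>i<k. a i \<le> n) \<longrightarrow> a k < m \<longrightarrow> (\<forall>i\<ge>Suc k. a i = s ''x'' i) \<longrightarrow>
      (\<exists>s1 s2. G (forget s) s1 \<and> B a s1 s2 \<and> G s2 (forget s')))"
  have "runs (nest (Suc k) body) s ((n + 1 + 1) * (nest_time n T k + acost (Plus (rd ''n'') (Const 1)) + 10) + 3) (?I (n + 1))"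
    unfolding nest.simps
  proof (rule runs_For[where I = ?I])
    fix m s1 assume m: "m < n + 1" and J: "?I m s1" and x: "s1 ''x'' k = m"
    have "I (forget s1)" using J by blast
    from Suc.IH[OF this]
    show "runs (nest k body) s1 (nest_time n T k) (\<lambda>s'. s' ''x'' k = m \<and> ?I (Suc m) (upd ''x'' k (Suc m) s'))"
    proof (rule runs_mono[OF _ order_refl])
      fix s' assume "I (forget s') \<and> swept G B n k s1 s'"
      then have K: "I (forget s')" "\<forall>i\<ge>k. s' ''x'' i = s1 ''x'' i" "G (forget s1) (forget s')"
        "\<And>a. (\<forall>i<k. a i \<le> n) \<Longrightarrow> (\<forall>i\<ge>k. a i = s1 ''x'' i) \<Longrightarrow>
          (\<exists>s1' s2. G (forget s1) s1' \<and> B a s1' s2 \<and> G s2 (forget s'))"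
        by (auto simp: swept_def)
      have "\<exists>t1 t2. G (forget s) t1 \<and> B a t1 t2 \<and> G t2 (forget s')"
        if a: "\<forall>i<k. a i \<le> n" "a k < Suc m" "\<forall>i\<ge>Suc k. a i = s ''x'' i" for a
      proof (cases "a k = m")
        case True
        have "\<forall>i\<ge>k. a i = s1 ''x'' i"
        proof (intro allI impI)
          fix i assume "k \<le> i"
          then show "a i = s1 ''x'' i" using a(3) J x True by (cases "i = k") auto
        qed
        then obtain t1 t2 where "G (forget s1) t1" "B a t1 t2" "G t2 (forget s')" using K(4) a(1) by blast
        then show ?thesis using J trans by blast
      next
        case False
        then have "a k < m" using a(2) by simp
        then obtain t1 t2 where "G (forget s) t1" "B a t1 t2" "G t2 (forget s1)" using J a by blast
        then show ?thesis using K(3) trans by blast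
      qed
      moreover have "s' ''x'' k = m" using K(2) x by simp
      moreover have "\<forall>i\<ge>Suc k. s' ''x'' i = s ''x'' i" using K(2) J by simp
      moreover have "G (forget s) (forget s')" using K(3) J trans by blast
      ultimately show "s' ''x'' k = m \<and> ?I (Suc m) (upd ''x'' k (Suc m) s')" using K(1) by simp
    qed
  next
    fix m s' assume "?I m s'"
    then show "aval (Plus (rd ''n'') (Const 1)) s' = n + 1" using n by simp
  next
    show "?I 0 (upd ''x'' k 0 s)" using Suc.prems refl by simp
  qed
  then show ?case
  proof (rule runs_mono)
    fix s' assume J: "?I (n + 1) s'"
    have "\<exists>t1 t2. G (forget s) t1 \<and> B a t1 t2 \<and> G t2 (forget s')"
      if a: "\<forall>i<Suc k. a i \<le> n" "\<forall>i\<ge>Suc k. a i = s ''x'' i" for a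
    proof -
      have "a k < n + 1" "\<forall>i<k. a i \<le> n" using a by (auto simp: less_Suc_eq_le)
      then show ?thesis using J a(2) by blast
    qed
    then show "I (forget s') \<and> swept G B n (Suc k) s s'" using J unfolding swept_def by blast
  qed simp
qed

section \<open>Local search and exhaustive probing\<close>

definition attempt_time :: "nat \<Rightarrow> nat" where
  "attempt_time n = 2 * ((n + 1) * ((n + 1) * 60 + 80) + 20) + 2 * ((n + 1) * 20 + 3) + 160"

definition probe_time :: "nat \<Rightarrow> nat" where
  "probe_time n = ((n + 1) * ((n + 1) * 60 + 30) + 3) + 2 * ((n + 1) * 20 + 3) + (n + 1) * 60 + 200"

context mdd_instance begin

abbreviation Dset :: "store \<Rightarrow> nat set" where "Dset s \<equiv> supp n (s ''D'')"

lemma runs_attempt: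
  assumes "env s"
  shows "runs attempt s (attempt_time n) (\<lambda>s'. keep {''D'', ''X'', ''dc'', ''i'', ''j'', ''val'', ''cur'', ''chg''} s s' \<and>
    (s' ''D'' = s ''D'' \<and> s' ''chg'' = s ''chg'' \<and>
        \<not> potential (s ''wt'') (toggled 13 (s ''x'') (Dset s)) < potential (s ''wt'') (Dset s) \<or>
     potential (s ''wt'') (Dset s') < potential (s ''wt'') (Dset s) \<and> s' ''chg'' 0 = 1))" (is "runs attempt s _ ?Q")
proof -
  let ?W = "{''X'', ''dc'', ''i'', ''j'', ''val'', ''cur''}"
  let ?w = "s ''wt''"
  let ?tog = "toggled 13 (s ''x'') (Dset s)"
  let ?A1 = "\<lambda>s'. keep ?W s s' \<and> supp n (s' ''X'') = Dset s"
  let ?A2 = "\<lambda>s'. ?A1 s' \<and> s' ''val'' 0 = potential ?w (Dset s)"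
  let ?A3 = "\<lambda>s'. ?A1 s' \<and> s' ''cur'' 0 = potential ?w (Dset s)"
  let ?A4 = "\<lambda>s'. keep ?W s s' \<and> supp n (s' ''X'') = ?tog \<and> s' ''cur'' 0 = potential ?w (Dset s)"
  let ?A5 = "\<lambda>s'. ?A4 s' \<and> s' ''val'' 0 = potential ?w ?tog"
  have env: "env s'" if "keep ?W s s'" for s' by (rule env_keep[OF assms that]) auto
  let ?e = "(n + 1) * ((n + 1) * 60 + 80) + 20" and ?c = "(n + 1) * 20 + 3"
  let ?b = "Less (rd ''val'') (rd ''cur'')"
  let ?accept = "Seq (copy ''X'' ''D'') (Write ''chg'' (Const 0) (Const 1))"
  have accept: "runs ?accept t (?c + 3) ?Q" if t: "?A5 t" and less: "potential ?w ?tog < potential ?w (Dset s)" for t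
  proof (rule runs_Seq[where P = "\<lambda>s'. keep (insert ''D'' ?W) s s' \<and> Dset s' = ?tog"])
    show "runs (copy ''X'' ''D'') t ?c (\<lambda>s'. keep (insert ''D'' ?W) s s' \<and> Dset s' = ?tog)"
    proof (rule runs_mono[OF runs_chain[OF runs_copy[OF env], of t "''X''" "''D''" "insert ''D'' ?W" s] order_refl])
      fix s' assume a: "keep (insert ''D'' ?W) s s' \<and> keep {''D'', ''i''} t s' \<and> (\<forall>v<n. s' ''D'' v = t ''X'' v)"
      have "Dset s' = supp n (t ''X'')" by (rule supp_cong) (use a in simp)
      then show "keep (insert ''D'' ?W) s s' \<and> Dset s' = ?tog" using a t by simp
    next
      show "keep (insert ''D'' ?W) s t" using t by (auto elim: keep_mono)
    qed (use t in auto)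
    fix s' assume s': "keep (insert ''D'' ?W) s s' \<and> Dset s' = ?tog"
    then have "keep {''D'', ''X'', ''dc'', ''i'', ''j'', ''val'', ''cur'', ''chg''} s s'" by (auto elim: keep_mono)
    then show "runs (Write ''chg'' (Const 0) (Const 1)) s' 3 ?Q" by (intro runs_Write_upd) (use s' less in auto)
  qed
  have reject: "runs Skip t 1 ?Q" if t: "?A5 t" and less: "\<not> potential ?w ?tog < potential ?w (Dset s)" for t
  proof -
    have "keep {''D'', ''X'', ''dc'', ''i'', ''j'', ''val'', ''cur'', ''chg''} s t" using t by (auto elim: keep_mono)
    then show ?thesis by (intro runs_Skip) (use less t in \<open>auto simp: keep_def\<close>)
  qed
  have 6: "runs (Cond ?b ?accept Skip) t (bcost ?b + max (?c + 3) 1 + 1) ?Q" if t: "?A5 t" for t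
    using accept[OF t] reject[OF t] t by (intro runs_Cond) auto
  have 5: "runs weigh_X t ?e ?A5" if "?A4 t" for t
    by (rule runs_mono[OF runs_chain[OF runs_weigh_X[OF env], of t ?W s]]) (use that in \<open>auto simp: keep_def\<close>)
  have 4: "runs (toggles 13) t (13 * 10 + 1) ?A4" if "?A3 t" for t
    by (rule runs_mono[OF runs_chain[OF runs_toggles, of ?W s]]) (use that in \<open>auto simp: keep_def\<close>)
  have 3: "runs (Write ''cur'' (Const 0) (rd ''val'')) t 4 ?A3" if "?A2 t" for t
    by (rule runs_Write_upd) (use that in auto)
  have 2: "runs weigh_X t ?e ?A2" if "?A1 t" for t
    by (rule runs_mono[OF runs_chain[OF runs_weigh_X[OF env], of t ?W s]]) (use that in \<open>auto simp: keep_def\<close>)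
  have 1: "runs (copy ''D'' ''X'') s ?c ?A1"
    by (rule runs_mono[OF runs_copy[OF assms]]) (auto elim: keep_mono simp: supp_def)
  have "runs attempt s (?c + (?e + (4 + ((13 * 10 + 1) + (?e + (bcost ?b + max (?c + 3) 1 + 1)))))) ?Q"
    unfolding attempt_def
    by (rule runs_Seq[OF 1], rule runs_Seq[OF 2], assumption, rule runs_Seq[OF 3], assumption,
        rule runs_Seq[OF 4], assumption, rule runs_Seq[OF 5], assumption, rule 6)
  then show ?thesis by (rule runs_mono) (auto simp: attempt_time_def)
qed

definition locally_minimal :: "(nat \<Rightarrow> nat) \<Rightarrow> nat set \<Rightarrow> bool" where
  "locally_minimal w D \<longleftrightarrow> (\<forall>a. (\<forall>i<13. a i \<le> n) \<longrightarrow> potential w D \<le> potential w (toggled 13 a D))"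

lemma toggled_cong: "(\<And>i. i < k \<Longrightarrow> a i = b i) \<Longrightarrow> toggled k a D = toggled k b D"
proof -
  assume "\<And>i. i < k \<Longrightarrow> a i = b i"
  then have "{i. i < k \<and> a i = v} = {i. i < k \<and> b i = v}" for v by auto
  then show ?thesis by (simp add: toggled_def)
qed

text \<open>If the flag is still 0 after the sweep, no exchange was accepted, so every tuple was
  tested against the final \<open>D\<close>: this is local minimality.\<close>

lemma runs_attempt_all:
  assumes "env s" "s ''wt'' = w"
  shows "runs (nest 13 attempt) s (nest_time n (attempt_time n) 13) (\<lambda>s'. env s' \<and> s' ''wt'' = w \<and> s' ''sol'' = s ''sol'' \<and>
    (s' ''D'' = s ''D'' \<and> s' ''chg'' = s ''chg'' \<or> potential w (Dset s') < potential w (Dset s) \<and> s' ''chg'' 0 = 1) \<and>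
    (s ''chg'' 0 = 0 \<longrightarrow> s' ''chg'' 0 = 0 \<longrightarrow> locally_minimal w (Dset s')))"
proof -
  let ?I = "\<lambda>t. env t \<and> t ''wt'' = w \<and> t ''sol'' = s ''sol''"
  let ?G = "\<lambda>t t'. t' ''D'' = t ''D'' \<and> t' ''chg'' = t ''chg'' \<or> potential w (Dset t') < potential w (Dset t) \<and> t' ''chg'' 0 = 1"
  let ?B = "\<lambda>a t t'. t' ''D'' = t ''D'' \<and> t' ''chg'' = t ''chg'' \<and> \<not> potential w (toggled 13 a (Dset t)) < potential w (Dset t)
     \<or> potential w (Dset t') < potential w (Dset t) \<and> t' ''chg'' 0 = 1"
  have envf: "env (forget t) = env t" for t by (simp add: env_def)
  have "runs (nest 13 attempt) s (nest_time n (attempt_time n) 13) (\<lambda>s'. ?I (forget s') \<and> swept ?G ?B n 13 s s')"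
  proof (rule runs_nest)
    fix t assume t: "?I (forget t)"
    then have et: "env t" using envf by blast
    let ?W = "{''D'', ''X'', ''dc'', ''i'', ''j'', ''val'', ''cur'', ''chg''}"
    show "runs attempt t (attempt_time n) (\<lambda>s'. ?I (forget s') \<and> s' ''x'' = t ''x'' \<and> ?B (t ''x'') (forget t) (forget s'))"
    proof (rule runs_mono[OF runs_attempt[OF et] order_refl], elim conjE)
      fix s' assume k: "keep ?W t s'" and a: "s' ''D'' = t ''D'' \<and> s' ''chg'' = t ''chg'' \<and>
        \<not> potential (t ''wt'') (toggled 13 (t ''x'') (Dset t)) < potential (t ''wt'') (Dset t) \<or>
        potential (t ''wt'') (Dset s') < potential (t ''wt'') (Dset t) \<and> s' ''chg'' 0 = 1"
      have "env s'" by (rule env_keep[OF et k]) auto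
      moreover have "s' ''wt'' = w" "s' ''sol'' = s ''sol''" "s' ''x'' = t ''x''" "t ''wt'' = w"
        using k t by (auto simp: keep_def)
      ultimately show "?I (forget s') \<and> s' ''x'' = t ''x'' \<and> ?B (t ''x'') (forget t) (forget s')"
        using a by (simp add: envf)
    qed
  next
    show "?I (forget s)" using assms by (simp add: envf)
  next
    fix t t' t'' assume "?G t t'" "?G t' t''"
    then show "?G t t''" by auto
  qed (auto simp: env_def)
  then show ?thesis
  proof (rule runs_mono[OF _ order_refl], elim conjE)
    fix s' assume e: "env (forget s')" "forget s' ''wt'' = w" "forget s' ''sol'' = s ''sol''"
      and sw: "swept ?G ?B n 13 s s'"
    have "locally_minimal w (Dset s')" if c: "s ''chg'' 0 = 0" "s' ''chg'' 0 = 0"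
      unfolding locally_minimal_def
    proof (intro allI impI)
      fix b :: "nat \<Rightarrow> nat" assume b: "\<forall>i<13. b i \<le> n"
      obtain a s1 s2 where 1: "\<forall>i<13. a i = b i" "?G (forget s) s1" "?B a s1 s2" "?G s2 (forget s')"
        by (rule sweptE[OF sw b])
      have "s2 ''chg'' 0 = 0" "s' ''D'' = s2 ''D''" using 1(4) c by auto
      then have "\<not> potential w (toggled 13 a (Dset s1)) < potential w (Dset s1)" "s2 ''D'' = s1 ''D''" using 1(3) by auto
      then show "potential w (Dset s') \<le> potential w (toggled 13 b (Dset s'))"
        using \<open>s' ''D'' = s2 ''D''\<close> toggled_cong[of 13 a b] 1(1) by simp
    qed
    then show "env s' \<and> s' ''wt'' = w \<and> s' ''sol'' = s ''sol'' \<and>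
      (s' ''D'' = s ''D'' \<and> s' ''chg'' = s ''chg'' \<or> potential w (Dset s') < potential w (Dset s) \<and> s' ''chg'' 0 = 1) \<and>
      (s ''chg'' 0 = 0 \<longrightarrow> s' ''chg'' 0 = 0 \<longrightarrow> locally_minimal w (Dset s'))"
      using e sw by (simp add: envf swept_def)
  qed
qed

text \<open>The measure is the potential plus one for a raised flag: a sweep with a success lowers
  the potential, one without lowers the flag.\<close>

lemma runs_local_search:
  assumes "env s" "s ''wt'' = w" "potential w (Dset s) \<le> M"
  shows "runs local_search s ((M + 2) * (nest_time n (attempt_time n) 13 + 9) + 3)
    (\<lambda>s'. env s' \<and> s' ''wt'' = w \<and> s' ''sol'' = s ''sol'' \<and> locally_minimal w (Dset s'))"
proof -
  let ?I = "\<lambda>t. env t \<and> t ''wt'' = w \<and> t ''sol'' = s ''sol'' \<and> (t ''chg'' 0 = 0 \<longrightarrow> locally_minimal w (Dset t))"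
  let ?f = "\<lambda>t. potential w (Dset t) + (if t ''chg'' 0 = 0 then 0 else 1)"
  let ?b = "Neg (Equal (rd ''chg'') (Const 0))"
  let ?T = "nest_time n (attempt_time n) 13"
  have "runs local_search s (3 + (M + 1 + 1) * ((3 + ?T) + bcost ?b + 1))
    (\<lambda>s'. env s' \<and> s' ''wt'' = w \<and> s' ''sol'' = s ''sol'' \<and> locally_minimal w (Dset s'))"
    unfolding local_search_def
  proof (rule runs_Seq)
    show "runs (Write ''chg'' (Const 0) (Const 1)) s 3 (\<lambda>t. ?I t \<and> ?f t \<le> M + 1)"
      by (rule runs_Write_upd) (use assms env_keep[of s "{''chg''}" "upd ''chg'' 0 1 s"] in auto)
  next
    fix s1 assume s1: "?I s1 \<and> ?f s1 \<le> M + 1"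
    have "runs (Loop ?b (Seq (Write ''chg'' (Const 0) (Const 0)) (nest 13 attempt))) s1
       ((M + 1 + 1) * ((3 + ?T) + bcost ?b + 1)) (\<lambda>s'. ?I s' \<and> \<not> bval ?b s')"
    proof (rule runs_Loop[where f = ?f])
      fix t assume t: "?I t" "bval ?b t"
      show "runs (Seq (Write ''chg'' (Const 0) (Const 0)) (nest 13 attempt)) t (3 + ?T) (\<lambda>s'. ?I s' \<and> ?f s' < ?f t)"
      proof (rule runs_Seq)
        show "runs (Write ''chg'' (Const 0) (Const 0)) t 3 (\<lambda>t'. env t' \<and> t' ''wt'' = w \<and> t' ''sol'' = s ''sol'' \<and>
            t' ''chg'' 0 = 0 \<and> t' ''D'' = t ''D'')"
          by (rule runs_Write_upd) (use t env_keep[of t "{''chg''}" "upd ''chg'' 0 0 t"] in auto)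
      next
        fix t' assume t': "env t' \<and> t' ''wt'' = w \<and> t' ''sol'' = s ''sol'' \<and> t' ''chg'' 0 = 0 \<and> t' ''D'' = t ''D''"
        show "runs (nest 13 attempt) t' ?T (\<lambda>s'. ?I s' \<and> ?f s' < ?f t)"
          by (rule runs_mono[OF runs_attempt_all[of t' w]]) (use t' t in auto)
      qed
    qed (use s1 in auto)
    then show "runs (Loop ?b (Seq (Write ''chg'' (Const 0) (Const 0)) (nest 13 attempt))) s1
       ((M + 1 + 1) * ((3 + ?T) + bcost ?b + 1)) (\<lambda>s'. env s' \<and> s' ''wt'' = w \<and> s' ''sol'' = s ''sol'' \<and> locally_minimal w (Dset s'))"
      by (rule runs_mono) auto
  qed
  then show ?thesis by (rule runs_mono) (auto simp: algebra_simps)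
qed

lemma runs_probe:
  assumes "env s"
  defines "S \<equiv> toggled 13 (s ''x'') (Dset s)"
  shows "runs probe s (probe_time n) (\<lambda>s'. keep {''X'', ''dc'', ''i'', ''j'', ''ok'', ''sol''} s s' \<and>
    (if good p S then supp n (s' ''sol'') = S else s' ''sol'' = s ''sol''))" (is "runs probe s _ ?Q")
proof -
  let ?W = "{''X'', ''dc'', ''i'', ''j'', ''ok''}"
  have env: "env s'" if "keep ?W s s'" for s' by (rule env_keep[OF assms(1) that]) auto
  let ?A1 = "\<lambda>s'. keep ?W s s' \<and> supp n (s' ''X'') = Dset s"
  let ?A2 = "\<lambda>s'. keep ?W s s' \<and> supp n (s' ''X'') = S"
  let ?A3 = "\<lambda>s'. ?A2 s' \<and> (\<forall>u<n. s' ''dc'' u = card (N u \<inter> S))"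
  let ?A4 = "\<lambda>s'. ?A3 s' \<and> s' ''ok'' 0 = 1"
  let ?ok = "\<lambda>k. p \<notin> S \<and> (\<forall>v<k. v \<notin> S \<longrightarrow> v \<noteq> p \<longrightarrow> card (N p \<inter> S) < card (N v \<inter> S))"
  let ?A5 = "\<lambda>k s'. ?A3 s' \<and> s' ''ok'' 0 = (if ?ok k then 1 else 0)"
  let ?c = "(n + 1) * 20 + 3" and ?d = "(n + 1) * ((n + 1) * 60 + 30) + 3"
  let ?b5 = "Equal (Read ''X'' (rd ''p'')) (Const 0)"
  let ?b6 = "Conj (Equal (Read ''X'' (rd ''i'')) (Const 0))
          (Conj (Neg (Equal (rd ''i'') (rd ''p''))) (Neg (Less (Read ''dc'' (rd ''p'')) (Read ''dc'' (rd ''i'')))))"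
  let ?c6 = "Cond ?b6 (Write ''ok'' (Const 0) (Const 0)) Skip"
  let ?b7 = "Equal (rd ''ok'') (Const 1)"
  have X: "s' ''X'' v = 0 \<longleftrightarrow> v \<notin> S" if "?A3 s'" "v < n" for s' v
    using that by (auto simp: supp_def)
  have accept: "runs (copy ''X'' ''sol'') t ?c ?Q" if t: "?A5 n t" and f: "good p S" for t
  proof (rule runs_mono[OF runs_chain[OF runs_copy[OF env], of t "''X''" "''sol''" "insert ''sol'' ?W" s] order_refl])
    fix s' assume a: "keep (insert ''sol'' ?W) s s' \<and> keep {''sol'', ''i''} t s' \<and> (\<forall>v<n. s' ''sol'' v = t ''X'' v)"
    have "supp n (s' ''sol'') = supp n (t ''X'')" by (rule supp_cong) (use a in simp)
    then show "?Q s'" using a t f by (simp add: insert_commute)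
  next
    show "keep (insert ''sol'' ?W) s t" using t by (auto elim: keep_mono)
  qed (use t in auto)
  have reject: "runs Skip t 1 ?Q" if t: "?A5 n t" and f: "\<not> good p S" for t
  proof -
    have "keep {''X'', ''dc'', ''i'', ''j'', ''ok'', ''sol''} s t" using t by (auto elim: keep_mono)
    then show ?thesis by (intro runs_Skip) (use f t in \<open>auto simp: keep_def\<close>)
  qed
  have 7: "runs (Cond ?b7 (copy ''X'' ''sol'') Skip) t (bcost ?b7 + max ?c 1 + 1) ?Q" if t: "?A5 n t" for t
  proof -
    have "bval ?b7 t \<longleftrightarrow> good p S" using t by (auto simp: good_def)
    then show ?thesis using accept[OF t] reject[OF t] by (intro runs_Cond) blast+
  qed
  have 6: "runs (For ''i'' 0 (rd ''n'') ?c6) t0 ((n + 1) * (40 + acost (rd ''n'') + 10) + 3) (?A5 n)" if t0: "?A5 0 t0" for t0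
  proof (rule runs_For[where I = ?A5])
    fix k t assume k: "k < n" and t: "?A5 k t" and i: "t ''i'' 0 = k"
    have e: "t ''p'' 0 = p" "t ''dc'' p = card (N p \<inter> S)" "t ''dc'' k = card (N k \<inter> S)"
      "t ''X'' k = 0 \<longleftrightarrow> k \<notin> S"
      using env[of t] t k p_less X[of t k] by (auto simp: env_def)
    have b: "bval ?b6 t \<longleftrightarrow> \<not> (k \<notin> S \<longrightarrow> k \<noteq> p \<longrightarrow> card (N p \<inter> S) < card (N k \<inter> S))"
      using e i by auto
    have okS: "?ok (Suc k) \<longleftrightarrow> ?ok k \<and> \<not> bval ?b6 t"
      unfolding b by (auto simp: less_Suc_eq)
    have "runs ?c6 t (bcost ?b6 + max 3 1 + 1) (\<lambda>s'. s' ''i'' 0 = k \<and> ?A5 (Suc k) (upd ''i'' 0 (Suc k) s'))"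
      unfolding okS
      by (rule runs_Cond; (rule runs_Write_upd | rule runs_Skip)) (use t i in \<open>simp_all del: bval.simps\<close>)
    then show "runs ?c6 t 40 (\<lambda>s'. s' ''i'' 0 = k \<and> ?A5 (Suc k) (upd ''i'' 0 (Suc k) s'))" by (rule runs_mono) auto
  next
    fix k t assume "?A5 k t"
    then show "aval (rd ''n'') t = n" using env[of t] by (auto simp: env_def)
  next
    show "?A5 0 (upd ''i'' 0 0 t0)" using t0 by simp
  qed
  have 5: "runs (Cond ?b5 Skip (Write ''ok'' (Const 0) (Const 0))) t (bcost ?b5 + max 1 3 + 1) (?A5 0)" if t: "?A4 t" for t
  proof -
    have "t ''p'' 0 = p" using env[of t] t by (simp add: env_def)
    then show ?thesis using t X[of t p] p_less by (intro runs_Cond runs_Skip runs_Write_upd) auto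
  qed
  have 4: "runs (Write ''ok'' (Const 0) (Const 1)) t 3 ?A4" if "?A3 t" for t
    by (rule runs_Write_upd) (use that in auto)
  have 3: "runs count_nbrs t ?d ?A3" if "?A2 t" for t
    by (rule runs_mono[OF runs_chain[OF runs_count_nbrs[OF env], of t ?W s]]) (use that in \<open>auto simp: keep_def\<close>)
  have 2: "runs (toggles 13) t (13 * 10 + 1) ?A2" if "?A1 t" for t
    by (rule runs_mono[OF runs_chain[OF runs_toggles, of ?W s]]) (use that in \<open>auto simp: keep_def S_def\<close>)
  have 1: "runs (copy ''D'' ''X'') s ?c ?A1"
    by (rule runs_mono[OF runs_copy[OF assms(1)]]) (auto elim: keep_mono simp: supp_def)
  have "runs probe s (?c + ((13 * 10 + 1) + (?d + (3 + ((bcost ?b5 + max 1 3 + 1) +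
      (((n + 1) * (40 + acost (rd ''n'') + 10) + 3) + (bcost ?b7 + max ?c 1 + 1))))))) ?Q"
    unfolding probe_def
    by (rule runs_Seq[OF 1], rule runs_Seq[OF 2], assumption, rule runs_Seq[OF 3], assumption,
        rule runs_Seq[OF 4], assumption, rule runs_Seq[OF 5], assumption, rule runs_Seq[OF 6], assumption, rule 7)
  then show ?thesis by (rule runs_mono) (auto simp: probe_time_def)
qed

text \<open>One admissible tuple within range guarantees a good final \<open>sol\<close>, though a
  later tuple may have written it.\<close>

lemma runs_probe_all:
  assumes "env s"
  defines "Q \<equiv> \<lambda>S. \<exists>a. S = toggled 13 a (Dset s) \<and> good p S"
  shows "runs (nest 13 probe) s (nest_time n (probe_time n) 13) (\<lambda>s'. env s' \<and>
    (s' ''sol'' = s ''sol'' \<or> Q (supp n (s' ''sol''))) \<and>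
    (\<forall>a. (\<forall>i<13. a i \<le> n) \<longrightarrow> good p (toggled 13 a (Dset s)) \<longrightarrow> Q (supp n (s' ''sol''))))"
proof -
  let ?B = "\<lambda>a t t'. t' ''D'' = t ''D'' \<and> (if good p (toggled 13 a (Dset t)) then supp n (t' ''sol'') = toggled 13 a (Dset t)
     else t' ''sol'' = t ''sol'')"
  let ?G = "\<lambda>t t'. t' ''D'' = t ''D'' \<and>
     (t' ''sol'' = t ''sol'' \<or> (\<exists>a. supp n (t' ''sol'') = toggled 13 a (Dset t) \<and> good p (supp n (t' ''sol''))))"
  have envf: "env (forget t) = env t" for t by (simp add: env_def)
  have "runs (nest 13 probe) s (nest_time n (probe_time n) 13) (\<lambda>s'. env (forget s') \<and> swept ?G ?B n 13 s s')"
  proof (rule runs_nest)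
    fix t assume "env (forget t)"
    then have t: "env t" using envf by blast
    show "runs probe t (probe_time n) (\<lambda>s'. env (forget s') \<and> s' ''x'' = t ''x'' \<and> ?B (t ''x'') (forget t) (forget s'))"
    proof (rule runs_mono[OF runs_probe[OF t] order_refl], elim conjE)
      fix s' assume k: "keep {''X'', ''dc'', ''i'', ''j'', ''ok'', ''sol''} t s'" and
        a: "if good p (toggled 13 (t ''x'') (Dset t)) then supp n (s' ''sol'') = toggled 13 (t ''x'') (Dset t)
          else s' ''sol'' = t ''sol''"
      have "env s'" by (rule env_keep[OF t k]) auto
      moreover have "s' ''D'' = t ''D''" "s' ''x'' = t ''x''" using k by (auto simp: keep_def)
      ultimately show "env (forget s') \<and> s' ''x'' = t ''x'' \<and> ?B (t ''x'') (forget t) (forget s')"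
        using a by (simp add: envf)
    qed
  next
    fix a t t' assume B: "?B a t t'"
    show "?G t t'"
    proof (cases "good p (toggled 13 a (Dset t))")
      case True
      then have "supp n (t' ''sol'') = toggled 13 a (Dset t)" using B by simp
      then show ?thesis using B True by metis
    qed (use B in simp)
  next
    fix t t' t'' assume "?G t t'" "?G t' t''"
    then show "?G t t''" by auto
  qed (use assms in \<open>auto simp: env_def\<close>)
  then show ?thesis
  proof (rule runs_mono[OF _ order_refl], elim conjE)
    fix s' assume e: "env (forget s')" and sw: "swept ?G ?B n 13 s s'"
    have "Q (supp n (s' ''sol''))" if b: "\<forall>i<13. b i \<le> n" "good p (toggled 13 b (Dset s))" for b
    proof -
      obtain a s1 s2 where 1: "\<forall>i<13. a i = b i" "?G (forget s) s1" "?B a s1 s2" "?G s2 (forget s')"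
        by (rule sweptE[OF sw b(1)])
      have D: "s1 ''D'' = s ''D''" "s2 ''D'' = s ''D''" using 1 by auto
      have "supp n (s2 ''sol'') = toggled 13 b (Dset s)"
        using 1(1,3) b(2) toggled_cong[of 13 a b] D by simp
      then show ?thesis unfolding Q_def using 1(4) D b(2) by auto
    qed
    then show "env s' \<and> (s' ''sol'' = s ''sol'' \<or> Q (supp n (s' ''sol''))) \<and>
    (\<forall>a. (\<forall>i<13. a i \<le> n) \<longrightarrow> good p (toggled 13 a (Dset s)) \<longrightarrow> Q (supp n (s' ''sol'')))"
      using e sw envf unfolding Q_def swept_def by auto
  qed
qed

end

section \<open>Weight tables and the complete program\<close>

primrec writes :: "(nat \<times> aexp) list \<Rightarrow> com" where
  "writes [] = Skip"
| "writes (e # l) = Seq (Write ''wt'' (Const (fst e)) (snd e)) (writes l)"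

text \<open>\<open>r\<close> evaluates to \<open>n * n\<close>, and \<open>b\<close> is
  \<open>4 n^2 + 4 n + 1\<close> built by repeated addition.\<close>

definition dom_table :: "(nat \<times> aexp) list" where
  "dom_table = (let m = rd ''n''; r = Read ''row'' m; d = Plus m (Const 1);
     b = Plus (Plus (Plus (Plus r r) (Plus r r)) (Plus (Plus m m) (Plus m m))) (Const 1)
   in [(0, Plus b b), (1, Const 1), (2, Const 0), (3, Const 0),
       (4, b), (5, Plus b d), (6, Plus (Plus b d) d), (7, Plus (Plus (Plus b d) d) d)])"

definition diss_table :: "(nat \<times> aexp) list" where
  "diss_table = [(0, Const 2), (1, Const 2), (2, Const 0), (3, Const 0),
     (4, Const 1), (5, Const 1), (6, Const 1), (7, Const 1)]"

definition clear_D :: com where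
  "clear_D = For ''i'' 0 (rd ''n'') (Write ''D'' (rd ''i'') (Const 0))"

definition phase :: "(nat \<times> aexp) list \<Rightarrow> com" where
  "phase l = Seq (writes l) (Seq clear_D (Seq local_search (nest 13 probe)))"

definition make_rows :: com where
  "make_rows = For ''i'' 0 (rd ''n'')
     (Write ''row'' (Plus (rd ''i'') (Const 1)) (Plus (Read ''row'' (rd ''i'')) (rd ''n'')))"

definition default_sol :: com where
  "default_sol = Seq (For ''i'' 0 (rd ''n'') (Write ''sol'' (rd ''i'') (Const 1))) (Write ''sol'' (rd ''p'') (Const 0))"

text \<open>The dominating set comes second so that it overwrites the result with the weaker size
  bound. If no probe succeeds, deleting everything but \<open>p\<close> remains as the
  answer.\<close>

definition mdd_program :: com where
  "mdd_program = Seq make_rows (Seq default_sol (Seq (phase diss_table) (phase dom_table)))"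

text \<open>The entries must not read \<open>wt\<close>, since they are evaluated while it is being
  filled.\<close>

lemma runs_writes:
  assumes "distinct (map fst l)"
    and "\<And>i e t t'. (i, e) \<in> set l \<Longrightarrow> keep {''wt''} t t' \<Longrightarrow> aval e t' = aval e t"
  shows "runs (writes l) s (sum_list (map (\<lambda>e. acost (snd e) + 2) l) + 1)
    (\<lambda>s'. keep {''wt''} s s' \<and> (\<forall>(i, e)\<in>set l. s' ''wt'' i = aval e s) \<and>
       (\<forall>i. i \<notin> fst ` set l \<longrightarrow> s' ''wt'' i = s ''wt'' i))"
  using assms
proof (induction l arbitrary: s)
  case Nil
  have "runs Skip s 1 (\<lambda>s'. keep {''wt''} s s' \<and> (\<forall>i. s' ''wt'' i = s ''wt'' i))"
    by (rule runs_Skip) simp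
  then show ?case by simp
next
  case (Cons ie l)
  obtain i e where ie: "ie = (i, e)" by (cases ie)
  let ?s1 = "upd ''wt'' i (aval e s) s"
  have "runs (writes (ie # l)) s ((acost e + 2) + (sum_list (map (\<lambda>e. acost (snd e) + 2) l) + 1))
    (\<lambda>s'. keep {''wt''} s s' \<and> (\<forall>(i, e)\<in>set (ie # l). s' ''wt'' i = aval e s) \<and>
       (\<forall>i. i \<notin> fst ` set (ie # l) \<longrightarrow> s' ''wt'' i = s ''wt'' i))"
    unfolding writes.simps
  proof (rule runs_Seq)
    show "runs (Write ''wt'' (Const (fst ie)) (snd ie)) s (acost e + 2) (\<lambda>s'. s' = ?s1)"
      by (rule runs_Write_upd) (simp_all add: ie)
  next
    fix s1 assume s1: "s1 = ?s1"
    then have k: "keep {''wt''} s s1" by simp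
    show "runs (writes l) s1 (sum_list (map (\<lambda>e. acost (snd e) + 2) l) + 1)
      (\<lambda>s'. keep {''wt''} s s' \<and> (\<forall>(i, e)\<in>set (ie # l). s' ''wt'' i = aval e s) \<and>
       (\<forall>i. i \<notin> fst ` set (ie # l) \<longrightarrow> s' ''wt'' i = s ''wt'' i))"
    proof (rule runs_mono[OF Cons.IH order_refl])
      show "distinct (map fst l)" using Cons.prems(1) by simp
      show "aval e' t' = aval e' t" if "(i', e') \<in> set l" "keep {''wt''} t t'" for i' e' t t'
        using Cons.prems(2)[of i' e' t t'] that by simp
      fix s' assume a: "keep {''wt''} s1 s' \<and> (\<forall>(i, e)\<in>set l. s' ''wt'' i = aval e s1) \<and>
        (\<forall>i. i \<notin> fst ` set l \<longrightarrow> s' ''wt'' i = s1 ''wt'' i)"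
      have "i \<notin> fst ` set l" using Cons.prems(1) ie by simp
      then have "s' ''wt'' i = aval e s" using a s1 by simp
      moreover have "aval e' s1 = aval e' s" if "(i', e') \<in> set l" for i' e'
        using Cons.prems(2)[of i' e' s s1] that k by simp
      ultimately show "keep {''wt''} s s' \<and> (\<forall>(i, e)\<in>set (ie # l). s' ''wt'' i = aval e s) \<and>
        (\<forall>i. i \<notin> fst ` set (ie # l) \<longrightarrow> s' ''wt'' i = s ''wt'' i)"
        using a k keep_trans[of "{''wt''}" s s1 s'] ie s1 by auto
    qed
  qed
  then show ?case by (simp add: ie algebra_simps)
qed

definition phase_time :: "nat \<Rightarrow> nat" where
  "phase_time n = 400 + ((n + 1) * 20 + 3) +
     ((n * (2 * (4 * (n * n) + 4 * n + 1)) + 2) * (nest_time n (attempt_time n) 13 + 9) + 3) + nest_time n (probe_time n) 13"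

definition program_time :: "nat \<Rightarrow> nat" where
  "program_time n = ((n + 1) * 40 + 3) + (((n + 1) * 20 + 3) + 4) + 2 * (phase_time n)"

context mdd_instance begin

text \<open>Only admissibility and size of the result matter here, so the entries of
  \<open>a\<close> are free; \<open>repairable\<close> bounds them because the loops have to meet
  the tuple.\<close>

definition reach :: "nat set \<Rightarrow> nat set \<Rightarrow> bool" where
  "reach D S \<longleftrightarrow> (\<exists>a. S = toggled 13 a D \<and> good p S)"

definition repairable :: "nat set \<Rightarrow> bool" where
  "repairable D \<longleftrightarrow> (\<exists>a. (\<forall>i<13. a i \<le> n) \<and> good p (toggled 13 a D))"

lemma runs_dom_table:
  assumes "env s"
  shows "runs (writes dom_table) s 400 (\<lambda>s'. keep {''wt''} s s' \<and> table_dom (s' ''wt''))"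
proof -
  have "runs (writes dom_table) s (sum_list (map (\<lambda>e. acost (snd e) + 2) dom_table) + 1)
    (\<lambda>s'. keep {''wt''} s s' \<and> (\<forall>(i, e)\<in>set dom_table. s' ''wt'' i = aval e s) \<and>
       (\<forall>i. i \<notin> fst ` set dom_table \<longrightarrow> s' ''wt'' i = s ''wt'' i))"
    by (rule runs_writes) (auto simp: dom_table_def Let_def keep_def)
  then show ?thesis
    by (rule runs_mono) (use assms in \<open>auto simp: dom_table_def table_dom_def Let_def env_def\<close>)
qed

lemma runs_diss_table:
  "runs (writes diss_table) s 400 (\<lambda>s'. keep {''wt''} s s' \<and> table_diss (s' ''wt''))"
proof -
  have "runs (writes diss_table) s (sum_list (map (\<lambda>e. acost (snd e) + 2) diss_table) + 1)
    (\<lambda>s'. keep {''wt''} s s' \<and> (\<forall>(i, e)\<in>set diss_table. s' ''wt'' i = aval e s) \<and>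
       (\<forall>i. i \<notin> fst ` set diss_table \<longrightarrow> s' ''wt'' i = s ''wt'' i))"
    by (rule runs_writes) (auto simp: diss_table_def)
  then show ?thesis
    by (rule runs_mono) (auto simp: diss_table_def table_diss_def)
qed

lemma runs_fill:
  assumes "env s" "b \<notin> {''n'', ''p'', ''row'', ''adj'', ''i''}"
  shows "runs (For ''i'' 0 (rd ''n'') (Write b (rd ''i'') (Const c))) s ((n + 1) * 20 + 3)
    (\<lambda>s'. keep {b, ''i''} s s' \<and> (\<forall>v<n. s' b v = c))"
proof -
  have "runs (For ''i'' 0 (rd ''n'') (Write b (rd ''i'') (Const c))) s ((n + 1) * (4 + acost (rd ''n'') + 10) + 3)
    (\<lambda>s'. keep {b, ''i''} s s' \<and> (\<forall>v<n. s' b v = c))"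
  proof (rule runs_For[where I = "\<lambda>k s'. keep {b, ''i''} s s' \<and> (\<forall>v<k. s' b v = c)"])
    fix k s' assume "k < n" "keep {b, ''i''} s s' \<and> (\<forall>v<k. s' b v = c)" "s' ''i'' 0 = k"
    then show "runs (Write b (rd ''i'') (Const c)) s' 4
      (\<lambda>s'. s' ''i'' 0 = k \<and> keep {b, ''i''} s (upd ''i'' 0 (Suc k) s') \<and> (\<forall>v<Suc k. upd ''i'' 0 (Suc k) s' b v = c))"
      using assms(2) by (intro runs_Write_upd) (auto simp: less_Suc_eq)
  next
    fix k s' assume "keep {b, ''i''} s s' \<and> (\<forall>v<k. s' b v = c)"
    then show "aval (rd ''n'') s' = n" using assms by (auto simp: env_def keep_def)
  qed (use assms in auto)
  then show ?thesis by (rule runs_mono) auto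
qed

text \<open>The search starts from the empty set, of potential \<open>n * w 0\<close>; the last
  hypothesis makes the number of sweeps polynomial.\<close>

lemma runs_phase:
  assumes "env s" "runs (writes l) s 400 (\<lambda>s'. keep {''wt''} s s' \<and> P (s' ''wt''))"
    and "\<And>w. P w \<Longrightarrow> w 0 \<le> 2 * (4 * (n * n) + 4 * n + 1)"
  shows "runs (phase l) s (phase_time n) (\<lambda>s'. env s' \<and> (\<exists>w D. P w \<and> D \<subseteq> {..<n} \<and> locally_minimal w D \<and>
    (s' ''sol'' = s ''sol'' \<or> reach D (supp n (s' ''sol''))) \<and>
    (repairable D \<longrightarrow> reach D (supp n (s' ''sol'')))))" (is "runs _ _ _ ?Q")
proof -
  let ?M = "n * (2 * (4 * (n * n) + 4 * n + 1))"
  let ?tl = "(?M + 2) * (nest_time n (attempt_time n) 13 + 9) + 3" and ?tp = "nest_time n (probe_time n) 13"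
  have "runs (phase l) s (400 + (((n + 1) * 20 + 3) + (?tl + ?tp))) ?Q"
    unfolding phase_def
  proof (rule runs_Seq[OF assms(2)])
    fix s1 assume s1: "keep {''wt''} s s1 \<and> P (s1 ''wt'')"
    have e1: "env s1" by (rule env_keep[OF assms(1), of "{''wt''}"]) (use s1 in auto)
    show "runs (Seq clear_D (Seq local_search (nest 13 probe))) s1 (((n + 1) * 20 + 3) + (?tl + ?tp)) ?Q"
      unfolding clear_D_def
    proof (rule runs_Seq[OF runs_fill[OF e1]])
      fix s2 assume s2: "keep {''D'', ''i''} s1 s2 \<and> (\<forall>v<n. s2 ''D'' v = 0)"
      have e2: "env s2" by (rule env_keep[OF e1, of "{''D'', ''i''}"]) (use s2 in auto)
      have w: "s2 ''wt'' = s1 ''wt''" "s2 ''sol'' = s ''sol''" using s1 s2 by (auto simp: keep_def)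
      have "Dset s2 = {}" using s2 by (auto simp: supp_def)
      then have "potential (s1 ''wt'') (Dset s2) = n * s1 ''wt'' 0" by (simp add: potential_def)
      also have "\<dots> \<le> ?M" using assms(3)[of "s1 ''wt''"] s1 by (intro mult_le_mono) auto
      finally have M: "potential (s1 ''wt'') (Dset s2) \<le> ?M" .
      show "runs (Seq local_search (nest 13 probe)) s2 (?tl + ?tp) ?Q"
      proof (rule runs_Seq[OF runs_local_search[OF e2 w(1) M]])
        fix s3 assume s3: "env s3 \<and> s3 ''wt'' = s1 ''wt'' \<and> s3 ''sol'' = s2 ''sol'' \<and> locally_minimal (s1 ''wt'') (Dset s3)"
        then have e3: "env s3" by blast
        show "runs (nest 13 probe) s3 ?tp ?Q"
        proof (rule runs_mono[OF runs_probe_all[OF e3] order_refl])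
          fix s' assume a: "env s' \<and>
            (s' ''sol'' = s3 ''sol'' \<or> (\<exists>a. supp n (s' ''sol'') = toggled 13 a (Dset s3) \<and> good p (supp n (s' ''sol'')))) \<and>
            (\<forall>a. (\<forall>i<13. a i \<le> n) \<longrightarrow> good p (toggled 13 a (Dset s3)) \<longrightarrow>
               (\<exists>a. supp n (s' ''sol'') = toggled 13 a (Dset s3) \<and> good p (supp n (s' ''sol''))))"
          have sub: "Dset s3 \<subseteq> {..<n}" by (auto simp: supp_def)
          have "(s' ''sol'' = s ''sol'' \<or> reach (Dset s3) (supp n (s' ''sol''))) \<and>
            (repairable (Dset s3) \<longrightarrow> reach (Dset s3) (supp n (s' ''sol'')))"
            using a s3 w unfolding reach_def repairable_def by metis
          then show "?Q s'" using a s1 s3 sub by blast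
        qed
      qed
    qed simp
  qed
  then show ?thesis by (rule runs_mono) (auto simp: phase_time_def)
qed

text \<open>The asymmetry between \<open>D1\<close> and \<open>D2\<close> reflects the order of the
  phases: a result obtained from \<open>D2\<close> may be overwritten by one from \<open>D1\<close>,
  never conversely.\<close>

lemma runs_program:
  assumes "s ''n'' 0 = n" "s ''p'' 0 = p" "s ''row'' = (\<lambda>_. 0)"
    and adj: "\<And>i j. i < n \<Longrightarrow> j < n \<Longrightarrow> s ''adj'' (i * n + j) = (if j \<in> N i then 1 else 0)"
  shows "runs mdd_program s (program_time n) (\<lambda>s'. \<exists>w1 w2 D1 D2.
    table_dom w1 \<and> D1 \<subseteq> {..<n} \<and> locally_minimal w1 D1 \<and>
    table_diss w2 \<and> D2 \<subseteq> {..<n} \<and> locally_minimal w2 D2 \<and>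
    (supp n (s' ''sol'') = {..<n} - {p} \<or> reach D1 (supp n (s' ''sol'')) \<or> reach D2 (supp n (s' ''sol''))) \<and>
    (repairable D1 \<longrightarrow> reach D1 (supp n (s' ''sol''))) \<and>
    (repairable D2 \<longrightarrow> reach D1 (supp n (s' ''sol'')) \<or> reach D2 (supp n (s' ''sol''))))" (is "runs _ _ _ ?Q")
proof -
  let ?body = "Write ''row'' (Plus (rd ''i'') (Const 1)) (Plus (Read ''row'' (rd ''i'')) (rd ''n''))"
  let ?I = "\<lambda>k s'. keep {''row'', ''i''} s s' \<and> (\<forall>i\<le>k. s' ''row'' i = i * n)"
  have rows: "runs make_rows s ((n + 1) * 40 + 3) (?I n)"
  proof -
    have "runs make_rows s ((n + 1) * (12 + acost (rd ''n'') + 10) + 3) (?I n)"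
      unfolding make_rows_def
    proof (rule runs_For[where I = ?I])
      fix k s' assume k: "k < n" and I: "?I k s'" and i: "s' ''i'' 0 = k"
      have e: "s' ''n'' 0 = n" "s' ''row'' k = k * n" using I assms(1) by (auto simp: keep_def)
      have kp: "keep {''row'', ''i''} s s'" using I by blast
      have "((s' ''row'')(Suc k := n + k * n)) j = j * n" if "j \<le> Suc k" for j
        using I that by (cases "j = Suc k") auto
      then show "runs ?body s' 12 (\<lambda>s'. s' ''i'' 0 = k \<and> ?I (Suc k) (upd ''i'' 0 (Suc k) s'))"
        using kp i e by (intro runs_Write_upd) (simp_all add: add.commute)
    next
      fix k s' assume "?I k s'"
      then show "aval (rd ''n'') s' = n" using assms(1) by (auto simp: keep_def)
    next
      show "?I 0 (upd ''i'' 0 0 s)" using assms(3) by simp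
    qed
    then show ?thesis by (rule runs_mono) auto
  qed
  have "runs mdd_program s (((n + 1) * 40 + 3) + ((((n + 1) * 20 + 3) + 4) + ((phase_time n) + (phase_time n)))) ?Q"
    unfolding mdd_program_def
  proof (rule runs_Seq[OF rows])
    fix s1 assume s1: "?I n s1"
    then have e1: "env s1" using assms by (auto simp: env_def keep_def)
    show "runs (Seq default_sol (Seq (phase diss_table) (phase dom_table))) s1
      ((((n + 1) * 20 + 3) + 4) + ((phase_time n) + (phase_time n))) ?Q"
    proof (rule runs_Seq)
      show "runs default_sol s1 (((n + 1) * 20 + 3) + 4) (\<lambda>s'. env s' \<and> supp n (s' ''sol'') = {..<n} - {p})"
        unfolding default_sol_def
      proof (rule runs_Seq[OF runs_fill[OF e1, of "''sol''" 1]])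
        fix s2 assume s2: "keep {''sol'', ''i''} s1 s2 \<and> (\<forall>v<n. s2 ''sol'' v = 1)"
        have e2: "env s2" by (rule env_keep[OF e1, of "{''sol'', ''i''}"]) (use s2 in auto)
        have "s2 ''p'' 0 = p" using e2 by (simp add: env_def)
        moreover have "env (upd ''sol'' p 0 s2)" by (rule env_keep[OF e2, of "{''sol''}"]) auto
        moreover have "supp n ((s2 ''sol'')(p := 0)) = {..<n} - {p}" using s2 by (auto simp: supp_def)
        ultimately show "runs (Write ''sol'' (rd ''p'') (Const 0)) s2 4 (\<lambda>s'. env s' \<and> supp n (s' ''sol'') = {..<n} - {p})"
          by (intro runs_Write_upd) simp_all
      qed simp
    next
      fix s2 assume s2: "env s2 \<and> supp n (s2 ''sol'') = {..<n} - {p}"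
      then have e2: "env s2" by blast
      show "runs (Seq (phase diss_table) (phase dom_table)) s2 ((phase_time n) + (phase_time n)) ?Q"
      proof (rule runs_Seq[OF runs_phase[OF e2 runs_diss_table]])
        fix s3 assume s3: "env s3 \<and> (\<exists>w D. table_diss w \<and> D \<subseteq> {..<n} \<and> locally_minimal w D \<and>
          (s3 ''sol'' = s2 ''sol'' \<or> reach D (supp n (s3 ''sol''))) \<and>
          (repairable D \<longrightarrow> reach D (supp n (s3 ''sol''))))"
        then have e3: "env s3" by blast
        show "runs (phase dom_table) s3 (phase_time n) ?Q"
        proof (rule runs_mono[OF runs_phase[OF e3 runs_dom_table[OF e3]] order_refl])
          fix s' assume s': "env s' \<and> (\<exists>w D. table_dom w \<and> D \<subseteq> {..<n} \<and> locally_minimal w D \<and>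
            (s' ''sol'' = s3 ''sol'' \<or> reach D (supp n (s' ''sol''))) \<and>
            (repairable D \<longrightarrow> reach D (supp n (s' ''sol''))))"
          obtain w2 D2 where 2: "table_diss w2" "D2 \<subseteq> {..<n}" "locally_minimal w2 D2"
            "s3 ''sol'' = s2 ''sol'' \<or> reach D2 (supp n (s3 ''sol''))"
            "repairable D2 \<longrightarrow> reach D2 (supp n (s3 ''sol''))" using s3 by blast
          obtain w1 D1 where 1: "table_dom w1" "D1 \<subseteq> {..<n}" "locally_minimal w1 D1"
            "s' ''sol'' = s3 ''sol'' \<or> reach D1 (supp n (s' ''sol''))"
            "repairable D1 \<longrightarrow> reach D1 (supp n (s' ''sol''))" using s' by blast
          have "supp n (s' ''sol'') = {..<n} - {p} \<or> reach D1 (supp n (s' ''sol'')) \<or> reach D2 (supp n (s' ''sol''))"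
            using 1(4) 2(4) s2 by metis
          moreover have "repairable D2 \<longrightarrow> reach D1 (supp n (s' ''sol'')) \<or> reach D2 (supp n (s' ''sol''))"
            using 1(4) 2(5) by metis
          ultimately show "?Q s'" using 1(1-3,5) 2(1-3) by blast
        qed (simp add: table_dom_def Let_def)
      qed (simp add: table_diss_def)
    qed
  qed
  then show ?thesis by (rule runs_mono) (auto simp: program_time_def)
qed

section \<open>Exchanges as tuples of toggles\<close>

lemma card_toggled_le:
  assumes "D \<subseteq> {..<n}"
  shows "card (toggled k a D) \<le> card D + k"
proof -
  have "toggled k a D \<subseteq> D \<union> a ` {..<k}"
  proof
    fix v assume v: "v \<in> toggled k a D"
    show "v \<in> D \<union> a ` {..<k}"
    proof (cases "v \<in> D")
      case False
      then have "odd (card {i. i < k \<and> a i = v})" using v by (simp add: toggled_def)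
      then have "card {i. i < k \<and> a i = v} \<noteq> 0" by (metis even_zero)
      then have "{i. i < k \<and> a i = v} \<noteq> {}" by (metis card.empty)
      then show ?thesis by auto
    qed simp
  qed
  then have "card (toggled k a D) \<le> card (D \<union> a ` {..<k})"
    using finite_subset[OF assms] by (intro card_mono) auto
  also have "\<dots> \<le> card D + card (a ` {..<k})" by (rule card_Un_le)
  also have "\<dots> \<le> card D + k" using card_image_le[of "{..<k}" a] by simp
  finally show ?thesis .
qed

lemma toggled_eq:
  assumes "D \<subseteq> {..<n}" "X \<subseteq> {..<n}" "card X \<le> k"
  obtains a where "\<And>i. i < k \<Longrightarrow> a i \<le> n" "toggled k a D = D - X \<union> (X - D)"
proof -
  have "finite X" using assms(2) by (rule finite_subset) simp
  then obtain xs where xs: "set xs = X" "distinct xs" using finite_distinct_list by blast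
  then have len: "length xs \<le> k" using assms(3) distinct_card by fastforce
  \<comment> \<open>Spare positions point to the dummy cell \<open>n\<close>.\<close>
  define a where "a i = (if i < length xs then xs ! i else n)" for i
  have c: "card {i. i < k \<and> a i = v} = (if v \<in> X then 1 else 0)" if v: "v < n" for v
  proof (cases "v \<in> X")
    case True
    then obtain j where j: "j < length xs" "xs ! j = v" using xs(1) by (metis in_set_conv_nth)
    have "{i. i < k \<and> a i = v} = {j}"
      using j len v xs(2) by (auto simp: a_def nth_eq_iff_index_eq split: if_splits)
    then show ?thesis using True by simp
  next
    case False
    then have e: "{i. i < k \<and> a i = v} = {}" using v xs(1) by (auto simp: a_def split: if_splits)
    show ?thesis unfolding e using False by simp
  qed
  have "toggled k a D = D - X \<union> (X - D)"
    using assms(1,2) c unfolding toggled_def by (auto split: if_splits)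
  moreover have "a i \<le> n" if "i < k" for i
  proof (cases "i < length xs")
    case True
    then have "xs ! i < n" using nth_mem[of i xs] xs(1) assms(2) by blast
    then show ?thesis using True by (simp add: a_def)
  qed (simp add: a_def)
  ultimately show thesis using that by blast
qed

end

lemma pbound_nest_time: "pbound T \<Longrightarrow> pbound (\<lambda>n. nest_time n (T n) k)"
  by (induction k) (auto intro!: pbound_add pbound_mult)

lemma pbound_program_time: "pbound program_time"
proof -
  have "pbound attempt_time" "pbound probe_time"
    unfolding attempt_time_def[abs_def] probe_time_def[abs_def]
    by (intro pbound_add pbound_mult pbound_const pbound_id)+
  then have "pbound phase_time"
    unfolding phase_time_def[abs_def] by (intro pbound_add pbound_mult pbound_nest_time pbound_const pbound_id)
  then show ?thesis
    unfolding program_time_def[abs_def] by (intro pbound_add pbound_mult pbound_const pbound_id)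
qed

text \<open>Each store in \<open>F\<close> differs from \<open>\<sigma>\<close> in some cell; the
  test compares these finitely many cells with the constants found in
  \<open>\<sigma>\<close>.\<close>

lemma separating_test:
  assumes "finite F" "\<sigma> \<notin> F"
  shows "\<exists>b. bval b \<sigma> \<and> (\<forall>\<tau>\<in>F. \<not> bval b \<tau>)"
  using assms
proof (induction F rule: finite_induct)
  case empty
  show ?case by (rule exI[of _ "Equal (Const 0) (Const 0)"]) simp
next
  case (insert \<tau> F)
  then obtain b where b: "bval b \<sigma>" "\<forall>\<tau>\<in>F. \<not> bval b \<tau>" by blast
  have "\<sigma> \<noteq> \<tau>" using insert.prems by blast
  then obtain x i where "\<sigma> x i \<noteq> \<tau> x i" by (meson ext)
  then show ?case using b
    by (intro exI[of _ "Conj (Equal (Read x (Const i)) (Const (\<sigma> x i))) b"]) auto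
qed

lemma constant_output:
  assumes "finite A"
  shows "\<exists>c T. \<forall>s. runs c s T (\<lambda>s'. s' ''sol'' = (\<lambda>v. if v \<in> A then 1 else s ''sol'' v))"
  using assms
proof (induction A rule: finite_induct)
  case empty
  show ?case by (intro exI[of _ Skip] exI[of _ 1] allI runs_Skip) simp
next
  case (insert a A)
  then obtain c T where c: "runs c s T (\<lambda>s'. s' ''sol'' = (\<lambda>v. if v \<in> A then 1 else s ''sol'' v))" for s by blast
  have "runs (Seq c (Write ''sol'' (Const a) (Const 1))) s (T + 3)
    (\<lambda>s'. s' ''sol'' = (\<lambda>v. if v \<in> insert a A then 1 else s ''sol'' v))" for s
    by (rule runs_Seq[OF c], rule runs_Write_upd) (auto simp: fun_eq_iff)
  then show ?case by blast
qed

text \<open>A cascade of separating tests. As \<open>sol\<close> is zero at the start, each branch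
  only writes the ones of its answer.\<close>

lemma finite_lookup:
  fixes F :: "store set"
  assumes "finite F" "\<And>\<sigma>. \<sigma> \<in> F \<Longrightarrow> finite (g \<sigma>) \<and> \<sigma> ''sol'' = (\<lambda>_. 0)"
  shows "\<exists>c T. \<forall>\<sigma>\<in>F. runs c \<sigma> T (\<lambda>s'. \<forall>v. s' ''sol'' v \<noteq> 0 \<longleftrightarrow> v \<in> g \<sigma>)"
  using assms
proof (induction F rule: finite_induct)
  case empty
  show ?case by simp
next
  case (insert \<sigma> F)
  then obtain c T where c: "\<forall>\<tau>\<in>F. runs c \<tau> T (\<lambda>s'. \<forall>v. s' ''sol'' v \<noteq> 0 \<longleftrightarrow> v \<in> g \<tau>)" by blast
  obtain b where b: "bval b \<sigma>" "\<forall>\<tau>\<in>F. \<not> bval b \<tau>" using separating_test insert.hyps by blast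
  have g: "finite (g \<sigma>)" "\<sigma> ''sol'' = (\<lambda>_. 0)" using insert.prems by auto
  obtain d U where d: "runs d s U (\<lambda>s'. s' ''sol'' = (\<lambda>v. if v \<in> g \<sigma> then 1 else s ''sol'' v))" for s
    using constant_output[OF g(1)] by blast
  have dg: "runs d \<sigma> U (\<lambda>s'. \<forall>v. s' ''sol'' v \<noteq> 0 \<longleftrightarrow> v \<in> g \<sigma>)"
    by (rule runs_mono[OF d order_refl]) (use g(2) in simp)
  have "runs (Cond b d c) \<tau> (bcost b + max U T + 1) (\<lambda>s'. \<forall>v. s' ''sol'' v \<noteq> 0 \<longleftrightarrow> v \<in> g \<tau>)"
    if "\<tau> \<in> insert \<sigma> F" for \<tau>
    by (rule runs_Cond) (use that b c dg in auto)
  then show ?case by blast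
qed

section \<open>The theorem\<close>

definition nbhd :: "'a set set \<Rightarrow> 'a \<Rightarrow> 'a set" where
  "nbhd E v = {w. {v, w} \<in> E}"

lemma vertex_degree_nbhd:
  assumes "\<And>e. e \<in> E \<Longrightarrow> card e = 2"
  shows "vertex_degree E v = card (nbhd E v)"
proof -
  have "{e \<in> E. v \<in> e} = (\<lambda>w. {v, w}) ` nbhd E v"
  proof
    show "{e \<in> E. v \<in> e} \<subseteq> (\<lambda>w. {v, w}) ` nbhd E v"
    proof
      fix e assume e: "e \<in> {e \<in> E. v \<in> e}"
      then obtain a b where "e = {a, b}" using assms[of e] by (auto simp: card_2_iff)
      then have "e = {v, if v = a then b else a}" using e by auto
      then show "e \<in> (\<lambda>w. {v, w}) ` nbhd E v" using e unfolding nbhd_def by blast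
    qed
  qed (auto simp: nbhd_def)
  moreover have "inj_on (\<lambda>w. {v, w}) (nbhd E v)"
    by (auto simp: inj_on_def doubleton_eq_iff)
  ultimately show ?thesis by (simp add: vertex_degree_def card_image)
qed

lemma cubic_graph_nbhd:
  assumes "cubic_graph V E"
  shows "cubic_nbhd V (nbhd E)"
proof
  have E: "e \<subseteq> V" "card e = 2" if "e \<in> E" for e
    using assms that by (auto simp: cubic_graph_def simple_graph_def)
  show "finite V" using assms by (simp add: cubic_graph_def simple_graph_def)
  show "nbhd E v \<subseteq> V" for v using E(1) by (auto simp: nbhd_def)
  show "v \<in> nbhd E w" if "w \<in> nbhd E v" for v w using that by (simp add: nbhd_def insert_commute)
  show "v \<notin> nbhd E v" for v using E(2)[of "{v}"] by (auto simp: nbhd_def)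
  show "card (nbhd E v) = 3" if "v \<in> V" for v
    using vertex_degree_nbhd[of E v] E(2) assms that by (simp add: cubic_graph_def)
qed

text \<open>In a cubic graph the degree left after the deletion is 3 minus the number of deleted
  neighbours, so maximal degree means fewest deleted neighbours.\<close>

lemma mdd_max_feasible_iff_good:
  assumes "cubic_graph V E" "p \<in> V"
  shows "mdd_max_feasible V E p S \<longleftrightarrow> S \<subseteq> V \<and> cubic_nbhd.good V (nbhd E) p S"
proof -
  interpret cubic_nbhd V "nbhd E" by (rule cubic_graph_nbhd[OF assms(1)])
  have deg: "vertex_degree (induced_edges E (V - S)) v = 3 - card (nbhd E v \<inter> S)" if v: "v \<in> V - S" for v
  proof -
    have "vertex_degree (induced_edges E (V - S)) v = card (nbhd (induced_edges E (V - S)) v)"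
      by (rule vertex_degree_nbhd)
        (use assms(1) in \<open>auto simp: induced_edges_def cubic_graph_def simple_graph_def\<close>)
    also have "nbhd (induced_edges E (V - S)) v = nbhd E v - S"
      using v N_sub[of v] by (auto simp: nbhd_def induced_edges_def)
    finally show ?thesis using card_N_Diff v by simp
  qed
  have less: "3 - card (nbhd E v \<inter> S) < 3 - card (nbhd E p \<inter> S) \<longleftrightarrow> card (nbhd E p \<inter> S) < card (nbhd E v \<inter> S)" for v
    using card_N_Int[of v S] card_N_Int[of p S] by linarith
  have "unique_max_degree_vertex (V - S) (induced_edges E (V - S)) p \<longleftrightarrow> good p S"
  proof (cases "p \<in> S")
    case False
    then have "p \<in> V - S" using assms(2) by simp
    then show ?thesis
      unfolding unique_max_degree_vertex_def good_def using deg less by auto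
  qed (simp add: unique_max_degree_vertex_def good_def)
  then show ?thesis unfolding mdd_max_feasible_def by (auto simp: good_def)
qed

lemma mdd_max_opt_attained:
  assumes "finite V" "p \<in> V"
  obtains S where "mdd_max_feasible V E p S" "card S = mdd_max_opt V E p"
proof -
  let ?C = "card ` {S. mdd_max_feasible V E p S}"
  have "finite ?C" using finite_mdd_max_feasible[OF assms(1)] by blast
  moreover have "?C \<noteq> {}" using mdd_max_feasible_all[OF assms(2)] by blast
  ultimately have "Min ?C \<in> ?C" by (rule Min_in)
  then obtain S where "mdd_max_feasible V E p S" "card S = Min ?C" by auto
  then show thesis using that by (simp add: mdd_max_opt_def)
qed

lemma mdd_input_adj:
  assumes "i < n" "j < n"
  shows "mdd_input n E p ''adj'' (i * n + j) = (if j \<in> nbhd E i then 1 else 0)"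
proof -
  have "i * n + j < (i + 1) * n" using assms(2) by simp
  also have "\<dots> \<le> n * n" using assms(1) by (intro mult_le_mono) auto
  finally have "i * n + j < n * n" .
  then show ?thesis using assms(2) by (simp add: mdd_input_def nbhd_def)
qed

text \<open>A lookup table answers per store; since the store determines the instance, the answer
  picked for it is optimal for the instance at hand.\<close>

lemma mdd_input_inject:
  assumes "mdd_input n E p = mdd_input n' E' p'"
    and "simple_graph {..<n} E" "simple_graph {..<n'} E'"
  shows "n = n'" "p = p'" "E = E'"
proof -
  have "mdd_input n E p ''n'' 0 = mdd_input n' E' p' ''n'' 0" "mdd_input n E p ''p'' 0 = mdd_input n' E' p' ''p'' 0"
    using assms(1) by simp_all
  then show n: "n = n'" and "p = p'" by (simp_all add: mdd_input_def)
  have sub: "A \<subseteq> B" if AB: "mdd_input n A p = mdd_input n B q" "simple_graph {..<n} A" for A B q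
  proof
    fix e assume e: "e \<in> A"
    then obtain a b where ab: "e = {a, b}" "a < n" "b < n"
      using AB(2) by (force simp: simple_graph_def card_2_iff)
    have "mdd_input n A p ''adj'' (a * n + b) = mdd_input n B q ''adj'' (a * n + b)" using AB(1) by simp
    then have "b \<in> nbhd A a \<longleftrightarrow> b \<in> nbhd B a" using ab mdd_input_adj by (simp split: if_splits)
    then show "e \<in> B" using e ab by (simp add: nbhd_def)
  qed
  show "E = E'" using sub[of E E' p'] sub[of E' E p] assms n \<open>p = p'\<close> by auto
qed

section \<open>Approximation ratio of the output\<close>

context mdd_instance begin

lemma reach_card:
  assumes "reach D S" "D \<subseteq> {..<n}"
  shows "card S \<le> card D + 13" "good p S" "S \<subseteq> {..<n}"
  using assms card_toggled_le[of D 13] by (auto simp: reach_def toggled_def)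

lemma locally_minimal_near:
  assumes "locally_minimal w D" "D \<subseteq> {..<n}"
  shows "minimal_near w D"
  unfolding minimal_near_def
proof (intro conjI allI impI)
  fix X :: "nat set" assume X: "X \<subseteq> {..<n}" "card X \<le> 13"
  obtain a where "\<And>i. i < 13 \<Longrightarrow> a i \<le> n" "toggled 13 a D = D - X \<union> (X - D)"
    by (rule toggled_eq[OF assms(2) X]) blast
  then show "potential w D \<le> potential w (D - X \<union> (X - D))"
    using assms(1) unfolding locally_minimal_def by metis
qed (rule assms(2))

lemma repairable_near:
  assumes "D \<subseteq> {..<n}" "X \<subseteq> {..<n}" "card X \<le> 13" "good p (D - X \<union> (X - D))"
  shows "repairable D"
proof -
  obtain a where "\<And>i. i < 13 \<Longrightarrow> a i \<le> n" "toggled 13 a D = D - X \<union> (X - D)"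
    by (rule toggled_eq[OF assms(1-3)]) blast
  then show ?thesis unfolding repairable_def using assms(4) by metis
qed

lemma output_ratio:
  assumes "table_dom w1" "D1 \<subseteq> {..<n}" "locally_minimal w1 D1"
    and "table_diss w2" "D2 \<subseteq> {..<n}" "locally_minimal w2 D2"
    and "S = {..<n} - {p} \<or> reach D1 S \<or> reach D2 S"
    and "repairable D1 \<Longrightarrow> reach D1 S" "repairable D2 \<Longrightarrow> reach D1 S \<or> reach D2 S"
    and S0: "good p S0" "S0 \<subseteq> {..<n}" and n: "n \<ge> 20000"
  shows "good p S" "S \<subseteq> {..<n}" "real (card S) \<le> 1.583 * real (card S0)"
proof -
  have pV: "p \<in> {..<n}" using p_less by simp
  show good: "good p S" and sub: "S \<subseteq> {..<n}"
    using assms(7) reach_card(2,3)[of D1 S] reach_card(2,3)[of D2 S] assms(2,5) by (auto simp: good_def)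
  note dom = minimal_near_dom_bound[OF assms(1) locally_minimal_near[OF assms(3,2)]]
  note diss = minimal_near_diss_bound[OF assms(4) locally_minimal_near[OF assms(6,5)]]
  have b1: "card S \<le> card D1 + 13" if "reach D1 S" using reach_card(1)[OF that assms(2)] .
  have b2: "card S \<le> card D2 + 13" if "reach D2 S" using reach_card(1)[OF that assms(5)] .
  note lower = good_card_ge[OF S0 pV]
  consider (whole) "card (N p \<inter> S0) = 0" | (two) "card (N p \<inter> S0) = 1" | (all) "S0 = {..<n} - {p}"
    using good_cases[OF S0 pV] by metis
  then show "real (card S) \<le> 1.583 * real (card S0)"
  proof cases
    case whole
    then have "N p \<inter> S0 = {}" by simp
    then obtain X where "X \<subseteq> {..<n}" "card X \<le> 13" "good p (D1 - X \<union> (X - D1))"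
      by (rule repair_dominating[OF dom(2) S0(1) pV S0(2)])
    then have "reach D1 S" using assms(8) repairable_near[OF assms(2)] by blast
    then have "38 * card S \<le> 15 * n + 38 * 13" using b1 dom(1) by simp
    moreover have "n - 1 \<le> 4 * card S0" using lower(1) by simp
    ultimately have "38 * real (card S) \<le> 15 * real n + 494" "real n - 1 \<le> 4 * real (card S0)"
      using n by linarith+
    \<comment> \<open>\<open>1.583 / 4\<close> exceeds \<open>15 / 38\<close> by about 0.00101; from
      20000 vertices on, this slack pays for the 13 extra vertices and for the
      \<open>- 1\<close>.\<close>
    then show ?thesis using n by (simp add: field_simps)
  next
    case two
    then have ne: "N p \<inter> S0 \<noteq> {}" by auto
    obtain X where "X \<subseteq> {..<n}" "card X \<le> 13" "good p (D2 - X \<union> (X - D2))"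
      by (rule repair_dissociation[OF assms(5) diss(1) S0(1) pV two])
    then have "reach D1 S \<or> reach D2 S" using assms(9) repairable_near[OF assms(5)] by blast
    \<comment> \<open>A result obtained from \<open>D1\<close> is covered as well, because
      \<open>15/38 < 3/5\<close>.\<close>
    then have "5 * card S \<le> 3 * n + 65" using b1 b2 dom(1) diss(2) by auto
    moreover have "2 * n \<le> 5 * card S0 + 2" using lower(2)[OF ne] by simp
    ultimately have "real (5 * card S) \<le> real (3 * n + 65)" "real (2 * n) \<le> real (5 * card S0 + 2)"
      by (simp_all only: of_nat_le_iff)
    then show ?thesis using n by (simp add: field_simps)
  next
    case all
    have "S \<subseteq> {..<n} - {p}" using good sub by (auto simp: good_def)
    then have "card S \<le> card S0" unfolding all by (intro card_mono) auto
    then show ?thesis by simp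
  qed
qed

end

text \<open>Only finitely many inputs are involved, so a program that tests for each of them exists without being
  exhibited.\<close>

lemma small_instances:
  "\<exists>c T. \<forall>n E p. n < m \<longrightarrow> cubic_graph {..<n} E \<longrightarrow> p < n \<longrightarrow>
     runs c (mdd_input n E p) T (\<lambda>s. mdd_max_feasible {..<n} E p (mdd_output n s) \<and>
       card (mdd_output n s) = mdd_max_opt {..<n} E p)"
proof -
  let ?valid = "\<lambda>\<sigma> n E p. n < m \<and> cubic_graph {..<n} E \<and> p < n \<and> \<sigma> = mdd_input n E p"
  let ?F = "{\<sigma>. \<exists>n E p. ?valid \<sigma> n E p}"
  let ?opt = "\<lambda>\<sigma> S. \<exists>n E p. ?valid \<sigma> n E p \<and> mdd_max_feasible {..<n} E p S \<and> card S = mdd_max_opt {..<n} E p"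
  define g where "g \<sigma> = (SOME S. ?opt \<sigma> S)" for \<sigma>
  have "?F \<subseteq> (\<lambda>(n, E, p). mdd_input n E p) ` ({..<m} \<times> Pow (Pow {..<m}) \<times> {..<m})"
  proof
    fix \<sigma> assume "\<sigma> \<in> ?F"
    then obtain n E p where v: "?valid \<sigma> n E p" by blast
    then have "E \<subseteq> Pow {..<m}" by (force simp: cubic_graph_def simple_graph_def)
    then have "(n, E, p) \<in> {..<m} \<times> Pow (Pow {..<m}) \<times> {..<m}" using v by simp
    then show "\<sigma> \<in> (\<lambda>(n, E, p). mdd_input n E p) ` ({..<m} \<times> Pow (Pow {..<m}) \<times> {..<m})"
      using v by force
  qed
  then have fin: "finite ?F" by (rule finite_subset) simp
  have g: "?opt \<sigma> (g \<sigma>)" if F: "\<sigma> \<in> ?F" for \<sigma>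
  proof -
    obtain n E p where v: "?valid \<sigma> n E p" using F by blast
    then obtain S where "mdd_max_feasible {..<n} E p S" "card S = mdd_max_opt {..<n} E p"
      using mdd_max_opt_attained[of "{..<n}" p E] by auto
    then have "\<exists>S. ?opt \<sigma> S" using v by blast
    then show ?thesis unfolding g_def by (rule someI_ex)
  qed
  have "finite (g \<sigma>) \<and> \<sigma> ''sol'' = (\<lambda>_. 0)" if F: "\<sigma> \<in> ?F" for \<sigma>
  proof -
    obtain n E p where v: "?valid \<sigma> n E p" and "mdd_max_feasible {..<n} E p (g \<sigma>)" using g[OF F] by blast
    then have "g \<sigma> \<subseteq> {..<n}" by (auto simp: mdd_max_feasible_def)
    then show ?thesis using v finite_subset by (auto simp: mdd_input_def)
  qed
  then obtain c T where c: "\<forall>\<sigma>\<in>?F. runs c \<sigma> T (\<lambda>s'. \<forall>v. s' ''sol'' v \<noteq> 0 \<longleftrightarrow> v \<in> g \<sigma>)"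
    using finite_lookup[OF fin, of g] by blast
  show ?thesis
  proof (intro exI allI impI)
    fix n E p assume v: "n < m" "cubic_graph {..<n} E" "p < n"
    let ?\<sigma> = "mdd_input n E p"
    have F: "?\<sigma> \<in> ?F" using v by blast
    obtain n' E' p' where v': "?valid ?\<sigma> n' E' p'"
      and o: "mdd_max_feasible {..<n'} E' p' (g ?\<sigma>)" "card (g ?\<sigma>) = mdd_max_opt {..<n'} E' p'"
      using g[OF F] by blast
    have eq: "n = n'" "p = p'" "E = E'"
      using mdd_input_inject[of n E p n' E' p'] v v' by (auto simp: cubic_graph_def)
    show "runs c ?\<sigma> T (\<lambda>s. mdd_max_feasible {..<n} E p (mdd_output n s) \<and>
       card (mdd_output n s) = mdd_max_opt {..<n} E p)"
    proof (rule runs_mono[OF bspec[OF c F] order_refl])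
      fix s' :: store assume a: "\<forall>v. s' ''sol'' v \<noteq> 0 \<longleftrightarrow> v \<in> g ?\<sigma>"
      have "g ?\<sigma> \<subseteq> {..<n}" using o(1) eq by (auto simp: mdd_max_feasible_def)
      then have "mdd_output n s' = g ?\<sigma>" using a by (auto simp: mdd_output_def)
      then show "mdd_max_feasible {..<n} E p (mdd_output n s') \<and> card (mdd_output n s') = mdd_max_opt {..<n} E p"
        using o eq by simp
    qed
  qed
qed

lemma large_instances:
  assumes "cubic_graph {..<n} E" "p < n" "n \<ge> 20000"
  shows "runs mdd_program (mdd_input n E p) (program_time n)
    (\<lambda>s. mdd_max_feasible {..<n} E p (mdd_output n s) \<and>
       real (card (mdd_output n s)) \<le> 1.583 * real (mdd_max_opt {..<n} E p))"
proof -
  interpret cubic_nbhd "{..<n}" "nbhd E" by (rule cubic_graph_nbhd[OF assms(1)])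
  interpret mdd_instance n "nbhd E" p by unfold_locales (rule assms(2))
  obtain S0 where S0: "mdd_max_feasible {..<n} E p S0" "card S0 = mdd_max_opt {..<n} E p"
    using mdd_max_opt_attained[of "{..<n}" p E] assms(2) by auto
  have iff: "mdd_max_feasible {..<n} E p S \<longleftrightarrow> S \<subseteq> {..<n} \<and> good p S" for S
    using mdd_max_feasible_iff_good[OF assms(1)] assms(2) by simp
  show ?thesis
  proof (rule runs_mono[OF runs_program order_refl])
    show "mdd_input n E p ''n'' 0 = n" "mdd_input n E p ''p'' 0 = p" "mdd_input n E p ''row'' = (\<lambda>_. 0)"
      by (auto simp: mdd_input_def)
    show "mdd_input n E p ''adj'' (i * n + j) = (if j \<in> nbhd E i then 1 else 0)" if "i < n" "j < n" for i j
      by (rule mdd_input_adj[OF that])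
  next
    fix s
    let ?S = "supp n (s ''sol'')"
    assume "\<exists>w1 w2 D1 D2.
      table_dom w1 \<and> D1 \<subseteq> {..<n} \<and> locally_minimal w1 D1 \<and>
      table_diss w2 \<and> D2 \<subseteq> {..<n} \<and> locally_minimal w2 D2 \<and>
      (?S = {..<n} - {p} \<or> reach D1 ?S \<or> reach D2 ?S) \<and>
      (repairable D1 \<longrightarrow> reach D1 ?S) \<and> (repairable D2 \<longrightarrow> reach D1 ?S \<or> reach D2 ?S)"
    then obtain w1 w2 D1 D2 where *: "table_dom w1" "D1 \<subseteq> {..<n}" "locally_minimal w1 D1"
      "table_diss w2" "D2 \<subseteq> {..<n}" "locally_minimal w2 D2"
      "?S = {..<n} - {p} \<or> reach D1 ?S \<or> reach D2 ?S"
      "repairable D1 \<Longrightarrow> reach D1 ?S" "repairable D2 \<Longrightarrow> reach D1 ?S \<or> reach D2 ?S" by blast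
    have o: "mdd_output n s = ?S" by (simp add: mdd_output_def supp_def)
    have "good p S0" "S0 \<subseteq> {..<n}" using S0(1) iff by blast+
    from output_ratio[OF * this assms(3)]
    show "mdd_max_feasible {..<n} E p (mdd_output n s) \<and>
       real (card (mdd_output n s)) \<le> 1.583 * real (mdd_max_opt {..<n} E p)"
      unfolding o iff S0(2)[symmetric] by blast
  qed
qed

theorem theorem11:
  "\<exists>(c :: com) (q :: nat poly). \<forall>(n :: nat) (E :: nat set set) (p :: nat).
     cubic_graph {..<n} E \<longrightarrow> p < n \<longrightarrow>
       (\<exists>t s. exec c (mdd_input n E p) t s \<and> t \<le> poly q n \<and>
          mdd_max_feasible {..<n} E p (mdd_output n s) \<and>
          real (card (mdd_output n s)) \<le> 1.583 * real (mdd_max_opt {..<n} E p))"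
proof -
  obtain c T where small: "\<And>n E p. n < 20000 \<Longrightarrow> cubic_graph {..<n} E \<Longrightarrow> p < n \<Longrightarrow>
     runs c (mdd_input n E p) T (\<lambda>s. mdd_max_feasible {..<n} E p (mdd_output n s) \<and>
       card (mdd_output n s) = mdd_max_opt {..<n} E p)"
    using small_instances[of 20000] by blast
  let ?b = "Less (rd ''n'') (Const 20000)"
  \<comment> \<open>A sum in place of the maximum of the two branches, so that closure of
    \<open>pbound\<close> under addition applies.\<close>
  let ?T = "\<lambda>n. bcost ?b + (T + program_time n) + 1"
  have "pbound ?T" by (intro pbound_add pbound_const pbound_program_time)
  then obtain q :: "nat poly" where q: "\<And>n. ?T n \<le> poly q n" unfolding pbound_def by blast
  have "runs (Cond ?b c mdd_program) (mdd_input n E p) (poly q n)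
      (\<lambda>s. mdd_max_feasible {..<n} E p (mdd_output n s) \<and>
        real (card (mdd_output n s)) \<le> 1.583 * real (mdd_max_opt {..<n} E p))" (is "runs _ _ _ ?Q")
    if g: "cubic_graph {..<n} E" "p < n" for n E p
  proof -
    have "runs (Cond ?b c mdd_program) (mdd_input n E p) (bcost ?b + max T (program_time n) + 1) ?Q"
    proof (rule runs_Cond)
      assume "bval ?b (mdd_input n E p)"
      then have "n < 20000" by (simp add: mdd_input_def)
      from small[OF this g] show "runs c (mdd_input n E p) T ?Q" by (rule runs_mono) auto
    next
      assume "\<not> bval ?b (mdd_input n E p)"
      then have "n \<ge> 20000" by (simp add: mdd_input_def)
      then show "runs mdd_program (mdd_input n E p) (program_time n) ?Q" by (rule large_instances[OF g])
    qed
    then show ?thesis by (rule runs_mono) (use q[of n] in auto)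
  qed
  then show ?thesis unfolding runs_def by blast
qed

end
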